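(* Let $F$ be a germ of biholomorphism of $\mathbb{C}^n$ fixing $0$, with diagonal differential $dF_0=\mathrm{Diag}(\lambda_1,\dots,\lambda_n)$, which is $m$-resonant with respect to all eigenvalues $\{\lambda_1,\dots,\lambda_n\}$ and of weighted order $k_0$. Assume that $|\lambda_j|=1$ for all $j=1,\dots,n$. If $F$ is parabolically attracting, then there exist (at least) $k_0$ repelling basins for $F$ having $0$ on the boundary.
   Context: Conventions: $\mathbb{N}=\{0,1,2,\dots\}$; for a multi-index $Q=(q_1,\dots,q_n)$, $|Q|=\sum_h q_h$ and $z^Q=\prod_h z_h^{q_h}$; $e_j$ is the $j$-th unit vector; $D=dF_0=\mathrm{Diag}(\lambda_1,\dots,\lambda_n)$. Resonances. A resonance is a pair $(j,L)$ with $j\in\{1,\dots,n\}$, $L\in\mathbb{N}^n$, $|L|\ge2$ and $\lambda_j=\lambda^L$. $F$ is $m$-resonant ($m\ge 1$) with respect to all eigenvalues if there are $m$ multi-indices $P^1,\dots,P^m\in\mathbb{N}^n$, linearly independent over $\mathbb{Q}$, such that the resonances $(j,L)$, $1\le j\le n$, are precisely those of the form $L=e_j+k_1P^1+\dots+k_mP^m$ with $k_1,\dots,k_m\in\mathbb{N}$ and $k_1+\dots+k_m\ge1$. The $P^t$ are called generators; they are unique up to order. Write $P^t=(p^t_1,\dots,p^t_n)$ and, for $K=(k_1,\dots,k_m)\in\mathbb{N}^m$, $K\mathbf{P}=\sum_{t=1}^m k_tP^t$. Normal form and weighted order. By the Poincaré–Dulac theorem, a (possibly formal) change of coordinates tangent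 to the identity conjugates $F$ to a (possibly formal) Poincaré–Dulac normal form $$\widetilde F(z)=Dz+\sum_{s=1}^n\ \sum_{K\in\mathbb{N}^m,\ K\ne0}a_{K,s}\,z^{K\mathbf{P}}z_s\,e_s.$$ The weighted order $k_0$ of $F$ is the minimal $|K|\ge 1$ such that $a_{K,s}\neq0$ for some $1\le s\le n$ ($k_0=+\infty$ if there is none); it does not depend on the normal form. Parabolic shadow. If $k_0<\infty$, the parabolic shadow of $F$ associated with $\widetilde F$ is the map $f(u)=u+H_{k_0+1}(u)$ of $\mathbb{C}^m$, where the $t$-th component of $H_{k_0+1}$, $t=1,\dots,m$, is $$u_t\sum_{K\in\mathbb{N}^m,\,|K|=k_0}\Big(p^t_1\frac{a_{K,1}}{\lambda_1}+\dots+p^t_n\frac{a_{K,n}}{\lambda_n}\Big)u^K.$$ Characteristic directions. A vector $v\in\mathbb{C}^m\setminus\{0\}$ is a non-degenerate characteristic direction of $f$ if $H_{k_0+1}(v)=\tau v$ with $\tau\neq0$. Then $[v]\in\mathbb{CP}^{m-1}$ is a fixed point of the rational self-map $\widetilde H_{k_0+1}$ of $\mathbb{CP}^{m-1}$ induced by $H_{k_0+1}$. The directors of $[v]$ are the eigenvalues of $\frac1{k_0}\big(d(\widetilde H_{k_0+1})_{[v]}-\mathrm{id}\big)$ on $T_{[v]}\mathbb{CP}^{m-1}$. $[v]$ is fully attractive if all directors have strictly positive real part (vacuous for $m=1$). A representative $v$ is normalized if $H_{k_0+1}(v)=-\frac1{k_0}v$. $F$ is parabolically attracting if for some parabolic shadow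 $f$ (with coefficients $a_{K,j}$) there is a normalized representative $v$ of a fully attractive non-degenerate characteristic direction of $f$ such that $$\mathrm{Re}\Big(\sum_{K\in\mathbb{N}^m,\,|K|=k_0}\frac{a_{K,j}}{\lambda_j}v^K\Big)<0,\qquad j=1,\dots,n.$$ Basins. A (local) basin of attraction at $0$ for a germ $G$ of biholomorphism of $\mathbb{C}^n$ fixing $0$ is a nonempty (not necessarily connected) open set $U\subset\mathbb{C}^n$ with $0\in\overline U$, contained in the domain of definition of $G$, with $G(U)\subseteq U$ and $G^{\circ\ell}(z)\to0$ as $\ell\to\infty$ for every $z\in U$. A repelling basin for $F$ is a basin of attraction for $F^{-1}$. *)

theory Defs
  imports "HOL-Analysis.Analysis"
begin

section \<open>Multi-indices\<close>

text \<open>A multi-index in \<open>\<nat>\<^sup>n\<close> is a vector of type \<open>nat ^ 'n\<close>; the unit vector \<open>e\<^sub>j\<close> is \<open>axis j 1\<close>.\<close>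

definition mdeg :: "nat ^ 'n \<Rightarrow> nat"
  where "mdeg Q = (\<Sum>h\<in>UNIV. Q $ h)"

definition mpow :: "complex ^ 'n \<Rightarrow> nat ^ 'n \<Rightarrow> complex"
  where "mpow z Q = (\<Prod>h\<in>UNIV. z $ h ^ Q $ h)"

lemma finite_multi_index_le: "finite {A :: nat ^ 'n. \<forall>h. A $ h \<le> Q $ h}"
proof -
  have "{A :: nat ^ 'n. \<forall>h. A $ h \<le> Q $ h}
      \<subseteq> vec_lambda ` (\<Pi>\<^sub>E h\<in>UNIV. {..Q $ h})"
  proof
    fix A :: "nat ^ 'n" assume "A \<in> {A. \<forall>h. A $ h \<le> Q $ h}"
    then have "vec_nth A \<in> (\<Pi>\<^sub>E h\<in>UNIV. {..Q $ h})" by auto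
    then show "A \<in> vec_lambda ` (\<Pi>\<^sub>E h\<in>UNIV. {..Q $ h})"
      by (metis image_eqI vec_nth_inverse)
  qed
  then show ?thesis by (rule finite_subset) (intro finite_imageI finite_PiE; simp)
qed

lemma finite_add_eq [simp]: "finite {(A, B). A + B = (Q :: nat ^ 'n)}"
proof (rule finite_subset)
  show "{(A, B). A + B = Q} \<subseteq> {A. \<forall>h. A $ h \<le> Q $ h} \<times> {A. \<forall>h. A $ h \<le> Q $ h}"
    by auto
  show "finite ({A. \<forall>h. A $ h \<le> Q $ h} \<times> {A. \<forall>h. A $ h \<le> Q $ h})"
    by (intro finite_cartesian_product finite_multi_index_le)
qed

section \<open>Formal power series in finitely many variables\<close>

typedef (overloaded) 'n mfps = "UNIV :: (nat ^ 'n \<Rightarrow> complex) set"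
  morphisms mcoeff Abs_mfps ..

setup_lifting type_definition_mfps

lemma mfps_eqI: "(\<And>Q. mcoeff f Q = mcoeff g Q) \<Longrightarrow> f = g"
  by transfer auto

instantiation mfps :: (finite) comm_ring_1
begin

lift_definition zero_mfps :: "'a mfps" is "\<lambda>_. 0" .
lift_definition one_mfps :: "'a mfps" is "\<lambda>Q. if Q = 0 then 1 else 0" .
lift_definition plus_mfps :: "'a mfps \<Rightarrow> 'a mfps \<Rightarrow> 'a mfps" is "\<lambda>f g Q. f Q + g Q" .
lift_definition minus_mfps :: "'a mfps \<Rightarrow> 'a mfps \<Rightarrow> 'a mfps" is "\<lambda>f g Q. f Q - g Q" .
lift_definition uminus_mfps :: "'a mfps \<Rightarrow> 'a mfps" is "\<lambda>f Q. - f Q" .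
lift_definition times_mfps :: "'a mfps \<Rightarrow> 'a mfps \<Rightarrow> 'a mfps"
  is "\<lambda>f g Q. \<Sum>(A, B) | A + B = Q. f A * g B" .

instance
proof
  fix f g h :: "'a mfps"
  show "f * g * h = f * (g * h)"
  proof (rule mfps_eqI)
    fix Q
    have "mcoeff (f * g * h) Q =
        (\<Sum>x | fst x + snd x = Q. \<Sum>y | fst y + snd y = fst x.
           mcoeff f (fst y) * mcoeff g (snd y) * mcoeff h (snd x))"
      by (simp add: times_mfps.rep_eq sum_distrib_right case_prod_unfold)
    also have "\<dots> = (\<Sum>(x, y) \<in> Sigma {x. fst x + snd x = Q} (\<lambda>x. {y. fst y + snd y = fst x}).
           mcoeff f (fst y) * mcoeff g (snd y) * mcoeff h (snd x))"
      using finite_add_eq by (subst sum.Sigma) (auto simp: case_prod_unfold)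
    also have "\<dots> = (\<Sum>(x, y) \<in> Sigma {x. fst x + snd x = Q} (\<lambda>x. {y. fst y + snd y = snd x}).
           mcoeff f (fst x) * (mcoeff g (fst y) * mcoeff h (snd y)))"
      by (rule sum.reindex_bij_witness
            [where i = "\<lambda>(x, y). ((fst x + fst y, snd y), (fst x, fst y))"
               and j = "\<lambda>(x, y). ((fst y, snd y + snd x), (snd y, snd x))"])
         (auto simp: algebra_simps)
    also have "\<dots> = (\<Sum>x | fst x + snd x = Q. \<Sum>y | fst y + snd y = snd x.
           mcoeff f (fst x) * (mcoeff g (fst y) * mcoeff h (snd y)))"
      using finite_add_eq by (subst sum.Sigma) (auto simp: case_prod_unfold)
    also have "\<dots> = mcoeff (f * (g * h)) Q"
      by (simp add: times_mfps.rep_eq sum_distrib_left case_prod_unfold)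
    finally show "mcoeff (f * g * h) Q = mcoeff (f * (g * h)) Q" .
  qed
  show "f * g = g * f"
  proof (rule mfps_eqI)
    fix Q
    show "mcoeff (f * g) Q = mcoeff (g * f) Q"
      unfolding times_mfps.rep_eq
      by (rule sum.reindex_bij_witness[where i = prod.swap and j = prod.swap])
         (auto simp: algebra_simps)
  qed
  show "1 * f = f"
  proof (rule mfps_eqI)
    fix Q
    have "mcoeff (1 * f) Q = (\<Sum>(A, B) \<in> {(0, Q)}. mcoeff 1 A * mcoeff f B)"
      unfolding times_mfps.rep_eq
      by (rule sum.mono_neutral_right) (auto simp: one_mfps.rep_eq split: if_splits)
    then show "mcoeff (1 * f) Q = mcoeff f Q" by (simp add: one_mfps.rep_eq)
  qed
  show "(f + g) * h = f * h + g * h"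
    by (rule mfps_eqI)
       (simp add: times_mfps.rep_eq plus_mfps.rep_eq case_prod_unfold distrib_right sum.distrib)
  show "(0 :: 'a mfps) \<noteq> 1"
    by transfer (metis zero_neq_one)
qed (transfer; simp add: fun_eq_iff)+

end

text \<open>
  Formal self-maps of \<open>(\<complex>\<^sup>n, 0)\<close> have type \<open>'n \<Rightarrow> 'n mfps\<close>. In \<open>fcompose G Phi\<close>, the
  coefficient of \<open>z\<^sup>Q\<close> in \<open>\<Sum>\<^sub>L g\<^sub>L \<Phi>\<^sup>L\<close> is cut off at \<open>|L| \<le> |Q|\<close>; nothing is lost when all
  components of \<open>Phi\<close> have zero constant term, the only case in which it is used.
\<close>

definition fcompose :: "('n::finite \<Rightarrow> 'n mfps) \<Rightarrow> ('n \<Rightarrow> 'n mfps) \<Rightarrow> 'n \<Rightarrow> 'n mfps"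
  where "fcompose G Phi = (\<lambda>j. Abs_mfps (\<lambda>Q.
    \<Sum>L | mdeg L \<le> mdeg Q. mcoeff (G j) L * mcoeff (\<Prod>h\<in>UNIV. Phi h ^ L $ h) Q))"

definition tangent_to_id :: "('n::finite \<Rightarrow> 'n mfps) \<Rightarrow> bool"
  where "tangent_to_id Phi \<longleftrightarrow>
    (\<forall>j Q. mdeg Q \<le> 1 \<longrightarrow> mcoeff (Phi j) Q = (if Q = axis j 1 then 1 else 0))"

section \<open>Germs of biholomorphisms\<close>

definition holomorphic_map_on :: "(complex ^ 'n \<Rightarrow> complex ^ 'n) \<Rightarrow> (complex ^ 'n) set \<Rightarrow> bool"
  where "holomorphic_map_on F U \<longleftrightarrow>
    (\<forall>z\<in>U. \<exists>A :: complex ^ 'n ^ 'n. (F has_derivative (\<lambda>w. A *v w)) (at z))"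

definition biholomorphic_on :: "(complex ^ 'n \<Rightarrow> complex ^ 'n) \<Rightarrow> (complex ^ 'n) set \<Rightarrow> bool"
  where "biholomorphic_on F U \<longleftrightarrow>
    open U \<and> inj_on F U \<and> holomorphic_map_on F U \<and>
    open (F ` U) \<and> holomorphic_map_on (inv_into U F) (F ` U)"

text \<open>\<open>c\<close> is the formal map given by the (unique) power series expansion of \<open>F\<close> at \<open>0\<close>.\<close>

definition taylor_at_0 :: "(complex ^ 'n \<Rightarrow> complex ^ 'n) \<Rightarrow> ('n::finite \<Rightarrow> 'n mfps) \<Rightarrow> bool"
  where "taylor_at_0 F c \<longleftrightarrow>
    (\<exists>r>0. \<forall>z. norm z < r \<longrightarrow>
       (\<forall>j. ((\<lambda>Q. mcoeff (c j) Q * mpow z Q) has_sum (F z $ j)) UNIV))"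

section \<open>Resonances and Poincare--Dulac normal forms\<close>

definition is_resonance :: "complex ^ 'n \<Rightarrow> 'n \<Rightarrow> nat ^ 'n \<Rightarrow> bool"
  where "is_resonance lam j L \<longleftrightarrow> 2 \<le> mdeg L \<and> lam $ j = mpow lam L"

definition gen_comb :: "('m::finite \<Rightarrow> nat ^ 'n) \<Rightarrow> nat ^ 'm \<Rightarrow> nat ^ 'n"
  where "gen_comb P K = (\<Sum>t\<in>UNIV. K $ t *s P t)"

text \<open>
  \<open>m\<close>-resonance with respect to all eigenvalues, with generators \<open>P\<close> and \<open>m = CARD('m)\<close>.
  Injectivity together with independence of the range is linear independence of the family.
\<close>

definition resonant_with_generators ::
    "complex ^ 'n \<Rightarrow> ('m::finite \<Rightarrow> nat ^ 'n) \<Rightarrow> bool"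
  where "resonant_with_generators lam P \<longleftrightarrow>
    inj P \<and>
    vec.independent (range (\<lambda>t. (\<chi> h. of_nat (P t $ h)) :: rat ^ 'n)) \<and>
    {(j, L). is_resonance lam j L} = {(j, axis j 1 + gen_comb P K) | j K. 1 \<le> mdeg K}"

text \<open>
  The formal map with components \<open>\<lambda>\<^sub>s z\<^sub>s + \<Sum>\<^bsub>K \<noteq> 0\<^esub> a\<^bsub>K,s\<^esub> z\<^bsup>KP\<^esup> z\<^sub>s\<close>. For linearly independent
  generators the inner sum has at most one term. The values \<open>a 0 s\<close> play no role.
\<close>

definition pd_series ::
    "complex ^ 'n \<Rightarrow> ('m::finite \<Rightarrow> nat ^ 'n) \<Rightarrow> (nat ^ 'm \<Rightarrow> 'n::finite \<Rightarrow> complex) \<Rightarrow> 'n \<Rightarrow> 'n mfps"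
  where "pd_series lam P a = (\<lambda>s. Abs_mfps (\<lambda>Q.
    (if Q = axis s 1 then lam $ s else 0) +
    (\<Sum>K | K \<noteq> 0 \<and> gen_comb P K + axis s 1 = Q. a K s)))"

definition is_pd_normal_form ::
    "(complex ^ 'n \<Rightarrow> complex ^ 'n) \<Rightarrow> complex ^ 'n \<Rightarrow> ('m::finite \<Rightarrow> nat ^ 'n) \<Rightarrow>
     (nat ^ 'm \<Rightarrow> 'n \<Rightarrow> complex) \<Rightarrow> bool"
  where "is_pd_normal_form F lam P a \<longleftrightarrow>
    (\<exists>c Phi. taylor_at_0 F c \<and> tangent_to_id Phi \<and>
       fcompose (pd_series lam P a) Phi = fcompose Phi c)"

definition nf_order :: "(nat ^ 'm::finite \<Rightarrow> 'n \<Rightarrow> complex) \<Rightarrow> enat"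
  where "nf_order a = (INF K \<in> {K. 1 \<le> mdeg K \<and> (\<exists>s. a K s \<noteq> 0)}. enat (mdeg K))"

text \<open>The order is the same for all normal forms of \<open>F\<close>, so any one of them may be used.\<close>

definition has_weighted_order ::
    "(complex ^ 'n \<Rightarrow> complex ^ 'n) \<Rightarrow> complex ^ 'n \<Rightarrow> ('m::finite \<Rightarrow> nat ^ 'n) \<Rightarrow> enat \<Rightarrow> bool"
  where "has_weighted_order F lam P k \<longleftrightarrow>
    (\<exists>a. is_pd_normal_form F lam P a \<and> nf_order a = k)"

section \<open>Parabolic shadows and characteristic directions\<close>

text \<open>
  The homogeneous part \<open>H\<close> of degree \<open>k + 1\<close> of the parabolic shadow \<open>u \<mapsto> u + H u\<close>
  associated with the normal form with coefficients \<open>a\<close>.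
\<close>

definition shadow_term ::
    "complex ^ 'n \<Rightarrow> ('m::finite \<Rightarrow> nat ^ 'n) \<Rightarrow> (nat ^ 'm \<Rightarrow> 'n \<Rightarrow> complex) \<Rightarrow> nat \<Rightarrow>
     complex ^ 'm \<Rightarrow> complex ^ 'm"
  where "shadow_term lam P a k u = (\<chi> t. u $ t *
    (\<Sum>K | mdeg K = k. (\<Sum>j\<in>UNIV. of_nat (P t $ j) * a K j / lam $ j) * mpow u K))"

definition nondeg_char_direction :: "(complex ^ 'm \<Rightarrow> complex ^ 'm) \<Rightarrow> complex ^ 'm \<Rightarrow> bool"
  where "nondeg_char_direction H v \<longleftrightarrow> v \<noteq> 0 \<and> (\<exists>\<tau>. \<tau> \<noteq> 0 \<and> H v = \<tau> *s v)"

text \<open>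
  The chart \<open>{[u]. u\<^sub>t \<noteq> 0}\<close> of projective space is identified with the affine hyperplane
  \<open>{u. u\<^sub>t = 1}\<close> through the representatives with \<open>t\<close>-th coordinate \<open>1\<close>; its tangent spaces are
  \<open>{w. w\<^sub>t = 0}\<close>, and the self-map induced by \<open>H\<close> reads \<open>u \<mapsto> H(u) / H(u)\<^sub>t\<close>.
\<close>

definition induced_in_chart ::
    "(complex ^ 'm \<Rightarrow> complex ^ 'm) \<Rightarrow> 'm \<Rightarrow> complex ^ 'm \<Rightarrow> complex ^ 'm"
  where "induced_in_chart H t u = (1 / H u $ t) *s H u"

text \<open>
  Eigenvalues of \<open>(1/k) (d - id)\<close>, where \<open>d\<close> is the differential of the induced map at \<open>[v]\<close>,
  computed in any chart around \<open>[v]\<close>; they do not depend on the chart.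
\<close>

definition directors ::
    "nat \<Rightarrow> (complex ^ 'm \<Rightarrow> complex ^ 'm) \<Rightarrow> complex ^ 'm::finite \<Rightarrow> complex set"
  where "directors k H v = {\<delta>. \<exists>t w. v $ t \<noteq> 0 \<and> w \<noteq> 0 \<and> w $ t = 0 \<and>
    (1 / of_nat k) *s
      (frechet_derivative (induced_in_chart H t) (at ((1 / v $ t) *s v)) w - w) = \<delta> *s w}"

definition fully_attractive ::
    "nat \<Rightarrow> (complex ^ 'm \<Rightarrow> complex ^ 'm) \<Rightarrow> complex ^ 'm::finite \<Rightarrow> bool"
  where "fully_attractive k H v \<longleftrightarrow> (\<forall>\<delta>\<in>directors k H v. Re \<delta> > 0)"

definition parabolically_attracting ::
    "(complex ^ 'n \<Rightarrow> complex ^ 'n) \<Rightarrow> complex ^ 'n \<Rightarrow> ('m::finite \<Rightarrow> nat ^ 'n) \<Rightarrow> bool"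
  where "parabolically_attracting F lam P \<longleftrightarrow>
    (\<exists>a k v. is_pd_normal_form F lam P a \<and> nf_order a = enat k \<and>
       nondeg_char_direction (shadow_term lam P a k) v \<and>
       fully_attractive k (shadow_term lam P a k) v \<and>
       shadow_term lam P a k v = (- 1 / of_nat k) *s v \<and>
       (\<forall>j. Re (\<Sum>K | mdeg K = k. a K j / lam $ j * mpow v K) < 0))"

section \<open>Basins\<close>

text \<open>\<open>V\<close> is the domain of definition of \<open>G\<close>.\<close>

definition basin_of_attraction ::
    "(complex ^ 'n \<Rightarrow> complex ^ 'n) \<Rightarrow> (complex ^ 'n) set \<Rightarrow> (complex ^ 'n) set \<Rightarrow> bool"
  where "basin_of_attraction G V B \<longleftrightarrow>
    B \<noteq> {} \<and> open B \<and> 0 \<in> closure B \<and> B \<subseteq> V \<and> G ` B \<subseteq> B \<and>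
    (\<forall>z\<in>B. (\<lambda>l. (G ^^ l) z) \<longlonglongrightarrow> 0)"

definition repelling_basin ::
    "(complex ^ 'n \<Rightarrow> complex ^ 'n) \<Rightarrow> (complex ^ 'n) set \<Rightarrow> (complex ^ 'n) set \<Rightarrow> bool"
  where "repelling_basin F U B \<longleftrightarrow> basin_of_attraction (inv_into U F) (F ` U) B"

end

theory Submission
  imports Defs "HOL-Library.Landau_Symbols" "HOL-Computational_Algebra.Fundamental_Theorem_Algebra"
begin

text \<open>
  Let \<open>u\<^sub>t = w\<^bsup>P t\<^esup>\<close> be the resonant monomials. In coordinates \<open>w\<close> that put \<open>F\<close> in Poincare--Dulac form
  up to order \<open>l\<close>, the germ acts by \<open>w\<^sub>j \<mapsto> \<lambda>\<^sub>j w\<^sub>j (1 + A\<^sub>j(u) + \<dots>) + O(|w|\<^bsup>l+1\<^esup>)\<close> with \<open>A\<^sub>j\<close> homogeneous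
  of degree \<open>k\<close>, hence on the monomials by \<open>u \<mapsto> u + H(u) + \<dots>\<close> where \<open>H\<close> is the shadow term. So the
  inverse acts by \<open>u \<mapsto> u - H(u) + \<dots>\<close> and multiplies \<open>|w\<^sub>j|\<close> by about \<open>1 - Re A\<^sub>j(u)\<close>.
  Let \<open>v\<close> be the given normalized direction and \<open>\<zeta>\<^sup>k = -1\<close>. Then \<open>v' = \<zeta> v\<close> is another representative of
  the same point of projective space, so it has the same directors, but \<open>H(v') = v'/k\<close> and
  \<open>Re A\<^sub>j(v') > 0\<close>: it is attracting for the inverse, which has the approximate orbit
  \<open>u = T\<^bsup>-1/k\<^esup> v'\<close>, with \<open>T\<close> growing by one in each step.

  Orbits near this one are followed in the rescaled variable \<open>Y = T\<^bsup>1/k\<^esup> u\<close>. To first order in \<open>1/T\<close> it moves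
  by \<open>(Y/k - H(Y))/T\<close>, and the linear part of \<open>Y/k - H(Y)\<close> at \<open>v'\<close> has the eigenvalue \<open>-1\<close> (a shift of
  the time \<open>T\<close>) and the negatives of the directors. All of them have negative real part
  (\<open>eigenvalues_of_fully_attractive_direction\<close>), so some norm \<open>N\<close> contracts
  (\<open>adapted_norm_exists\<close>). Since \<open>Re A\<^sub>j(v') > 0\<close>, the coordinates decay at least like a power
  \<open>T\<^bsup>-b\<^esup>\<close>, and then the remainder \<open>O(|w|\<^bsup>l+1\<^esup>)\<close> is negligible once \<open>b(l+1)\<close> is large. Hence for large
  \<open>T\<close> the inverse maps the region \<open>|w\<^sub>j| < T\<^bsup>-b\<^esup>\<close>, \<open>N(Y - v') < \<eta>\<close> at time \<open>T\<close> into the region at time \<open>T + 1\<close>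
  (\<open>region_step\<close>, \<open>region_invariant\<close>). Letting the region depend on time avoids any discussion of the
  argument of \<open>u\<close>. The region at a fixed late time is open and nonempty, and the orbits that start
  in it tend to \<open>0\<close> uniformly (\<open>uniformly_attracted_open_set\<close>).

  A basin of attraction need not be connected, so one such open set \<open>W\<close> carries as many disjoint
  basins as desired: choose points of \<open>W\<close> whose orbits are disjoint, take small balls around
  them, and saturate these balls under forward iteration. By uniform convergence only finitely
  many iterates can make two of the saturated balls meet, and these are excluded by shrinking the
  balls (\<open>disjoint_basins_from_uniform_attraction\<close>).
\<close>

section \<open>Multi-indices and monomials\<close>

lemma mdeg_0 [simp]: "mdeg 0 = 0"
  by (simp add: mdeg_def)

lemma mdeg_add: "mdeg (A + B) = mdeg A + mdeg B"
  by (simp add: mdeg_def sum.distrib)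

lemma mdeg_axis [simp]: "mdeg (axis j 1 :: nat ^ 'n) = 1"
  by (simp add: mdeg_def axis_def)

text \<open>
  Simplification rewrites \<open>axis j 1\<close> to this form when the entries are natural numbers.
\<close>

lemma mdeg_axis_Suc_0 [simp]: "mdeg (axis j (Suc 0) :: nat ^ 'n) = Suc 0"
  using mdeg_axis[of j] by simp

lemma mdeg_eq_0_iff: "mdeg Q = 0 \<longleftrightarrow> Q = 0"
  by (simp add: mdeg_def vec_eq_iff)

lemma finite_mdeg_le [simp]: "finite {Q :: nat ^ 'n. mdeg Q \<le> l}"
proof (rule finite_subset)
  show "{Q :: nat ^ 'n. mdeg Q \<le> l} \<subseteq> {A. \<forall>h. A $ h \<le> (\<chi> h. l) $ h}"
  proof safe
    fix Q :: "nat ^ 'n" and h assume "mdeg Q \<le> l"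
    then show "Q $ h \<le> (\<chi> h. l) $ h"
      using member_le_sum[of h UNIV "($) Q"] by (simp add: mdeg_def)
  qed
qed (rule finite_multi_index_le)

lemma finite_mdeg_eq [simp]: "finite {Q :: nat ^ 'n. mdeg Q = l}"
  by (rule finite_subset[OF _ finite_mdeg_le[of l]]) auto

lemma mpow_add: "mpow z (A + B) = mpow z A * mpow z B"
  by (simp add: mpow_def power_add prod.distrib)

lemma mpow_0_right [simp]: "mpow z 0 = 1"
  by (simp add: mpow_def)

lemma mpow_axis [simp]: "mpow z (axis j 1) = z $ j"
proof -
  have "mpow z (axis j 1) = (\<Prod>h\<in>UNIV. if h = j then z $ h else 1)"
    unfolding mpow_def by (rule prod.cong) (auto simp: axis_def)
  then show ?thesis by simp
qed

lemma mpow_axis_Suc_0 [simp]: "mpow z (axis j (Suc 0)) = z $ j"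
  using mpow_axis[of z j] by simp

lemma mpow_scale: "mpow (c *s z) Q = c ^ mdeg Q * mpow z Q"
  by (simp add: mpow_def mdeg_def power_mult_distrib prod.distrib power_sum)

lemma norm_mpow_le: "norm (mpow z Q) \<le> norm z ^ mdeg Q"
proof -
  have "norm (mpow z Q) = (\<Prod>h\<in>UNIV. norm (z $ h) ^ Q $ h)"
    by (simp add: mpow_def prod_norm[symmetric] norm_power)
  also have "\<dots> \<le> (\<Prod>h\<in>UNIV. norm z ^ Q $ h)"
    by (intro prod_mono conjI power_mono) (auto simp: Finite_Cartesian_Product.norm_nth_le)
  finally show ?thesis by (simp add: mdeg_def power_sum)
qed

lemma tendsto_mpow [tendsto_intros]:
  "(f \<longlongrightarrow> a) F \<Longrightarrow> ((\<lambda>x. mpow (f x) Q) \<longlongrightarrow> mpow a Q) F"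
  unfolding mpow_def by (intro tendsto_intros)

lemma continuous_on_mpow [continuous_intros]:
  "continuous_on S f \<Longrightarrow> continuous_on S (\<lambda>x. mpow (f x) Q)"
  unfolding mpow_def by (intro continuous_intros)

lemma norm_mpow_diff_le:
  assumes "\<And>j. norm (a $ j) \<le> 1" "\<And>j. norm (b $ j) \<le> 1"
  shows "norm (mpow a Q - mpow b Q) \<le> (\<Sum>j\<in>UNIV. of_nat (Q $ j) * norm (a $ j - b $ j))"
proof -
  have "norm (mpow a Q - mpow b Q) \<le> (\<Sum>j\<in>UNIV. norm (a $ j ^ Q $ j - b $ j ^ Q $ j))"
    unfolding mpow_def using assms
    by (intro norm_prod_diff) (auto simp: norm_power power_le_one)
  also have "\<dots> \<le> (\<Sum>j\<in>UNIV. of_nat (Q $ j) * norm (a $ j - b $ j))"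
    using assms by (intro sum_mono norm_power_diff) auto
  finally show ?thesis .
qed

lemma norm_le_sum_nth: "norm x \<le> (\<Sum>i\<in>UNIV. norm (x $ i))"
  unfolding norm_vec_def by (rule L2_set_le_sum) simp

lemma norm_vector_scale: "norm (c *s x) = norm c * norm (x :: complex ^ 'm)"
proof -
  have "(norm (c *s x))\<^sup>2 = (norm c * norm x)\<^sup>2"
    by (simp add: norm_vec_def L2_set_def norm_mult power_mult_distrib sum_distrib_left sum_nonneg)
  then show ?thesis by (rule power2_eq_imp_eq) auto
qed

lemma bounded_bilinear_vector_scale: "bounded_bilinear (\<lambda>(c :: complex) (x :: complex ^ 'm). c *s x)"
proof
  show "\<exists>K. \<forall>a b. norm (a *s b :: complex ^ 'm) \<le> norm a * norm b * K"
    by (intro exI[of _ 1]) (simp add: norm_vector_scale)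
qed (simp_all add: vec_eq_iff algebra_simps)

section \<open>Jets of functions and composition of formal series\<close>

text \<open>
  Truncations of formal series are polynomial maps, so they make sense as functions even when
  the series diverges; this is how a formal conjugacy is used analytically.
\<close>

definition jet_poly :: "nat \<Rightarrow> 'n::finite mfps \<Rightarrow> complex ^ 'n \<Rightarrow> complex"
  where "jet_poly l s z = (\<Sum>Q | mdeg Q \<le> l. mcoeff s Q * mpow z Q)"

definition has_jet :: "nat \<Rightarrow> (complex ^ 'n::finite \<Rightarrow> complex) \<Rightarrow> 'n mfps \<Rightarrow> bool"
  where "has_jet l f s \<longleftrightarrow>
    (\<lambda>z. f z - jet_poly l s z) \<in> O[nhds 0](\<lambda>z. complex_of_real (norm z ^ Suc l))"

lemma bigo_mpow:
  assumes "d \<le> mdeg Q"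
  shows "(\<lambda>z :: complex ^ 'n. mpow z Q) \<in> O[nhds 0](\<lambda>z. complex_of_real (norm z ^ d))"
proof (rule bigoI[where c = 1])
  have "eventually (\<lambda>z. z \<in> ball 0 1) (nhds (0 :: complex ^ 'n))"
    by (intro eventually_nhds_in_open) auto
  then show "eventually (\<lambda>z. norm (mpow z Q) \<le> 1 * norm (complex_of_real (norm z ^ d))) (nhds 0)"
  proof eventually_elim
    case (elim z)
    then have "norm z ^ mdeg Q \<le> norm z ^ d"
      using assms by (intro power_decreasing) auto
    with norm_mpow_le[of z Q] show ?case by (simp add: norm_power)
  qed
qed

lemma bounded_jet_poly: "jet_poly l s \<in> O[nhds 0](\<lambda>_. 1)"
proof -
  have "(\<lambda>z. mcoeff s Q * mpow z Q) \<in> O[nhds 0](\<lambda>_. 1)" for Q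
    using bigo_mpow[of 0 Q] by (cases "mcoeff s Q = 0") simp_all
  then have "(\<lambda>z. \<Sum>Q | mdeg Q \<le> l. mcoeff s Q * mpow z Q) \<in> O[nhds 0](\<lambda>_. 1)"
    by (intro big_sum_in_bigo)
  then show ?thesis by (simp add: jet_poly_def[abs_def])
qed

lemma bigo_norm_power_1: "(\<lambda>z :: complex ^ 'n. complex_of_real (norm z ^ d)) \<in> O[nhds 0](\<lambda>_. 1)"
proof (rule bigoI[where c = 1])
  have "eventually (\<lambda>z. z \<in> ball 0 1) (nhds (0 :: complex ^ 'n))"
    by (intro eventually_nhds_in_open) auto
  then show "eventually (\<lambda>z. norm (complex_of_real (norm z ^ d)) \<le> 1 * norm (1::complex))
      (nhds (0 :: complex ^ 'n))"
    by eventually_elim (auto simp: norm_power intro: power_le_one)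
qed

lemma has_jet_jet_poly: "has_jet l (jet_poly l s) s"
  by (simp add: has_jet_def)

lemma has_jet_unique:
  assumes "has_jet l f s" "has_jet l g s"
  shows "(\<lambda>z. f z - g z) \<in> O[nhds 0](\<lambda>z. complex_of_real (norm z ^ Suc l))"
  using sum_in_bigo(2)[OF assms[unfolded has_jet_def]] by simp

lemma has_jet_lincomb:
  assumes "finite I" "\<And>i. i \<in> I \<Longrightarrow> has_jet l (f i) (s i)"
    and "\<And>Q. mdeg Q \<le> l \<Longrightarrow> mcoeff t Q = (\<Sum>i\<in>I. a i * mcoeff (s i) Q)"
  shows "has_jet l (\<lambda>z. \<Sum>i\<in>I. a i * f i z) t"
proof -
  have t: "jet_poly l t z = (\<Sum>i\<in>I. a i * jet_poly l (s i) z)" for z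
  proof -
    have "jet_poly l t z = (\<Sum>Q | mdeg Q \<le> l. \<Sum>i\<in>I. a i * mcoeff (s i) Q * mpow z Q)"
      by (simp add: jet_poly_def assms(3) sum_distrib_right)
    also have "\<dots> = (\<Sum>i\<in>I. a i * jet_poly l (s i) z)"
      by (subst sum.swap) (simp add: jet_poly_def sum_distrib_left mult.assoc)
    finally show ?thesis .
  qed
  have "(\<lambda>z. a i * (f i z - jet_poly l (s i) z)) \<in> O[nhds 0](\<lambda>z. complex_of_real (norm z ^ Suc l))"
    if "i \<in> I" for i
    using assms(2)[OF that] unfolding has_jet_def by (cases "a i = 0") simp_all
  then have "(\<lambda>z. \<Sum>i\<in>I. a i * (f i z - jet_poly l (s i) z))
      \<in> O[nhds 0](\<lambda>z. complex_of_real (norm z ^ Suc l))"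
    by (intro big_sum_in_bigo)
  then show ?thesis
    unfolding has_jet_def t by (simp add: sum_subtractf right_diff_distrib)
qed

lemma jet_poly_times:
  "(\<lambda>z. jet_poly l s z * jet_poly l t z - jet_poly l (s * t) z)
     \<in> O[nhds 0](\<lambda>z. complex_of_real (norm z ^ Suc l))"
proof -
  let ?S = "{Q :: nat ^ 'a. mdeg Q \<le> l}"
  let ?f = "\<lambda>z (A, B). mcoeff s A * mcoeff t B * mpow z (A + B)"
  define X where "X = {(A, B). (A, B) \<in> ?S \<times> ?S \<and> \<not> mdeg (A + B) \<le> l}"
  have "jet_poly l s z * jet_poly l t z - jet_poly l (s * t) z = sum (?f z) X" for z
  proof -
    have "jet_poly l s z * jet_poly l t z = sum (?f z) (?S \<times> ?S)"
      by (simp add: jet_poly_def sum_product sum.cartesian_product mpow_add algebra_simps)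
    moreover have "jet_poly l (s * t) z = sum (?f z) (?S \<times> ?S - X)"
    proof -
      have "jet_poly l (s * t) z
          = (\<Sum>Q\<in>?S. \<Sum>x | fst x + snd x = Q. mcoeff s (fst x) * mcoeff t (snd x) * mpow z (fst x + snd x))"
        by (simp add: jet_poly_def times_mfps.rep_eq sum_distrib_right case_prod_unfold)
      also have "\<dots> = (\<Sum>(Q, x)\<in>Sigma ?S (\<lambda>Q. {x. fst x + snd x = Q}).
           mcoeff s (fst x) * mcoeff t (snd x) * mpow z (fst x + snd x))"
        using finite_add_eq by (subst sum.Sigma) (auto simp: case_prod_unfold)
      also have "\<dots> = sum (?f z) (?S \<times> ?S - X)"
        by (rule sum.reindex_bij_witness
            [where i = "\<lambda>x. (fst x + snd x, x)" and j = snd])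
           (auto simp: X_def mdeg_add)
      finally show ?thesis .
    qed
    moreover have "X \<subseteq> ?S \<times> ?S" by (auto simp: X_def)
    ultimately show ?thesis
      by (simp add: sum_diff)
  qed
  moreover have "(\<lambda>z. sum (?f z) X) \<in> O[nhds 0](\<lambda>z. complex_of_real (norm z ^ Suc l))"
  proof (rule big_sum_in_bigo)
    fix x assume "x \<in> X"
    then have "Suc l \<le> mdeg (fst x + snd x)" by (auto simp: X_def)
    then have *: "(\<lambda>z. mpow z (fst x + snd x)) \<in> O[nhds 0](\<lambda>z. complex_of_real (norm z ^ Suc l))"
      by (rule bigo_mpow)
    show "(\<lambda>z. ?f z x) \<in> O[nhds 0](\<lambda>z. complex_of_real (norm z ^ Suc l))"
      using * by (cases "mcoeff s (fst x) * mcoeff t (snd x) = 0") (auto simp: case_prod_unfold)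
  qed
  ultimately show ?thesis by simp
qed

lemma has_jet_mult:
  assumes "has_jet l f s" "has_jet l g t"
  shows "has_jet l (\<lambda>z. f z * g z) (s * t)"
proof -
  let ?e = "\<lambda>z :: complex ^ 'a. complex_of_real (norm z ^ Suc l)"
  have g: "g \<in> O[nhds 0](\<lambda>_. 1)"
  proof -
    have "(\<lambda>z. g z - jet_poly l t z) \<in> O[nhds 0](\<lambda>_. 1)"
      using assms(2) bigo_norm_power_1 unfolding has_jet_def by (rule landau_o.big_trans)
    from sum_in_bigo(1)[OF this bounded_jet_poly[of l t]] show ?thesis by simp
  qed
  have 1: "(\<lambda>z. (f z - jet_poly l s z) * g z) \<in> O[nhds 0](\<lambda>z. ?e z * 1)"
    using assms(1) g unfolding has_jet_def by (rule landau_o.big.mult)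
  have 2: "(\<lambda>z. jet_poly l s z * (g z - jet_poly l t z)) \<in> O[nhds 0](\<lambda>z. 1 * ?e z)"
    using bounded_jet_poly assms(2) unfolding has_jet_def by (rule landau_o.big.mult)
  have "(\<lambda>z. ((f z - jet_poly l s z) * g z + jet_poly l s z * (g z - jet_poly l t z))
     + (jet_poly l s z * jet_poly l t z - jet_poly l (s * t) z)) \<in> O[nhds 0](?e)"
    using 1 2 by (intro sum_in_bigo jet_poly_times) simp_all
  then show ?thesis
    unfolding has_jet_def by (simp add: algebra_simps)
qed

lemma has_jet_1: "has_jet l (\<lambda>_. 1) (1 :: 'n::finite mfps)"
proof -
  have "jet_poly l (1 :: 'n mfps) z = (\<Sum>Q\<in>{0}. mcoeff 1 Q * mpow z Q)" for z
    unfolding jet_poly_def by (rule sum.mono_neutral_right) (auto simp: one_mfps.rep_eq)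
  then show ?thesis by (simp add: has_jet_def one_mfps.rep_eq)
qed

lemma has_jet_power: "has_jet l f s \<Longrightarrow> has_jet l (\<lambda>z. f z ^ p) (s ^ p)"
proof (induction p)
  case 0
  then show ?case by (simp add: has_jet_1)
next
  case (Suc p)
  then show ?case using has_jet_mult[of l f s "\<lambda>z. f z ^ p" "s ^ p"] by simp
qed

lemma has_jet_prod:
  "(\<And>i. i \<in> I \<Longrightarrow> has_jet l (f i) (s i)) \<Longrightarrow> has_jet l (\<lambda>z. \<Prod>i\<in>I. f i z) (\<Prod>i\<in>I. s i)"
proof (induction I rule: infinite_finite_induct)
  case (insert i I)
  then show ?case
    using has_jet_mult[of l "f i" "s i" "\<lambda>z. \<Prod>i\<in>I. f i z" "\<Prod>i\<in>I. s i"] by simp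
qed (simp_all add: has_jet_1)

definition order_ge :: "'n::finite mfps \<Rightarrow> nat \<Rightarrow> bool"
  where "order_ge s d \<longleftrightarrow> (\<forall>Q. mdeg Q < d \<longrightarrow> mcoeff s Q = 0)"

lemma order_ge_times:
  assumes "order_ge s d" "order_ge t e"
  shows "order_ge (s * t) (d + e)"
  unfolding order_ge_def
proof (intro allI impI)
  fix Q :: "nat ^ 'a" assume Q: "mdeg Q < d + e"
  have "mcoeff s A * mcoeff t B = 0" if "A + B = Q" for A B
  proof -
    from Q that have "mdeg A < d \<or> mdeg B < e" by (auto simp: mdeg_add)
    with assms show ?thesis by (auto simp: order_ge_def)
  qed
  then show "mcoeff (s * t) Q = 0"
    by (auto simp: times_mfps.rep_eq intro!: sum.neutral)
qed

lemma order_ge_power: "order_ge s d \<Longrightarrow> order_ge (s ^ p) (p * d)"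
proof (induction p)
  case 0
  then show ?case by (simp add: order_ge_def)
next
  case (Suc p)
  then show ?case using order_ge_times[of s d "s ^ p" "p * d"] by simp
qed

lemma order_ge_prod:
  "finite I \<Longrightarrow> (\<And>i. i \<in> I \<Longrightarrow> order_ge (s i) (d i)) \<Longrightarrow> order_ge (\<Prod>i\<in>I. s i) (\<Sum>i\<in>I. d i)"
  by (induction I rule: finite_induct) (simp_all add: order_ge_times, simp add: order_ge_def)

text \<open>
  The Taylor polynomial of a composition is the truncation of the formal composition: powers
  \<open>s\<^sup>L\<close> with \<open>|L| > |Q|\<close> do not contribute to the coefficient of \<open>z\<^sup>Q\<close>, because the inner series have no
  constant term.
\<close>

lemma has_jet_fcompose:
  assumes jet: "\<And>h. has_jet l (\<lambda>z. f z $ h) (s h)" and const: "\<And>h. mcoeff (s h) 0 = 0"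
  shows "has_jet l (\<lambda>z. jet_poly l (G j) (f z)) (fcompose G s j)"
proof -
  have ord: "order_ge (s h) 1" for h
    using const by (auto simp: order_ge_def mdeg_eq_0_iff)
  have ordL: "order_ge (\<Prod>h\<in>UNIV. s h ^ L $ h) (mdeg L)" for L :: "nat ^ 'a"
    unfolding mdeg_def using order_ge_power[OF ord] by (intro order_ge_prod) auto
  have "has_jet l (\<lambda>z. \<Sum>L | mdeg L \<le> l. mcoeff (G j) L * mpow (f z) L) (fcompose G s j)"
  proof (rule has_jet_lincomb)
    fix Q :: "nat ^ 'a" assume Q: "mdeg Q \<le> l"
    show "mcoeff (fcompose G s j) Q
        = (\<Sum>L | mdeg L \<le> l. mcoeff (G j) L * mcoeff (\<Prod>h\<in>UNIV. s h ^ L $ h) Q)"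
      unfolding fcompose_def Abs_mfps_inverse[OF UNIV_I]
      using Q ordL by (intro sum.mono_neutral_left) (auto simp: order_ge_def not_le)
  next
    fix L :: "nat ^ 'a"
    show "has_jet l (\<lambda>z. mpow (f z) L) (\<Prod>h\<in>UNIV. s h ^ L $ h)"
      unfolding mpow_def by (intro has_jet_prod has_jet_power jet)
  qed simp
  then show ?thesis by (simp add: jet_poly_def)
qed

text \<open>
  The series converges absolutely at a point with all coordinates equal to some \<open>\<rho> > 0\<close>. Comparison
  with this point bounds the tail beyond order \<open>l\<close> by \<open>(|z| / \<rho>)\<^bsup>l+1\<^esup>\<close> times the sum of the absolute
  values there.
\<close>

lemma taylor_has_jet:
  assumes "taylor_at_0 F c"
  shows "has_jet l (\<lambda>z. F z $ j) (c j)"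
proof -
  obtain r where r: "r > 0"
    and sums: "\<And>z. norm z < r \<Longrightarrow> ((\<lambda>Q. mcoeff (c j) Q * mpow z Q) has_sum (F z $ j)) UNIV"
    using assms unfolding taylor_at_0_def by blast
  define N where "N = real (CARD('a))"
  define \<rho> where "\<rho> = r / (2 * N)"
  have N: "N \<ge> 1" by (simp add: N_def Suc_leI)
  then have \<rho>: "\<rho> > 0" using r by (simp add: \<rho>_def)
  define p :: "complex ^ 'a" where "p = (\<chi> h. of_real \<rho>)"
  have "norm p \<le> (\<Sum>h\<in>UNIV. norm (p $ h))" by (rule norm_le_sum_nth)
  also have "\<dots> = N * \<rho>" using \<rho> by (simp add: p_def N_def)
  also have "\<dots> = r / 2" using N by (simp add: \<rho>_def)
  finally have "norm p < r" using r by simp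
  from has_sum_imp_summable[OF sums[OF this]]
  have "(\<lambda>Q. norm (mcoeff (c j) Q * mpow p Q)) summable_on UNIV"
    by (simp add: summable_on_iff_abs_summable_on_complex)
  moreover have "norm (mcoeff (c j) Q * mpow p Q) = norm (mcoeff (c j) Q) * \<rho> ^ mdeg Q" for Q
    using \<rho> by (simp add: p_def mpow_def mdeg_def norm_mult prod_norm[symmetric] norm_power power_sum)
  ultimately have summ: "(\<lambda>Q. norm (mcoeff (c j) Q) * \<rho> ^ mdeg Q) summable_on UNIV" by simp
  define S where "S = (\<Sum>\<^sub>\<infinity>Q. norm (mcoeff (c j) Q) * \<rho> ^ mdeg Q)"
  have bound: "norm (F z $ j - jet_poly l (c j) z) \<le> S / \<rho> ^ Suc l * norm (complex_of_real (norm z ^ Suc l))"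
    if z: "norm z < \<rho>" for z
  proof -
    have "r * 1 \<le> r * (2 * N)" using N r by (intro mult_left_mono) auto
    then have "\<rho> \<le> r" using N by (simp add: \<rho>_def divide_le_eq)
    with z have "norm z < r" by simp
    note hs = sums[OF this]
    let ?f = "\<lambda>Q. mcoeff (c j) Q * mpow z Q"
    let ?A = "{Q :: nat ^ 'a. mdeg Q \<le> l}"
    have "(?f has_sum (F z $ j - jet_poly l (c j) z)) (UNIV - ?A)"
      unfolding jet_poly_def by (rule has_sum_Diff[OF hs has_sum_finite]) auto
    then have eq: "F z $ j - jet_poly l (c j) z = infsum ?f (UNIV - ?A)"
      by (simp add: infsumI)
    define q where "q = norm z / \<rho>"
    have q: "0 \<le> q" "q \<le> 1" using z \<rho> by (auto simp: q_def)
    have le: "norm (?f Q) \<le> (norm (mcoeff (c j) Q) * \<rho> ^ mdeg Q) * q ^ Suc l" if "Q \<in> UNIV - ?A" for Q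
    proof -
      have "norm (?f Q) \<le> norm (mcoeff (c j) Q) * norm z ^ mdeg Q"
        by (simp add: norm_mult mult_left_mono norm_mpow_le)
      also have "norm z ^ mdeg Q = \<rho> ^ mdeg Q * q ^ mdeg Q"
        using \<rho> by (simp add: q_def power_divide)
      also have "\<dots> \<le> \<rho> ^ mdeg Q * q ^ Suc l"
        using that q \<rho> by (intro mult_left_mono power_decreasing) auto
      finally show ?thesis by (simp add: mult_left_mono mult.assoc)
    qed
    have s1: "(\<lambda>Q. (norm (mcoeff (c j) Q) * \<rho> ^ mdeg Q) * q ^ Suc l) summable_on (UNIV - ?A)"
      by (intro summable_on_cmult_left summable_on_subset_banach[OF summ]) auto
    have s2: "(\<lambda>Q. norm (?f Q)) summable_on (UNIV - ?A)"
      using s1 le by (rule Infinite_Sum.abs_summable_on_comparison_test')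
    have "norm (F z $ j - jet_poly l (c j) z) \<le> (\<Sum>\<^sub>\<infinity>Q\<in>UNIV - ?A. norm (?f Q))"
      unfolding eq using s2 by (rule norm_infsum_bound)
    also have "\<dots> \<le> (\<Sum>\<^sub>\<infinity>Q\<in>UNIV - ?A. (norm (mcoeff (c j) Q) * \<rho> ^ mdeg Q) * q ^ Suc l)"
      using s2 s1 le by (rule infsum_mono)
    also have "\<dots> \<le> (\<Sum>\<^sub>\<infinity>Q. (norm (mcoeff (c j) Q) * \<rho> ^ mdeg Q) * q ^ Suc l)"
      using s1 summable_on_cmult_left[OF summ] \<rho> q
      by (intro infsum_mono2) auto
    also have "\<dots> = S * q ^ Suc l"
      using summ by (subst infsum_cmult_left) (auto simp: S_def)
    finally show ?thesis by (simp add: q_def power_divide norm_power norm_mult)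
  qed
  have "eventually (\<lambda>z. z \<in> ball 0 \<rho>) (nhds (0 :: complex ^ 'a))"
    using \<rho> by (intro eventually_nhds_in_open) auto
  then have "eventually (\<lambda>z. norm (F z $ j - jet_poly l (c j) z)
      \<le> S / \<rho> ^ Suc l * norm (complex_of_real (norm z ^ Suc l))) (nhds 0)"
    by eventually_elim (rule bound, simp)
  then show ?thesis unfolding has_jet_def by (rule bigoI)
qed

lemma taylor_const:
  assumes "taylor_at_0 F c"
  shows "mcoeff (c j) 0 = F 0 $ j"
proof -
  from assms have "((\<lambda>Q. mcoeff (c j) Q * mpow 0 Q) has_sum (F 0 $ j)) UNIV"
    by (auto simp: taylor_at_0_def)
  moreover have "((\<lambda>Q. mcoeff (c j) Q * mpow 0 Q) has_sum (mcoeff (c j) 0)) UNIV"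
  proof -
    have "mpow 0 Q = 0" if "Q \<noteq> 0" for Q :: "nat ^ 'a"
      using that by (auto simp: mpow_def vec_eq_iff)
    then have "((\<lambda>Q. mcoeff (c j) Q * mpow 0 Q) has_sum (\<Sum>Q\<in>{0}. mcoeff (c j) Q * mpow 0 Q)) UNIV"
      by (subst has_sum_cong_neutral[where T = "{0}" and g = "\<lambda>Q. mcoeff (c j) Q * mpow 0 Q"])
         (auto intro!: has_sum_finiteI)
    then show ?thesis by simp
  qed
  ultimately show ?thesis by (metis has_sum_unique)
qed

text \<open>
  Both terms have the same \<open>l\<close>-jet, by the formal conjugacy equation. So a polynomial change of
  coordinates conjugates \<open>F\<close> to the truncated normal form up to an error of order \<open>l + 1\<close>.
\<close>

lemma normal_form_up_to_order:
  assumes c: "taylor_at_0 F c" and F0: "F 0 = 0" and Phi: "tangent_to_id Phi"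
    and conj: "fcompose G Phi = fcompose Phi c"
  shows "(\<lambda>z. jet_poly l (Phi j) (F z) - jet_poly l (G j) (\<chi> h. jet_poly l (Phi h) z))
    \<in> O[nhds 0](\<lambda>z. complex_of_real (norm z ^ Suc l))"
proof (rule has_jet_unique)
  show "has_jet l (\<lambda>z. jet_poly l (Phi j) (F z)) (fcompose Phi c j)"
    using taylor_has_jet[OF c] taylor_const[OF c] F0 by (intro has_jet_fcompose) auto
  have "mcoeff (Phi h) 0 = 0" for h
  proof -
    have "(0 :: nat ^ 'a) \<noteq> axis h 1" by (auto simp: vec_eq_iff axis_def)
    then show ?thesis using Phi by (auto simp: tangent_to_id_def)
  qed
  then show "has_jet l (\<lambda>z. jet_poly l (G j) (\<chi> h. jet_poly l (Phi h) z)) (fcompose Phi c j)"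
    unfolding conj[symmetric] by (intro has_jet_fcompose) (simp_all add: has_jet_jet_poly)
qed

lemma tangent_to_id_jet:
  assumes Phi: "tangent_to_id Phi" and l: "l \<ge> 1"
  shows "(\<lambda>z. jet_poly l (Phi j) z - z $ j) \<in> O[nhds 0](\<lambda>z. complex_of_real (norm z ^ 2))"
proof -
  let ?S = "{Q. mdeg Q \<le> l}"
  have fin: "finite ?S" by simp
  have "jet_poly l (Phi j) z - z $ j = (\<Sum>Q\<in>?S - {Q. mdeg Q \<le> 1}. mcoeff (Phi j) Q * mpow z Q)" for z
  proof -
    have "(\<Sum>Q\<in>{Q. mdeg Q \<le> 1}. mcoeff (Phi j) Q * mpow z Q) = (\<Sum>Q\<in>{axis j 1}. mcoeff (Phi j) Q * mpow z Q)"
      using Phi by (intro sum.mono_neutral_right) (auto simp: tangent_to_id_def)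
    also have "\<dots> = z $ j" using Phi by (simp add: tangent_to_id_def)
    finally have low: "(\<Sum>Q\<in>{Q. mdeg Q \<le> 1}. mcoeff (Phi j) Q * mpow z Q) = z $ j" .
    show ?thesis
      unfolding jet_poly_def low[symmetric] using l by (intro sum_diff[symmetric] fin) auto
  qed
  moreover have "(\<lambda>z. \<Sum>Q\<in>?S - {Q. mdeg Q \<le> 1}. mcoeff (Phi j) Q * mpow z Q)
      \<in> O[nhds 0](\<lambda>z. complex_of_real (norm z ^ 2))"
  proof (rule big_sum_in_bigo)
    fix Q :: "nat ^ 'a" assume "Q \<in> ?S - {Q. mdeg Q \<le> 1}"
    then have "2 \<le> mdeg Q" by auto
    from bigo_mpow[OF this] show "(\<lambda>z. mcoeff (Phi j) Q * mpow z Q) \<in> O[nhds 0](\<lambda>z. complex_of_real (norm z ^ 2))"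
      by (cases "mcoeff (Phi j) Q = 0") simp_all
  qed
  ultimately show ?thesis by simp
qed

lemma bigo_nhds_0E:
  fixes f :: "'i::finite \<Rightarrow> complex ^ 'n \<Rightarrow> complex"
  assumes "\<And>j. f j \<in> O[nhds 0](\<lambda>z. complex_of_real (norm z ^ d))"
  obtains C r where "C > 0" "r > 0" "\<And>j z. norm z < r \<Longrightarrow> norm (f j z) \<le> C * norm z ^ d"
proof -
  have "\<exists>C r. C > 0 \<and> r > 0 \<and> (\<forall>z. norm z < r \<longrightarrow> norm (f j z) \<le> C * norm z ^ d)" for j
  proof -
    obtain C where "C > 0" "eventually (\<lambda>z. norm (f j z) \<le> C * norm (complex_of_real (norm z ^ d))) (nhds 0)"
      using assms[of j] by (rule landau_o.bigE)
    then show ?thesis unfolding eventually_nhds_metric by (auto simp: norm_power)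
  qed
  then obtain C r where Cr: "\<And>j. C j > 0" "\<And>j. r j > 0"
    "\<And>j z. norm z < r j \<Longrightarrow> norm (f j z) \<le> C j * norm z ^ d" by metis
  show thesis
  proof (rule that[of "\<Sum>j\<in>UNIV. C j" "Min (range r)"])
    show "(\<Sum>j\<in>UNIV. C j) > 0" using Cr(1) by (intro sum_pos) auto
    show "Min (range r) > 0" using Cr(2) by (subst Min_gr_iff) auto
    fix j and z :: "complex ^ 'n" assume "norm z < Min (range r)"
    then have "norm (f j z) \<le> C j * norm z ^ d" by (intro Cr) simp
    also have "\<dots> \<le> (\<Sum>j\<in>UNIV. C j) * norm z ^ d"
      using Cr(1) by (intro mult_right_mono member_le_sum) (auto intro: less_imp_le)
    finally show "norm (f j z) \<le> (\<Sum>j\<in>UNIV. C j) * norm z ^ d" .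
  qed
qed

section \<open>Norms adapted to a linear map with spectrum in the right half plane\<close>

text \<open>
  The vector \<open>p(B) y\<close>, by Horner's scheme.
\<close>

definition poly_act :: "complex ^ 'm ^ 'm \<Rightarrow> complex poly \<Rightarrow> complex ^ 'm \<Rightarrow> complex ^ 'm"
  where "poly_act B p y = foldr (\<lambda>a acc. a *s y + B *v acc) (coeffs p) 0"

lemma poly_act_0 [simp]: "poly_act B 0 y = 0"
  by (simp add: poly_act_def)

lemma poly_act_pCons: "poly_act B (pCons a p) y = a *s y + B *v poly_act B p y"
  by (cases "pCons a p = 0") (auto simp: poly_act_def cCons_def)

lemma poly_act_smult: "poly_act B (smult c p) y = c *s poly_act B p y"
  by (induction p)
     (simp_all add: poly_act_pCons vec.scale_right_distrib matrix_vector_mult_scaleR vector_scalar_commute)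

lemma poly_act_add: "poly_act B (p + q) y = poly_act B p y + poly_act B q y"
proof (induction p q rule: poly_induct2)
  case (pCons a p b q)
  then show ?case
    by (simp add: poly_act_pCons vec.scale_left_distrib matrix_vector_right_distrib algebra_simps)
qed simp

lemma poly_act_linear_factor:
  "poly_act B ([:-\<mu>, 1:] * q) y = B *v poly_act B q y - \<mu> *s poly_act B q y"
proof -
  have "[:-\<mu>, 1:] * q = smult (-\<mu>) q + pCons 0 q" by simp
  then show ?thesis
    by (simp only: poly_act_add poly_act_smult poly_act_pCons vec.scale_minus_left) simp
qed

lemma poly_act_monom: "poly_act B (monom c i) y = c *s (((*v) B ^^ i) y)"
  by (induction i) (simp_all add: monom_0 monom_Suc poly_act_pCons vector_scalar_commute)

lemma poly_act_sum: "poly_act B (\<Sum>i\<in>I. p i) y = (\<Sum>i\<in>I. poly_act B (p i) y)"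
  by (induction I rule: infinite_finite_induct) (simp_all add: poly_act_add)

lemma nontrivial_relation:
  fixes f :: "nat \<Rightarrow> complex ^ 'm"
  obtains c i where "i \<le> CARD('m)" "c i \<noteq> 0" "(\<Sum>i\<le>CARD('m). c i *s f i) = 0"
proof (cases "inj_on f {..CARD('m)}")
  case False
  then obtain i j where ij: "i \<le> CARD('m)" "j \<le> CARD('m)" "i \<noteq> j" "f i = f j"
    by (auto simp: inj_on_def)
  define c :: "nat \<Rightarrow> complex" where "c = (\<lambda>k. if k = i then 1 else if k = j then -1 else 0)"
  have "(\<Sum>k\<le>CARD('m). c k *s f k) = (\<Sum>k\<in>{i, j}. c k *s f k)"
    using ij by (intro sum.mono_neutral_right) (auto simp: c_def)
  also have "\<dots> = 0" using ij by (simp add: c_def vec.scale_minus_left)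
  finally show thesis using that[of i c] ij by (simp add: c_def)
next
  case True
  let ?V = "f ` {..CARD('m)}"
  have "card ?V = Suc CARD('m)" using True by (simp add: card_image)
  then have "vec.dim ?V < card ?V"
    using dim_subset_UNIV_cart_gen[of ?V] by simp
  then have "vec.dependent ?V"
    using vec.dim_eq_card_independent by force
  then obtain u v where "v \<in> ?V" "u v \<noteq> 0" "(\<Sum>v\<in>?V. u v *s v) = 0"
    by (subst (asm) vec.dependent_finite) auto
  then obtain i where "i \<le> CARD('m)" "u (f i) \<noteq> 0" by auto
  moreover have "(\<Sum>i\<le>CARD('m). u (f i) *s f i) = 0"
    using \<open>(\<Sum>v\<in>?V. u v *s v) = 0\<close> True by (simp add: sum.reindex)
  ultimately show thesis using that[of i "\<lambda>i. u (f i)"] by simp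
qed

text \<open>
  Among the nonzero polynomials \<open>p\<close> with \<open>p(B) y \<in> S\<close> one of minimal degree is not constant, so it has a
  root \<open>\<mu>\<close>. With \<open>p = (X - \<mu>) q\<close>, the vector \<open>e = q(B) y\<close> is outside \<open>S\<close> by minimality.
\<close>

lemma eigenvector_modulo_invariant_subspace:
  fixes B :: "complex ^ 'm ^ 'm"
  assumes S: "vec.subspace S" and y: "y \<notin> S"
  obtains e \<mu> where "e \<notin> S" "B *v e - \<mu> *s e \<in> S"
proof -
  obtain c i where ci: "i \<le> CARD('m)" "c i \<noteq> 0"
    and rel: "(\<Sum>i\<le>CARD('m). c i *s (((*v) B ^^ i) y)) = 0"
    by (rule nontrivial_relation[where f = "\<lambda>i. ((*v) B ^^ i) y"])
  define p0 where "p0 = (\<Sum>i\<le>CARD('m). monom (c i) i)"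
  have "coeff p0 i = c i"
    using ci by (simp add: p0_def coeff_sum)
  with ci have "p0 \<noteq> 0" by auto
  moreover have "poly_act B p0 y = 0"
    using rel by (simp add: p0_def poly_act_sum poly_act_monom)
  then have "poly_act B p0 y \<in> S" using S by (simp add: vec.subspace_0)
  ultimately obtain p where p: "p \<noteq> 0" "poly_act B p y \<in> S"
    and least: "\<And>q. q \<noteq> 0 \<Longrightarrow> poly_act B q y \<in> S \<Longrightarrow> degree p \<le> degree q"
    using ex_has_least_nat[of "\<lambda>p. p \<noteq> 0 \<and> poly_act B p y \<in> S" p0 degree] by blast
  have "degree p \<noteq> 0"
  proof
    assume "degree p = 0"
    then obtain a where a: "p = [:a:]" by (rule degree_eq_zeroE)
    with p have "a \<noteq> 0" "a *s y \<in> S" by (auto simp: poly_act_pCons)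
    then have "inverse a *s (a *s y) \<in> S" using S by (blast intro: vec.subspace_scale)
    with \<open>a \<noteq> 0\<close> y show False by simp
  qed
  then obtain \<mu> where "poly p \<mu> = 0"
    using fundamental_theorem_of_algebra[of p] by (auto simp: constant_degree)
  then obtain q where q: "p = [:-\<mu>, 1:] * q"
    by (auto simp: poly_eq_0_iff_dvd)
  with p have "q \<noteq> 0" by auto
  then have "degree p = Suc (degree q)"
    unfolding q by (subst degree_mult_eq) auto
  with least[of q] \<open>q \<noteq> 0\<close> have "poly_act B q y \<notin> S" by auto
  moreover have "B *v poly_act B q y - \<mu> *s poly_act B q y \<in> S"
    using p(2) by (simp only: q poly_act_linear_factor)
  ultimately show thesis by (rule that)
qed

text \<open>
  Otherwise \<open>B - \<mu>\<close> is injective, so it maps the invariant subspace \<open>S\<close> onto itself, and the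
  preimage of \<open>B e - \<mu> e\<close> in \<open>S\<close> would have to be \<open>e\<close>.
\<close>

lemma eigenvalue_from_quotient:
  fixes B :: "complex ^ 'm ^ 'm"
  assumes S: "vec.subspace S" and inv: "\<And>x. x \<in> S \<Longrightarrow> B *v x \<in> S"
    and e: "e \<notin> S" "B *v e - \<mu> *s e \<in> S"
  obtains w where "w \<noteq> 0" "B *v w = \<mu> *s w"
proof (rule ccontr)
  assume neg: "\<not> thesis"
  let ?f = "\<lambda>x. B *v x - \<mu> *s x"
  have lin: "Vector_Spaces.linear (*s) (*s) ?f"
    by unfold_locales
       (simp_all add: matrix_vector_right_distrib vec.scale_right_distrib vec.scale_right_diff_distrib
          vector_scalar_commute vec.scale_left_commute)
  have ker: "x = 0" if "?f x = 0" for x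
    using neg that that[symmetric] \<open>\<And>w. w \<noteq> 0 \<Longrightarrow> B *v w = \<mu> *s w \<Longrightarrow> thesis\<close> by fastforce
  have inj: "inj ?f"
    using lin ker by (subst vec.linear_inj_iff_eq_0) auto
  have sub: "?f ` S \<subseteq> S"
    using inv S by (auto intro: vec.subspace_diff vec.subspace_scale)
  have "vec.dim (?f ` S) = vec.dim S"
    using lin inj by (intro vec.dim_image_eq) (auto intro: inj_on_subset)
  then have "?f ` S = S"
    using sub S lin by (intro vec.subspace_dim_equal vec.linear_subspace_image) auto
  with e(2) have "?f e \<in> ?f ` S" by simp
  then obtain x where x: "x \<in> S" "?f x = ?f e" by fastforce
  from injD[OF inj x(2)] x(1) e(1) show False by simp
qed

definition norm_on :: "(complex ^ 'm) set \<Rightarrow> (complex ^ 'm \<Rightarrow> real) \<Rightarrow> bool"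
  where "norm_on S N \<longleftrightarrow>
    (\<forall>x\<in>S. 0 \<le> N x \<and> (N x = 0 \<longrightarrow> x = 0) \<and> (\<forall>a. N (a *s x) = norm a * N x) \<and>
      (\<forall>y\<in>S. N (x + y) \<le> N x + N y))"

text \<open>
  The explicit Euler steps of \<open>x' = - B x\<close> contract at a uniform rate. A norm that contracts the flow
  would not be enough for a discrete dynamical system.
\<close>

definition contracting_on :: "complex ^ 'm ^ 'm \<Rightarrow> (complex ^ 'm) set \<Rightarrow> (complex ^ 'm \<Rightarrow> real) \<Rightarrow> bool"
  where "contracting_on B S N \<longleftrightarrow>
    (\<exists>c>0. \<exists>s0>0. \<forall>s x. 0 \<le> s \<and> s \<le> s0 \<and> x \<in> S \<longrightarrow>
       N (x - of_real s *s (B *v x)) \<le> (1 - c * s) * N x)"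

lemma norm_one_minus_le:
  assumes "Re \<mu> > 0" "0 \<le> s" "s \<le> Re \<mu> / (norm \<mu>)\<^sup>2"
  shows "norm (1 - of_real s * \<mu>) \<le> 1 - s * Re \<mu> / 2"
proof -
  have n: "norm \<mu> > 0" using assms(1) by auto
  have a: "s * (norm \<mu>)\<^sup>2 \<le> Re \<mu>" using assms n by (simp add: field_simps)
  then have b: "s * (s * (norm \<mu>)\<^sup>2) \<le> s * Re \<mu>" using assms(2) by (intro mult_left_mono)
  have "(Re \<mu>)\<^sup>2 \<le> (norm \<mu>)\<^sup>2" by (simp add: cmod_def)
  then have "s * (Re \<mu>)\<^sup>2 \<le> s * (norm \<mu>)\<^sup>2" using assms(2) by (intro mult_left_mono)
  with a have "(s * Re \<mu>) * Re \<mu> \<le> 1 * Re \<mu>" by (simp add: power2_eq_square mult.assoc)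
  then have c: "s * Re \<mu> \<le> 1" using assms(1) by (simp only: mult_le_cancel_right_pos)
  have "(norm (1 - of_real s * \<mu>))\<^sup>2 = 1 - 2 * (s * Re \<mu>) + s * (s * (norm \<mu>)\<^sup>2)"
    unfolding cmod_power2 by (simp add: algebra_simps power2_eq_square)
  also have "\<dots> \<le> (1 - s * Re \<mu> / 2)\<^sup>2"
    using b zero_le_power2[of "s * Re \<mu>"] by (simp add: power2_eq_square algebra_simps)
  finally have "(norm (1 - of_real s * \<mu>))\<^sup>2 \<le> (1 - s * Re \<mu> / 2)\<^sup>2" .
  moreover have "0 \<le> 1 - s * Re \<mu> / 2" using c by linarith
  ultimately show ?thesis by (rule power2_le_imp_le)
qed

text \<open>
  The new norm is \<open>N(x) + K |\<alpha>|\<close> on \<open>x + \<alpha> e\<close>. The map \<open>B\<close> couples the new coordinate \<open>\<alpha>\<close> to \<open>S\<close> through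
  the vector \<open>f = B e - \<mu> e\<close>, and a large \<open>K\<close> lets the decay of \<open>\<alpha>\<close> absorb this coupling.
\<close>

lemma adapted_norm_extend:
  fixes B :: "complex ^ 'm ^ 'm"
  assumes S: "vec.subspace S" and inv: "\<And>x. x \<in> S \<Longrightarrow> B *v x \<in> S"
    and N: "norm_on S N" "contracting_on B S N"
    and e: "e \<notin> S" "B *v e - \<mu> *s e \<in> S" and \<mu>: "Re \<mu> > 0"
  obtains S' N' where "vec.subspace S'" "S \<subset> S'" "\<forall>x\<in>S'. B *v x \<in> S'"
    "norm_on S' N'" "contracting_on B S' N'"
proof -
  define S' where "S' = {x + \<alpha> *s e | x \<alpha>. x \<in> S}"
  define f where "f = B *v e - \<mu> *s e"
  have fS: "f \<in> S" using e by (simp add: f_def)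
  have Be: "B *v e = f + \<mu> *s e" by (simp add: f_def)
  have uniq: "x = x' \<and> \<alpha> = \<alpha>'" if "x + \<alpha> *s e = x' + \<alpha>' *s e" "x \<in> S" "x' \<in> S" for x x' \<alpha> \<alpha>'
  proof -
    have *: "(\<alpha> - \<alpha>') *s e = x' - x"
      using that(1) by (simp add: vec.scale_left_diff_distrib algebra_simps)
    have "\<alpha> = \<alpha>'"
    proof (rule ccontr)
      assume "\<alpha> \<noteq> \<alpha>'"
      then have "inverse (\<alpha> - \<alpha>') * (\<alpha> - \<alpha>') = 1" by simp
      then have "e = inverse (\<alpha> - \<alpha>') *s (x' - x)"
        by (simp only: *[symmetric] vec.scale_scale vec.scale_one)
      with S that have "e \<in> S" by (simp add: vec.subspace_diff vec.subspace_scale)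
      with e show False by simp
    qed
    with that show ?thesis by simp
  qed
  define K where "K = 4 * N f / Re \<mu> + 1"
  have scaleN: "N (a *s x) = norm a * N x" if "x \<in> S" for a x
    using N that by (simp add: norm_on_def)
  have Nf: "N f \<ge> 0" using N fS by (auto simp: norm_on_def)
  then have K: "K > 0" using \<mu> by (simp add: K_def add_nonneg_pos)
  define N' where "N' = (\<lambda>z. let (x, \<alpha>) = (SOME (x, \<alpha>). x \<in> S \<and> z = x + \<alpha> *s e) in N x + K * norm \<alpha>)"
  have N': "N' (x + \<alpha> *s e) = N x + K * norm \<alpha>" if "x \<in> S" for x \<alpha>
  proof -
    have "(SOME (x', \<alpha>'). x' \<in> S \<and> x + \<alpha> *s e = x' + \<alpha>' *s e) = (x, \<alpha>)"
      using that by (intro some_equality) (auto dest: uniq)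
    then show ?thesis by (simp add: N'_def)
  qed
  have add: "(x + \<alpha> *s e) + (y + \<beta> *s e) = (x + y) + (\<alpha> + \<beta>) *s e" for x y \<alpha> \<beta>
    by (simp add: vec.scale_left_distrib algebra_simps)
  have scale: "a *s (x + \<alpha> *s e) = a *s x + (a * \<alpha>) *s e" for a x \<alpha>
    by (simp add: vec.scale_right_distrib)
  have B: "B *v (x + \<alpha> *s e) = (B *v x + \<alpha> *s f) + (\<alpha> * \<mu>) *s e" for x \<alpha>
    by (simp add: matrix_vector_right_distrib vector_scalar_commute Be scale
        vec.scale_right_distrib add.assoc)
  have sub: "vec.subspace S'"
    unfolding vec.subspace_def
  proof (intro conjI ballI allI)
    have "0 = 0 + 0 *s e \<and> 0 \<in> S" using vec.subspace_0[OF S] by simp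
    then show "0 \<in> S'" unfolding S'_def by blast
    show "x + y \<in> S'" if "x \<in> S'" "y \<in> S'" for x y
    proof -
      from that obtain x0 \<alpha> y0 \<beta> where "x = x0 + \<alpha> *s e" "x0 \<in> S" "y = y0 + \<beta> *s e" "y0 \<in> S"
        by (auto simp: S'_def)
      then have "x + y = (x0 + y0) + (\<alpha> + \<beta>) *s e" "x0 + y0 \<in> S"
        using add S by (auto intro: vec.subspace_add)
      then show ?thesis unfolding S'_def by blast
    qed
    show "c *s x \<in> S'" if "x \<in> S'" for c x
    proof -
      from that obtain x0 \<alpha> where "x = x0 + \<alpha> *s e" "x0 \<in> S" by (auto simp: S'_def)
      then have "c *s x = c *s x0 + (c * \<alpha>) *s e" "c *s x0 \<in> S"
        using scale S by (auto intro: vec.subspace_scale)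
      then show ?thesis unfolding S'_def by blast
    qed
  qed
  have "S \<subseteq> S'"
  proof
    fix x assume "x \<in> S"
    then have "x = x + 0 *s e \<and> x \<in> S" by simp
    then show "x \<in> S'" unfolding S'_def by blast
  qed
  moreover have "e \<in> S'"
  proof -
    have "e = 0 + 1 *s e \<and> 0 \<in> S" using vec.subspace_0[OF S] by simp
    then show ?thesis unfolding S'_def by blast
  qed
  ultimately have psub: "S \<subset> S'" using e by blast
  have invS': "B *v x \<in> S'" if "x \<in> S'" for x
  proof -
    from that obtain x0 \<alpha> where "x = x0 + \<alpha> *s e" "x0 \<in> S" by (auto simp: S'_def)
    then have "B *v x = (B *v x0 + \<alpha> *s f) + (\<alpha> * \<mu>) *s e" "B *v x0 + \<alpha> *s f \<in> S"
      using B S inv fS by (auto intro!: vec.subspace_add vec.subspace_scale)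
    then show ?thesis unfolding S'_def by blast
  qed
  have norm': "norm_on S' N'"
    unfolding norm_on_def
  proof (intro ballI conjI impI allI)
    fix x assume "x \<in> S'"
    then obtain x0 \<alpha> where x: "x = x0 + \<alpha> *s e" "x0 \<in> S" by (auto simp: S'_def)
    have N0: "N x0 \<ge> 0" "N x0 = 0 \<Longrightarrow> x0 = 0" using N x by (auto simp: norm_on_def)
    show "0 \<le> N' x" using x K N0 by (simp add: N')
    show "x = 0" if "N' x = 0"
    proof -
      have "N x0 + K * norm \<alpha> = 0" using that x by (simp add: N')
      then have "N x0 = 0" "K * norm \<alpha> = 0"
        using N0 K by (smt (verit) mult_nonneg_nonneg norm_ge_zero)+
      with N0 K x show ?thesis by simp
    qed
    show "N' (a *s x) = norm a * N' x" for a
    proof -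
      have "N (a *s x0) = norm a * N x0" using N x by (auto simp: norm_on_def)
      then show ?thesis using x S
        by (simp add: scale N' vec.subspace_scale norm_mult algebra_simps)
    qed
    show "N' (x + y) \<le> N' x + N' y" if "y \<in> S'" for y
    proof -
      from that obtain y0 \<beta> where y: "y = y0 + \<beta> *s e" "y0 \<in> S" by (auto simp: S'_def)
      have "N (x0 + y0) \<le> N x0 + N y0" using N x y by (auto simp: norm_on_def)
      moreover have "K * norm (\<alpha> + \<beta>) \<le> K * norm \<alpha> + K * norm \<beta>"
        using K norm_triangle_ineq[of \<alpha> \<beta>] by (simp flip: distrib_left)
      moreover have "N' (x + y) = N (x0 + y0) + K * norm (\<alpha> + \<beta>)"
        unfolding x y add using x y S by (intro N' vec.subspace_add)
      ultimately show ?thesis using x y by (simp add: N')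
    qed
  qed
  from N(2) obtain c s0 where c: "c > 0" "s0 > 0"
    and contr: "\<And>s x. 0 \<le> s \<Longrightarrow> s \<le> s0 \<Longrightarrow> x \<in> S \<Longrightarrow>
      N (x - of_real s *s (B *v x)) \<le> (1 - c * s) * N x"
    unfolding contracting_on_def by blast
  \<comment> \<open>Half of the decay rate \<open>Re \<mu> / 2\<close> of the new coordinate pays for the coupling, half remains.\<close>
  define c' where "c' = min c (Re \<mu> / 4)"
  define s1 where "s1 = min s0 (Re \<mu> / (norm \<mu>)\<^sup>2)"
  have "norm \<mu> > 0" using \<mu> by auto
  then have pos: "c' > 0" "s1 > 0" using c \<mu> by (auto simp: c'_def s1_def)
  have "N' (x - of_real s *s (B *v x)) \<le> (1 - c' * s) * N' x"
    if "0 \<le> s" "s \<le> s1" "x \<in> S'" for s x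
  proof -
    from that obtain x0 \<alpha> where x: "x = x0 + \<alpha> *s e" "x0 \<in> S" by (auto simp: S'_def)
    define y0 where "y0 = x0 - of_real s *s (B *v x0)"
    define g where "g = (- (of_real s * \<alpha>)) *s f"
    have y0: "y0 \<in> S" using S inv x by (auto simp: y0_def intro!: vec.subspace_diff vec.subspace_scale)
    have g: "g \<in> S" using S fS by (auto simp: g_def intro!: vec.subspace_neg vec.subspace_scale)
    have eq: "x - of_real s *s (B *v x) = (y0 + g) + ((1 - of_real s * \<mu>) * \<alpha>) *s e"
      unfolding x B y0_def g_def
      by (simp add: vec.scale_right_distrib vec.scale_left_diff_distrib vec.scale_minus_left
          vec.scale_right_diff_distrib algebra_simps)
    have "N (y0 + g) \<le> N y0 + N g" using N y0 g by (auto simp: norm_on_def)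
    also have "N g = s * norm \<alpha> * N f"
    proof -
      have "N g = norm (- (of_real s * \<alpha>)) * N f"
        unfolding g_def by (rule scaleN[OF fS])
      then show ?thesis using that by (simp add: norm_mult)
    qed
    also have "N f = Re \<mu> / 4 * (K - 1)" using \<mu> by (simp add: K_def)
    also have "N y0 \<le> (1 - c * s) * N x0"
      using contr[of s x0] that x by (simp add: y0_def s1_def)
    finally have 1: "N (y0 + g) \<le> (1 - c * s) * N x0 + s * norm \<alpha> * (Re \<mu> / 4 * (K - 1))" by simp
    have "norm ((1 - of_real s * \<mu>) * \<alpha>) \<le> (1 - s * Re \<mu> / 2) * norm \<alpha>"
      unfolding norm_mult using \<mu> that by (intro mult_right_mono norm_one_minus_le) (auto simp: s1_def)
    then have 2: "K * norm ((1 - of_real s * \<mu>) * \<alpha>) \<le> K * ((1 - s * Re \<mu> / 2) * norm \<alpha>)"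
      using K by (intro mult_left_mono) auto
    have "N x0 \<ge> 0" using N x by (auto simp: norm_on_def)
    then have 3: "(1 - c * s) * N x0 \<le> (1 - c' * s) * N x0"
      using that by (intro mult_right_mono) (auto simp: c'_def mult_right_mono)
    have 4: "(1 - s * (Re \<mu> / 4)) * (K * norm \<alpha>) \<le> (1 - c' * s) * (K * norm \<alpha>)"
    proof (rule mult_right_mono)
      have "c' * s \<le> Re \<mu> / 4 * s" using that by (intro mult_right_mono) (auto simp: c'_def)
      then show "1 - s * (Re \<mu> / 4) \<le> 1 - c' * s" by (simp add: mult.commute)
    qed (use K in simp)
    have 5: "0 \<le> s * norm \<alpha> * Re \<mu>" using that \<mu> by simp
    have "N' (x - of_real s *s (B *v x)) = N (y0 + g) + K * norm ((1 - of_real s * \<mu>) * \<alpha>)"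
      unfolding eq using y0 g S by (intro N' vec.subspace_add)
    also have "\<dots> \<le> (1 - c' * s) * N x0 + (1 - c' * s) * (K * norm \<alpha>)"
    proof -
      have "s * norm \<alpha> * (Re \<mu> / 4 * (K - 1)) + K * ((1 - s * Re \<mu> / 2) * norm \<alpha>)
          = (1 - s * (Re \<mu> / 4)) * (K * norm \<alpha>) - s * norm \<alpha> * Re \<mu> / 4"
        by (simp add: field_simps)
      with 1 2 3 4 5 show ?thesis by linarith
    qed
    also have "\<dots> = (1 - c' * s) * N' x" using x by (simp add: N' algebra_simps)
    finally show ?thesis .
  qed
  then have "contracting_on B S' N'" unfolding contracting_on_def using pos by blast
  with sub psub invS' norm' show thesis by (intro that) auto
qed

text \<open>
  An invariant subspace of maximal dimension that carries a contracting norm is the whole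
  space, since it could otherwise be enlarged by one dimension.
\<close>

lemma adapted_norm_exists:
  fixes B :: "complex ^ 'm ^ 'm"
  assumes ev: "\<And>\<mu> w. w \<noteq> 0 \<Longrightarrow> B *v w = \<mu> *s w \<Longrightarrow> Re \<mu> > 0"
  obtains N where "norm_on UNIV N" "contracting_on B UNIV N"
proof -
  define good where "good S N \<longleftrightarrow> vec.subspace S \<and> (\<forall>x\<in>S. B *v x \<in> S) \<and> norm_on S N \<and> contracting_on B S N"
    for S :: "(complex ^ 'm) set" and N
  have "good {0} norm"
    by (auto simp: good_def norm_on_def contracting_on_def vec.subspace_def intro: exI[of _ 1])
  then have ex0: "\<exists>N. good {0} N" by blast
  have bd: "\<forall>S. (\<exists>N. good S N) \<longrightarrow> vec.dim S < Suc CARD('m)"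
    using dim_subset_UNIV_cart_gen by (auto simp: less_Suc_eq_le)
  obtain S where "\<exists>N. good S N" and max: "\<And>T. \<exists>N. good T N \<Longrightarrow> vec.dim T \<le> vec.dim S"
    using ex_has_greatest_nat[of "\<lambda>S. \<exists>N. good S N", OF ex0 bd] by blast
  then obtain N where N: "good S N" by blast
  have "S = UNIV"
  proof (rule ccontr)
    assume "S \<noteq> UNIV"
    then obtain y where y: "y \<notin> S" by blast
    have S: "vec.subspace S" "\<And>x. x \<in> S \<Longrightarrow> B *v x \<in> S" "norm_on S N" "contracting_on B S N"
      using N by (auto simp: good_def)
    obtain e \<mu> where e: "e \<notin> S" "B *v e - \<mu> *s e \<in> S"
      by (rule eigenvector_modulo_invariant_subspace[OF S(1) y])
    obtain w where "w \<noteq> 0" "B *v w = \<mu> *s w"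
      by (rule eigenvalue_from_quotient[OF S(1,2) e])
    then have \<mu>: "Re \<mu> > 0" by (rule ev)
    obtain S' N' where S': "vec.subspace S'" "S \<subset> S'" "\<forall>x\<in>S'. B *v x \<in> S'"
      "norm_on S' N'" "contracting_on B S' N'"
      by (rule adapted_norm_extend[OF S e \<mu>])
    have "vec.dim S < vec.dim S'"
      using S(1) S' by (intro vec.dim_psubset) (simp add: vec.span_eq_iff[THEN iffD2])
    moreover have "\<exists>N. good S' N" using S' by (auto simp: good_def)
    ultimately show False using max[of S'] by simp
  qed
  with N show thesis using that by (auto simp: good_def)
qed

lemma norm_on_UNIV_upper_bound:
  fixes N :: "complex ^ 'm \<Rightarrow> real"
  assumes N: "norm_on UNIV N"
  obtains b where "b > 0" "\<And>x. N x \<le> b * norm x"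
proof -
  have tri: "N (x + y) \<le> N x + N y" and scale: "N (c *s x) = norm c * N x"
    and nonneg: "0 \<le> N x" for x y c
    using N by (auto simp: norm_on_def)
  have N0: "N 0 = 0" using scale[of 0 0] by simp
  have sum: "N (\<Sum>i\<in>I. f i) \<le> (\<Sum>i\<in>I. N (f i))" for I and f :: "'m \<Rightarrow> _"
    by (induction I rule: infinite_finite_induct) (auto simp: N0 intro: order_trans[OF tri])
  define b where "b = 1 + (\<Sum>i\<in>UNIV. N (axis i 1))"
  have b: "b > 0" using sum_nonneg[of UNIV "\<lambda>i. N (axis i 1)"] nonneg by (simp add: b_def add_pos_nonneg)
  have up: "N x \<le> b * norm x" for x
  proof -
    have "N x = N (\<Sum>i\<in>UNIV. x $ i *s axis i 1)" by (simp add: basis_expansion)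
    also have "\<dots> \<le> (\<Sum>i\<in>UNIV. norm (x $ i) * N (axis i 1))"
      using sum[of "\<lambda>i. x $ i *s axis i 1" UNIV] by (simp add: scale)
    also have "\<dots> \<le> (\<Sum>i\<in>UNIV. norm x * N (axis i 1))"
      by (intro sum_mono mult_right_mono nonneg Finite_Cartesian_Product.norm_nth_le)
    also have "\<dots> \<le> b * norm x" by (simp add: b_def sum_distrib_left[symmetric] algebra_simps)
    finally show ?thesis .
  qed
  with b show thesis by (rule that)
qed

lemma norm_on_continuous:
  assumes N: "norm_on UNIV N"
  shows "continuous_on UNIV N"
proof (rule continuous_onI)
  obtain b where ab: "b > 0" "\<And>x. N x \<le> b * norm x"
    by (rule norm_on_UNIV_upper_bound[OF N]) blast
  have tri: "N (x + y) \<le> N x + N y" for x y using N by (auto simp: norm_on_def)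
  fix x :: "complex ^ 'a" and \<epsilon> :: real assume "\<epsilon> > 0"
  have "dist (N x') (N x) \<le> \<epsilon>" if "dist x' x < \<epsilon> / b" for x'
  proof -
    have "N x' \<le> N x + b * dist x' x"
      using tri[of x "x' - x"] ab(2)[of "x' - x"] by (simp add: dist_norm)
    moreover have "N x \<le> N x' + b * dist x' x"
      using tri[of x' "x - x'"] ab(2)[of "x - x'"] by (simp add: dist_norm norm_minus_commute)
    moreover have "b * dist x' x < \<epsilon>" using that ab by (simp add: field_simps)
    ultimately show ?thesis by (simp add: dist_real_def)
  qed
  then show "\<exists>d>0. \<forall>x'\<in>UNIV. dist x' x < d \<longrightarrow> dist (N x') (N x) \<le> \<epsilon>"
    using \<open>\<epsilon> > 0\<close> ab by (intro exI[of _ "\<epsilon> / b"]) simp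
qed

lemma norm_on_UNIV_equivalent:
  fixes N :: "complex ^ 'm \<Rightarrow> real"
  assumes N: "norm_on UNIV N"
  obtains a b where "a > 0" "b > 0" "\<And>x. a * norm x \<le> N x" "\<And>x. N x \<le> b * norm x"
proof -
  have tri: "N (x + y) \<le> N x + N y" and scale: "N (c *s x) = norm c * N x"
    and nonneg: "0 \<le> N x" and pos: "N x = 0 \<Longrightarrow> x = 0" for x y c
    using N by (auto simp: norm_on_def)
  have N0: "N 0 = 0" using scale[of 0 0] by simp
  obtain b where b: "b > 0" and up: "\<And>x. N x \<le> b * norm x"
    by (rule norm_on_UNIV_upper_bound[OF N]) blast
  have "continuous_on (sphere 0 1) N"
    using norm_on_continuous[OF N] by (rule continuous_on_subset) simp
  moreover have "sphere (0 :: complex ^ 'm) 1 \<noteq> {}" by simp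
  ultimately obtain x0 where x0: "x0 \<in> sphere 0 1" "\<And>x. x \<in> sphere 0 1 \<Longrightarrow> N x0 \<le> N x"
    using continuous_attains_inf[of "sphere (0 :: complex ^ 'm) 1" N] by auto
  have a: "N x0 > 0" using x0(1) nonneg[of x0] pos[of x0] by (cases "N x0 = 0") auto
  have "N x0 * norm x \<le> N x" for x
  proof (cases "x = 0")
    case False
    then have "N x0 \<le> N (of_real (inverse (norm x)) *s x)"
      by (intro x0) (simp add: norm_vector_scale norm_inverse)
    also have "\<dots> = inverse (norm x) * N x" by (simp only: scale norm_of_real) simp
    finally show ?thesis using False by (simp add: field_simps)
  qed (simp add: N0)
  with a b up show thesis by (intro that[of "N x0" b])
qed

section \<open>Spectrum of the shadow at a fully attractive direction\<close>

text \<open>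
  Complex differentiability, with a derivative that is explicitly complex linear, so that the derivative
  of a map can be written as a complex matrix.
\<close>

definition complex_gradient_at :: "(complex ^ 'm \<Rightarrow> complex) \<Rightarrow> complex ^ 'm \<Rightarrow> complex ^ 'm \<Rightarrow> bool"
  where "complex_gradient_at f u d \<longleftrightarrow> (f has_derivative (\<lambda>w. \<Sum>h\<in>UNIV. d $ h * w $ h)) (at u)"

lemma complex_gradient_const: "complex_gradient_at (\<lambda>_. c) u 0"
  by (simp add: complex_gradient_at_def)

lemma has_derivative_coordinate: "((\<lambda>u :: complex ^ 'm. u $ t) has_derivative (\<lambda>w. w $ t)) F"
  by (rule bounded_linear_imp_has_derivative[OF bounded_linear_vec_nth])

lemma complex_gradient_nth: "complex_gradient_at (\<lambda>u :: complex ^ 'm. u $ t) u (axis t 1)"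
proof -
  have "(\<lambda>w :: complex ^ 'm. \<Sum>h\<in>UNIV. axis t 1 $ h * w $ h) = (\<lambda>w. w $ t)"
    by (auto simp: axis_def fun_eq_iff if_distrib[of "\<lambda>x. x * _"] cong: if_cong)
  then show ?thesis by (simp add: complex_gradient_at_def has_derivative_coordinate)
qed

lemma complex_gradient_mult:
  assumes "complex_gradient_at f u d" "complex_gradient_at g u e"
  shows "complex_gradient_at (\<lambda>x. f x * g x) u (f u *s e + g u *s d)"
proof -
  have "((\<lambda>x. f x * g x) has_derivative
      (\<lambda>w. f u * (\<Sum>h\<in>UNIV. e $ h * w $ h) + (\<Sum>h\<in>UNIV. d $ h * w $ h) * g u)) (at u)"
    using assms unfolding complex_gradient_at_def by (rule has_derivative_mult)
  moreover have "(\<lambda>w. f u * (\<Sum>h\<in>UNIV. e $ h * w $ h) + (\<Sum>h\<in>UNIV. d $ h * w $ h) * g u)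
      = (\<lambda>w. \<Sum>h\<in>UNIV. (f u *s e + g u *s d) $ h * w $ h)"
    by (simp add: fun_eq_iff sum_distrib_left sum_distrib_right sum.distrib[symmetric] algebra_simps)
  ultimately show ?thesis by (simp only: complex_gradient_at_def)
qed

lemma complex_gradient_sum:
  assumes "\<And>i. i \<in> I \<Longrightarrow> complex_gradient_at (f i) u (d i)"
  shows "complex_gradient_at (\<lambda>x. \<Sum>i\<in>I. f i x) u (\<Sum>i\<in>I. d i)"
proof -
  have "((\<lambda>x. \<Sum>i\<in>I. f i x) has_derivative (\<lambda>w. \<Sum>i\<in>I. \<Sum>h\<in>UNIV. d i $ h * w $ h)) (at u)"
    using assms unfolding complex_gradient_at_def by (rule has_derivative_sum)
  moreover have "(\<lambda>w. \<Sum>i\<in>I. \<Sum>h\<in>UNIV. d i $ h * w $ h)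
      = (\<lambda>w. \<Sum>h\<in>UNIV. (\<Sum>i\<in>I. d i) $ h * w $ h)"
    by (subst sum.swap) (simp add: fun_eq_iff sum_distrib_right)
  ultimately show ?thesis by (simp only: complex_gradient_at_def)
qed

lemma complex_gradient_power:
  assumes "complex_gradient_at f u d"
  shows "\<exists>d. complex_gradient_at (\<lambda>x. f x ^ p) u d"
proof (induction p)
  case 0
  show ?case using complex_gradient_const[of 1 u] by auto
next
  case (Suc p)
  then show ?case using complex_gradient_mult[OF assms] by force
qed

lemma complex_gradient_prod:
  assumes "\<And>i. i \<in> I \<Longrightarrow> \<exists>d. complex_gradient_at (f i) u d"
  shows "\<exists>d. complex_gradient_at (\<lambda>x. \<Prod>i\<in>I. f i x) u d"
  using assms
proof (induction I rule: infinite_finite_induct)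
  case (insert i I)
  then obtain d e where "complex_gradient_at (f i) u d"
    "complex_gradient_at (\<lambda>x. \<Prod>i\<in>I. f i x) u e" by blast
  from complex_gradient_mult[OF this] insert.hyps show ?case by auto
qed (auto intro: complex_gradient_const)

lemma complex_gradient_mpow: "\<exists>d. complex_gradient_at (\<lambda>u. mpow u K) u d"
  unfolding mpow_def by (intro complex_gradient_prod complex_gradient_power[OF complex_gradient_nth])

lemma has_derivative_matrix_of_gradients:
  fixes f :: "complex ^ 'm \<Rightarrow> complex ^ 'k"
  assumes "\<And>t. \<exists>d. complex_gradient_at (\<lambda>u. f u $ t) u d"
  obtains M where "(f has_derivative (\<lambda>w. M *v w)) (at u)"
    "\<And>t. complex_gradient_at (\<lambda>u. f u $ t) u (M $ t)"
proof -
  obtain d where d: "\<And>t. complex_gradient_at (\<lambda>u. f u $ t) u (d t)"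
    using assms by metis
  define M where "M = (\<chi> t. d t)"
  have "((\<lambda>u. f u $ t) has_derivative (\<lambda>w. (M *v w) $ t)) (at u)" for t
    using d[of t] by (simp add: complex_gradient_at_def M_def matrix_vector_mult_def)
  then have "(f has_derivative (\<lambda>w. M *v w)) (at u)"
    by (subst has_derivative_componentwise_within[of f])
       (auto simp: Basis_vec_def inner_axis intro!: has_derivative_inner_left)
  with d show thesis by (intro that) (auto simp: M_def)
qed

text \<open>
  Euler's identity: differentiate \<open>H (x v) = x\<^bsup>k+1\<^esup> H v\<close> at \<open>x = 1\<close>.
\<close>

lemma homogeneous_Euler:
  fixes H :: "complex ^ 'm \<Rightarrow> complex ^ 'm"
  assumes hom: "\<And>c u. H (c *s u) = c ^ Suc k *s H u"
    and der: "(H has_derivative (\<lambda>w. M *v w)) (at v)"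
  shows "M *v v = of_nat (Suc k) *s H v"
proof -
  let ?g = "\<lambda>x :: real. complex_of_real x *s v"
  have g: "(?g has_derivative (\<lambda>h. of_real h *s v)) (at 1)"
    by (intro bounded_linear_imp_has_derivative
        bounded_linear_compose[OF bounded_bilinear.bounded_linear_left[OF bounded_bilinear_vector_scale] bounded_linear_of_real])
  have "(H has_derivative (\<lambda>w. M *v w)) (at (?g 1))" using der by simp
  from has_derivative_compose[OF g this]
  have 1: "((\<lambda>x. H (?g x)) has_derivative (\<lambda>h. M *v (of_real h *s v))) (at 1)" .
  have "((\<lambda>x :: real. complex_of_real (x ^ Suc k)) has_derivative (\<lambda>h. of_real (of_nat (Suc k) * h))) (at 1)"
    by (auto intro!: derivative_eq_intros simp: fun_eq_iff algebra_simps)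
  from bounded_linear.has_derivative[OF bounded_bilinear.bounded_linear_left[OF bounded_bilinear_vector_scale] this]
  have 2: "((\<lambda>x. H (?g x)) has_derivative (\<lambda>h. complex_of_real (of_nat (Suc k) * h) *s H v)) (at 1)"
    by (simp add: hom)
  from fun_cong[OF has_derivative_unique[OF 1 2], of 1] show ?thesis by simp
qed

text \<open>
  In the chart \<open>u\<^sub>t = 1\<close> the differential of the induced map at \<open>[v]\<close> is \<open>dH(v) / \<tau>\<close> modulo \<open>v\<close>. So an
  eigenvalue \<open>\<mu>\<close> of \<open>dH(v)\<close> either belongs to \<open>v\<close>, with \<open>\<mu> = (k + 1) \<tau>\<close> by Euler's identity, or gives the
  director \<open>(\<mu> / \<tau> - 1) / k\<close>.
\<close>

lemma eigenvalues_of_fully_attractive_direction: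
  fixes H :: "complex ^ 'm \<Rightarrow> complex ^ 'm"
  assumes k: "k \<ge> 1" and hom: "\<And>c u. H (c *s u) = c ^ Suc k *s H u"
    and der: "(H has_derivative (\<lambda>w. M *v w)) (at v)"
    and v: "v \<noteq> 0" "H v = \<tau> *s v" "\<tau> \<noteq> 0" and attr: "fully_attractive k H v"
    and w0: "w0 \<noteq> 0" "M *v w0 = \<mu> *s w0"
  shows "Re (\<mu> / \<tau>) > 1"
proof -
  obtain t where t: "v $ t \<noteq> 0" using v(1) by (auto simp: vec_eq_iff)
  define p where "p = (1 / v $ t) *s v"
  have pt: "p $ t = 1" using t by (simp add: p_def)
  have vp: "v = v $ t *s p" using t by (simp add: p_def)
  have Mv: "M *v v = (of_nat (Suc k) * \<tau>) *s v"
    using homogeneous_Euler[OF hom der] v by simp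
  have Mp: "M *v p = (of_nat (Suc k) * \<tau>) *s p"
    unfolding p_def by (simp only: vector_scalar_commute Mv vec.scale_scale mult.commute)
  define \<kappa> where "\<kappa> = \<tau> * (1 / v $ t) ^ k"
  have \<kappa>: "\<kappa> \<noteq> 0" using v t by (simp add: \<kappa>_def)
  have Hp: "H p = \<kappa> *s p"
    unfolding p_def hom v(2) by (simp add: \<kappa>_def p_def algebra_simps)
  have "((\<lambda>u. v $ t *s u) has_derivative (\<lambda>w. v $ t *s w)) (at p)"
    by (intro bounded_linear_imp_has_derivative
        bounded_bilinear.bounded_linear_right[OF bounded_bilinear_vector_scale])
  moreover have "(H has_derivative (\<lambda>w. M *v w)) (at (v $ t *s p))" using der vp by simp
  ultimately have "((\<lambda>u. H (v $ t *s u)) has_derivative (\<lambda>w. M *v (v $ t *s w))) (at p)"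
    by (rule has_derivative_compose)
  from bounded_linear.has_derivative[OF
      bounded_bilinear.bounded_linear_right[OF bounded_bilinear_vector_scale] this,
      of "(1 / v $ t) ^ Suc k"]
  have "((\<lambda>u. (1 / v $ t) ^ Suc k *s H (v $ t *s u)) has_derivative
      (\<lambda>w. (1 / v $ t) ^ Suc k *s (M *v (v $ t *s w)))) (at p)" .
  moreover have "(1 / v $ t) ^ Suc k *s H (v $ t *s u) = H u" for u
    using t by (simp add: hom power_divide)
  moreover have "(1 / v $ t) ^ Suc k *s (M *v (v $ t *s w)) = (\<kappa> / \<tau>) *s (M *v w)" for w
    using t v by (simp add: vector_scalar_commute \<kappa>_def)
  ultimately have derp: "(H has_derivative (\<lambda>w. (\<kappa> / \<tau>) *s (M *v w))) (at p)" by simp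
  \<comment> \<open>The differential of the induced map at \<open>p\<close>, by the quotient rule.\<close>
  define D where "D = (\<lambda>w. (1 / \<tau>) *s (M *v w) - ((M *v w) $ t / \<tau>) *s p)"
  have Hpt: "H p $ t = \<kappa>" by (simp add: Hp pt)
  have "((\<lambda>u. H u $ t) has_derivative (\<lambda>w. (\<kappa> / \<tau>) * (M *v w) $ t)) (at p)"
    using bounded_linear.has_derivative[OF bounded_linear_vec_nth derp, of t] by simp
  from has_derivative_divide[OF has_derivative_const[of 1] this]
  have "((\<lambda>u. 1 / H u $ t) has_derivative (\<lambda>w. - ((M *v w) $ t / (\<kappa> * \<tau>)))) (at p)"
    using \<kappa> by (simp add: Hpt field_simps)
  from bounded_bilinear.FDERIV[OF bounded_bilinear_vector_scale this derp]
  have "(induced_in_chart H t has_derivative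
      (\<lambda>w. (1 / \<kappa>) *s ((\<kappa> / \<tau>) *s (M *v w)) + (- ((M *v w) $ t / (\<kappa> * \<tau>))) *s (\<kappa> *s p))) (at p)"
    using \<kappa> pt by (simp add: induced_in_chart_def[abs_def] Hpt Hp)
  moreover have "(1 / \<kappa>) *s ((\<kappa> / \<tau>) *s (M *v w)) + (- ((M *v w) $ t / (\<kappa> * \<tau>))) *s (\<kappa> *s p) = D w" for w
    using \<kappa> by (simp add: D_def vec_eq_iff field_simps)
  ultimately have "(induced_in_chart H t has_derivative D) (at p)" by simp
  then have fd: "frechet_derivative (induced_in_chart H t) (at p) = D"
    by (rule frechet_derivative_at[symmetric])
  \<comment> \<open>Representative of the eigenvector modulo \<open>v\<close> in the tangent space of the chart.\<close>
  define w where "w = w0 - w0 $ t *s p"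
  have wt: "w $ t = 0" by (simp add: w_def pt)
  show ?thesis
  proof (cases "w = 0")
    case True
    then have w0p: "w0 = w0 $ t *s p" by (simp add: w_def)
    have "\<mu> *s w0 = (of_nat (Suc k) * \<tau>) *s w0"
    proof -
      have "\<mu> *s w0 = M *v (w0 $ t *s p)" using w0 w0p by simp
      also have "\<dots> = (of_nat (Suc k) * \<tau>) *s (w0 $ t *s p)"
        by (simp only: vector_scalar_commute Mp vec.scale_scale mult.commute)
      finally show ?thesis using w0p by simp
    qed
    then have "\<mu> = of_nat (Suc k) * \<tau>" using w0(1) by (metis vec.scale_right_imp_eq)
    then have "\<mu> / \<tau> = of_nat (Suc k)" using v by simp
    then show ?thesis using k by simp
  next
    case False
    have Mw: "M *v w = \<mu> *s w0 - (w0 $ t * (of_nat (Suc k) * \<tau>)) *s p"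
      unfolding w_def by (simp only: matrix_vector_mult_diff_distrib vector_scalar_commute Mp w0 vec.scale_scale)
    have Dw: "D w = (\<mu> / \<tau>) *s w"
      using v(3) pt unfolding D_def Mw by (simp add: w_def vec_eq_iff field_simps)
    define \<delta> where "\<delta> = (1 / of_nat k) * (\<mu> / \<tau> - 1)"
    have "(1 / of_nat k) *s (D w - w) = \<delta> *s w"
      unfolding Dw \<delta>_def by (simp add: vec_eq_iff algebra_simps)
    then have "\<delta> \<in> directors k H v"
      using t False wt fd unfolding directors_def p_def by blast
    then have "Re \<delta> > 0" using attr by (auto simp: fully_attractive_def)
    moreover have "Re \<delta> = (Re (\<mu> / \<tau>) - 1) / real k"
    proof -
      have "\<delta> = (\<mu> / \<tau> - 1) / of_real (real k)" by (simp add: \<delta>_def)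
      then show ?thesis by (simp only: Re_divide_of_real minus_complex.sel one_complex.sel)
    qed
    ultimately show ?thesis using k by (simp add: zero_less_divide_iff)
  qed
qed

text \<open>
  Since \<open>v\<^sub>t = 0\<close>, the \<open>t\<close>-th row of \<open>dH(v)\<close> is \<open>\<sigma>(v)\<close> times the \<open>t\<close>-th coordinate. This is a left eigenvector;
  \<open>dH(v) - \<sigma>(v)\<close> is therefore not surjective, hence not injective.
\<close>

lemma zero_coordinate_multiplier:
  fixes H :: "complex ^ 'm \<Rightarrow> complex ^ 'm"
  assumes M: "(H has_derivative (\<lambda>w. M *v w)) (at v)"
    and H: "\<And>u. H u $ t = u $ t * \<sigma> u" and \<sigma>: "complex_gradient_at \<sigma> v d" and vt: "v $ t = 0"
  obtains w where "w \<noteq> 0" "M *v w = \<sigma> v *s w"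
proof (rule ccontr)
  assume neg: "\<not> thesis"
  have row: "(M *v w) $ t = \<sigma> v * w $ t" for w
  proof -
    have 1: "((\<lambda>u. H u $ t) has_derivative (\<lambda>w. (M *v w) $ t)) (at v)"
      by (rule bounded_linear.has_derivative[OF bounded_linear_vec_nth M])
    have 2: "((\<lambda>u. H u $ t) has_derivative (\<lambda>w. w $ t * \<sigma> v)) (at v)"
      using has_derivative_mult[OF has_derivative_coordinate \<sigma>[unfolded complex_gradient_at_def], of t] vt
      by (simp add: H)
    from fun_cong[OF has_derivative_unique[OF 1 2], of w] show ?thesis by simp
  qed
  let ?f = "\<lambda>x. M *v x - \<sigma> v *s x"
  have lin: "Vector_Spaces.linear (*s) (*s) ?f"
    by unfold_locales
       (simp_all add: matrix_vector_right_distrib vec.scale_right_distrib vec.scale_right_diff_distrib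
          vector_scalar_commute vec.scale_left_commute)
  have "x = 0" if "?f x = 0" for x
    using neg that that[symmetric] \<open>\<And>w. w \<noteq> 0 \<Longrightarrow> M *v w = \<sigma> v *s w \<Longrightarrow> thesis\<close> by fastforce
  then have "inj ?f" using lin by (subst vec.linear_inj_iff_eq_0) auto
  then have "surj ?f" using lin by (intro vec.linear_injective_imp_surjective) auto
  then obtain x where "axis t 1 = ?f x" by (rule surjE)
  then have "?f x $ t = 1" by (metis axis_nth)
  then show False by (simp add: row)
qed

text \<open>
  The directors are read off at the normalized point of the chart, so they depend only on the class of the
  direction in projective space.
\<close>

lemma fully_attractive_scale:
  assumes "c \<noteq> 0"
  shows "fully_attractive k H (c *s v) \<longleftrightarrow> fully_attractive k H v"
proof -
  have "(1 / (c *s v) $ t) *s (c *s v) = (1 / v $ t) *s v" for t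
    using assms by (simp add: vec_eq_iff)
  then have "directors k H (c *s v) = directors k H v"
    using assms by (simp add: directors_def)
  then show ?thesis by (simp add: fully_attractive_def)
qed

section \<open>First-order asymptotics along a filter\<close>

text \<open>
  Uniform continuity on a ball that contains both functions eventually.
\<close>

lemma tendsto_uniform_diff:
  fixes Y Y' :: "'x \<Rightarrow> 'a::euclidean_space" and h :: "'a \<Rightarrow> 'b::real_normed_vector"
  assumes "((\<lambda>x. Y' x - Y x) \<longlongrightarrow> 0) F" "eventually (\<lambda>x. norm (Y x) \<le> C) F" "continuous_on UNIV h"
  shows "((\<lambda>x. h (Y' x) - h (Y x)) \<longlongrightarrow> 0) F"
proof (rule tendstoI)
  fix \<epsilon> :: real assume "\<epsilon> > 0"
  have "uniformly_continuous_on (cball 0 (C + 1)) h"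
    by (rule compact_uniformly_continuous[OF continuous_on_subset[OF assms(3)]]) auto
  then obtain d where d: "d > 0" "\<And>x x'. x \<in> cball 0 (C + 1) \<Longrightarrow> x' \<in> cball 0 (C + 1) \<Longrightarrow>
      dist x' x < d \<Longrightarrow> dist (h x') (h x) < \<epsilon>"
    using \<open>\<epsilon> > 0\<close> unfolding uniformly_continuous_on_def by metis
  have "eventually (\<lambda>x. dist (Y' x - Y x) 0 < min d 1) F"
    using d(1) by (intro tendstoD[OF assms(1)]) auto
  with assms(2) show "eventually (\<lambda>x. dist (h (Y' x) - h (Y x)) 0 < \<epsilon>) F"
  proof eventually_elim
    case (elim x)
    have "norm (Y' x) \<le> norm (Y x) + norm (Y' x - Y x)" by (rule norm_triangle_sub)
    with elim have "Y' x \<in> cball 0 (C + 1)" "Y x \<in> cball 0 (C + 1)" "dist (Y' x) (Y x) < d"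
      by (auto simp: dist_norm)
    then have "dist (h (Y' x)) (h (Y x)) < \<epsilon>" by (intro d)
    then show ?case by (simp add: dist_norm)
  qed
qed

lemma bounded_continuous_image:
  fixes Y :: "'x \<Rightarrow> 'a::euclidean_space" and h :: "'a \<Rightarrow> 'b::real_normed_vector"
  assumes "Bfun Y F" "continuous_on UNIV h"
  shows "Bfun (\<lambda>x. h (Y x)) F"
proof -
  obtain C where C: "eventually (\<lambda>x. norm (Y x) \<le> C) F" using assms(1) by (rule BfunE)
  have "bounded (h ` cball 0 C)"
    by (intro compact_imp_bounded compact_continuous_image continuous_on_subset[OF assms(2)]) auto
  then obtain K where K: "\<forall>y\<in>cball 0 C. norm (h y) \<le> K" by (auto simp: bounded_iff)
  show ?thesis by (rule BfunI[of _ K]) (use C in eventually_elim, use K in auto)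
qed

lemma tendsto_0_mult_Bfun:
  fixes f g :: "'x \<Rightarrow> 'b::real_normed_algebra"
  assumes "(f \<longlongrightarrow> 0) F" "Bfun g F"
  shows "((\<lambda>x. f x * g x) \<longlongrightarrow> 0) F" "((\<lambda>x. g x * f x) \<longlongrightarrow> 0) F"
  using bounded_bilinear.Zfun_prod_Bfun[OF bounded_bilinear_mult, of f F g]
    bounded_bilinear.Bfun_prod_Zfun[OF bounded_bilinear_mult, of g F f] assms
  by (simp_all add: tendsto_Zfun_iff)

lemma tendsto_Bfun: "(f \<longlongrightarrow> (l :: 'b::real_normed_vector)) F \<Longrightarrow> Bfun f F"
proof (rule BfunI)
  assume "(f \<longlongrightarrow> l) F"
  then have "eventually (\<lambda>x. dist (f x) l < 1) F" by (rule tendstoD) simp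
  then show "eventually (\<lambda>x. norm (f x) \<le> norm l + 1) F"
  proof eventually_elim
    case (elim x)
    with norm_triangle_sub[of "f x" l] show ?case by (simp add: dist_norm)
  qed
qed

lemma Bfun_add:
  assumes "Bfun f F" "Bfun (g :: 'x \<Rightarrow> 'b::real_normed_vector) F"
  shows "Bfun (\<lambda>x. f x + g x) F"
proof -
  obtain A where A: "eventually (\<lambda>x. norm (f x) \<le> A) F" using assms(1) by (rule BfunE)
  obtain B where B: "eventually (\<lambda>x. norm (g x) \<le> B) F" using assms(2) by (rule BfunE)
  show ?thesis
    by (rule BfunI[of _ "A + B"]) (use A B in eventually_elim, metis add_mono norm_triangle_le)
qed

text \<open>\<open>f = 1 + \<alpha>/T + o(1/T)\<close> with bounded \<open>\<alpha>\<close>.\<close>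

definition first_order :: "('x \<Rightarrow> real) \<Rightarrow> 'x filter \<Rightarrow> ('x \<Rightarrow> 'b::real_normed_field) \<Rightarrow> ('x \<Rightarrow> 'b) \<Rightarrow> bool"
  where "first_order T F f \<alpha> \<longleftrightarrow> ((\<lambda>x. of_real (T x) * (f x - 1) - \<alpha> x) \<longlongrightarrow> 0) F \<and> Bfun \<alpha> F"

lemma tendsto_inverse_scale:
  fixes f :: "'x \<Rightarrow> 'b::real_normed_field"
  assumes T: "filterlim T at_top F" and "Bfun (\<lambda>x. of_real (T x) * f x) F"
  shows "(f \<longlongrightarrow> 0) F"
proof -
  have "((\<lambda>x. inverse (T x)) \<longlongrightarrow> 0) F" using T by (rule tendsto_inverse_0_at_top)
  then have "((\<lambda>x. of_real (inverse (T x)) :: 'b) \<longlongrightarrow> of_real 0) F" by (rule tendsto_of_real)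
  then have "((\<lambda>x. of_real (inverse (T x)) * (of_real (T x) * f x)) \<longlongrightarrow> 0) F"
    using assms(2) by (intro tendsto_0_mult_Bfun) auto
  moreover have "eventually (\<lambda>x. T x > 0) F" using T by (auto simp: filterlim_at_top_dense)
  then have "eventually (\<lambda>x. of_real (inverse (T x)) * (of_real (T x) * f x) = f x) F"
    by eventually_elim simp
  ultimately show ?thesis by (rule Lim_transform_eventually)
qed

lemma first_order_bounded:
  assumes "first_order T F f \<alpha>"
  shows "Bfun (\<lambda>x. of_real (T x) * (f x - 1)) F"
  using Bfun_add[OF tendsto_Bfun, of "\<lambda>x. of_real (T x) * (f x - 1) - \<alpha> x" 0 F \<alpha>] assms
  by (simp add: first_order_def)

lemma first_order_tendsto:
  assumes "filterlim T at_top F" "first_order T F f \<alpha>"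
  shows "(f \<longlongrightarrow> 1) F"
  using tendsto_inverse_scale[OF assms(1) first_order_bounded[OF assms(2)]]
  by (simp add: LIM_zero_iff)

lemma first_order_1: "first_order T F (\<lambda>_. 1) (\<lambda>_. 0)"
  by (simp add: first_order_def)

lemma first_order_mult:
  assumes T: "filterlim T at_top F" and f: "first_order T F f \<alpha>" and g: "first_order T F g \<beta>"
  shows "first_order T F (\<lambda>x. f x * g x) (\<lambda>x. \<alpha> x + \<beta> x)"
  unfolding first_order_def
proof
  show "Bfun (\<lambda>x. \<alpha> x + \<beta> x) F" using f g by (auto simp: first_order_def intro: Bfun_add)
  have "((\<lambda>x. g x - 1) \<longlongrightarrow> 0) F" using first_order_tendsto[OF T g] by (simp add: LIM_zero_iff)
  then have "((\<lambda>x. (of_real (T x) * (f x - 1)) * (g x - 1)) \<longlongrightarrow> 0) F"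
    using first_order_bounded[OF f] by (intro tendsto_0_mult_Bfun)
  then have "((\<lambda>x. (of_real (T x) * (f x - 1) - \<alpha> x) + (of_real (T x) * (g x - 1) - \<beta> x)
      + (of_real (T x) * (f x - 1)) * (g x - 1)) \<longlongrightarrow> 0 + 0 + 0) F"
    using f g by (intro tendsto_add) (auto simp: first_order_def)
  then show "((\<lambda>x. of_real (T x) * (f x * g x - 1) - (\<alpha> x + \<beta> x)) \<longlongrightarrow> 0) F"
    by (simp add: algebra_simps)
qed

lemma first_order_power:
  assumes "filterlim T at_top F" "first_order T F f \<alpha>"
  shows "first_order T F (\<lambda>x. f x ^ p) (\<lambda>x. of_nat p * \<alpha> x)"
proof (induction p)
  case (Suc p)
  from first_order_mult[OF assms this] show ?case by (simp add: algebra_simps)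
qed (simp add: first_order_1)

lemma first_order_prod:
  assumes "filterlim T at_top F" "finite I" "\<And>i. i \<in> I \<Longrightarrow> first_order T F (f i) (\<alpha> i)"
  shows "first_order T F (\<lambda>x. \<Prod>i\<in>I. f i x) (\<lambda>x. \<Sum>i\<in>I. \<alpha> i x)"
  using assms(2,3)
proof (induction I rule: finite_induct)
  case (insert i I)
  then have "first_order T F (\<lambda>x. f i x * (\<Prod>i\<in>I. f i x)) (\<lambda>x. \<alpha> i x + (\<Sum>i\<in>I. \<alpha> i x))"
    by (intro first_order_mult assms(1)) auto
  with insert.hyps show ?case by simp
qed (simp add: first_order_1)

text \<open>
  The derivative of \<open>y\<^sup>b\<close> at \<open>1\<close>.
\<close>

lemma first_order_powr:
  assumes T: "filterlim T at_top F"
  shows "first_order T F (\<lambda>x. (1 + 1 / T x) powr b) (\<lambda>_. b)"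
proof -
  have "((\<lambda>y. y powr b) has_real_derivative b * 1 powr (b - 1)) (at 1)"
    by (rule has_real_derivative_powr) simp
  then have lim: "((\<lambda>h. ((1 + h) powr b - 1 powr b) / h) \<longlongrightarrow> b) (at 0)"
    by (simp add: DERIV_def)
  have "filterlim (\<lambda>x. 1 / T x) (at 0) F"
    unfolding filterlim_at
  proof
    have "eventually (\<lambda>x. T x > 0) F" using T by (auto simp: filterlim_at_top_dense)
    then show "eventually (\<lambda>x. 1 / T x \<in> UNIV \<and> 1 / T x \<noteq> 0) F" by eventually_elim auto
    show "((\<lambda>x. 1 / T x) \<longlongrightarrow> 0) F" using tendsto_inverse_0_at_top[OF T] by (simp add: inverse_eq_divide)
  qed
  from filterlim_compose[OF lim this]
  have "((\<lambda>x. T x * ((1 + 1 / T x) powr b - 1)) \<longlongrightarrow> b) F" by (simp add: mult.commute)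
  then show ?thesis by (simp add: first_order_def LIM_zero)
qed

section \<open>The truncated dynamics in rescaled monomials\<close>

definition gen_monomials :: "('m::finite \<Rightarrow> nat ^ 'n) \<Rightarrow> complex ^ 'n \<Rightarrow> complex ^ 'm"
  where "gen_monomials P w = (\<chi> t. mpow w (P t))"

text \<open>
  \<open>A j\<close> is the leading relative change of the \<open>j\<close>-th coordinate under one step of the germ, in its dependence
  on the resonant monomials.
\<close>

locale shadow_data =
  fixes lam :: "complex ^ 'n" and P :: "'m::finite \<Rightarrow> nat ^ 'n" and k :: nat
    and A :: "'n \<Rightarrow> complex ^ 'm \<Rightarrow> complex"
  assumes k: "k \<ge> 1"
    and norm_lam: "\<And>j. norm (lam $ j) = 1"
    and mpow_lam: "\<And>t. mpow lam (P t) = 1"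
    and P_nonzero: "\<And>t. P t \<noteq> 0"
    and A_gradient: "\<And>j u. \<exists>d. complex_gradient_at (A j) u d"
    and A_hom: "\<And>j c u. A j (c *s u) = c ^ k * A j u"
begin

lemma A_cont: "continuous_on UNIV (A j)"
proof -
  have "isCont (A j) u" for u
  proof -
    obtain d where "complex_gradient_at (A j) u d" using A_gradient by blast
    then show ?thesis by (auto simp: complex_gradient_at_def dest: has_derivative_continuous)
  qed
  then show ?thesis by (simp add: continuous_on_eq_continuous_at)
qed

definition monomial_multiplier :: "'m \<Rightarrow> complex ^ 'm \<Rightarrow> complex"
  where "monomial_multiplier t u = (\<Sum>j\<in>UNIV. of_nat (P t $ j) * A j u)"

text \<open>
  The shadow term: the leading part of \<open>u\<close>'s displacement, as each factor \<open>w\<^sub>j\<close> of \<open>w\<^bsup>P t\<^esup>\<close> contributes its own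
  relative change.
\<close>

definition H :: "complex ^ 'm \<Rightarrow> complex ^ 'm"
  where "H u = (\<chi> t. u $ t * monomial_multiplier t u)"

lemma H_cont: "continuous_on UNIV H"
  unfolding H_def monomial_multiplier_def by (intro continuous_intros A_cont)

lemma A_0: "A j 0 = 0"
  using A_hom[of j 0 0] k by (simp add: power_0_left)

lemma A_tendsto: "(f \<longlongrightarrow> u) F \<Longrightarrow> ((\<lambda>x. A j (f x)) \<longlongrightarrow> A j u) F"
  by (rule continuous_on_tendsto_compose[OF A_cont]) auto

lemma gen_monomials_tendsto_0: "(w \<longlongrightarrow> 0) F \<Longrightarrow> ((\<lambda>x. gen_monomials P (w x)) \<longlongrightarrow> 0) F"
proof (rule vec_tendstoI)
  fix t assume w: "(w \<longlongrightarrow> 0) F"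
  have "mpow 0 (P t) = 0" using P_nonzero[of t] by (auto simp: mpow_def vec_eq_iff)
  with tendsto_mpow[OF w, of "P t"]
  show "((\<lambda>x. gen_monomials P (w x) $ t) \<longlongrightarrow> 0 $ t) F" by (simp add: gen_monomials_def)
qed

text \<open>
  Here \<open>w\<close> is the image of \<open>w'\<close> under the germ up to a small error, so \<open>w'\<close> is the image of \<open>w\<close> under
  the inverse. The relation expresses \<open>w\<close> through \<open>w'\<close>, while bounds are known for \<open>w\<close> only. Therefore
  \<open>Y'\<close> is first shown to be bounded, then \<open>Y - Y'\<close> is expanded at \<open>Y'\<close>, and finally \<open>Y'\<close> is replaced
  by \<open>Y\<close> in the leading terms, which costs \<open>o(1)\<close> because \<open>Y - Y'\<close> tends to \<open>0\<close>.
\<close>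

lemma one_step_asymptotics:
  fixes T :: "'x \<Rightarrow> real" and w w' e :: "'x \<Rightarrow> complex ^ 'n"
  assumes g: "r > 0" "\<And>j u. norm u < r \<Longrightarrow> norm (g j u - A j u) \<le> C * norm u ^ Suc k"
    and T: "filterlim T at_top F" and w': "(w' \<longlongrightarrow> 0) F"
    and step: "eventually (\<lambda>x. \<forall>j. w x $ j = lam $ j * w' x $ j * (1 + g j (gen_monomials P (w' x))) + e x $ j) F"
    and e: "\<And>j. ((\<lambda>x. of_real (T x powr (1 + 1 / k)) * e x $ j) \<longlongrightarrow> 0) F"
    and Y: "Y = (\<lambda>x. of_real (T x powr (1 / k)) *s gen_monomials P (w x))" "Bfun Y F"
    and Y': "Y' = (\<lambda>x. of_real (T x powr (1 / k)) *s gen_monomials P (w' x))"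
  shows "((\<lambda>x. of_real (T x) *s (Y' x - Y x) + H (Y x)) \<longlongrightarrow> 0) F"
    and "\<And>j. ((\<lambda>x. of_real (T x) * g j (gen_monomials P (w' x)) - A j (Y x)) \<longlongrightarrow> 0) F"
proof -
  let ?u' = "\<lambda>x. gen_monomials P (w' x)"
  have T1: "eventually (\<lambda>x. T x \<ge> 1) F" using T by (auto simp: filterlim_at_top)
  have u': "(?u' \<longlongrightarrow> 0) F" by (rule gen_monomials_tendsto_0[OF w'])
  note r = g(1) and C = g(2)
  have small: "eventually (\<lambda>x. norm (?u' x) < r) F"
    using tendstoD[OF u' r] by simp
  have gA: "((\<lambda>x. g j (?u' x) - A j (?u' x)) \<longlongrightarrow> 0) F" for j
  proof (rule Lim_null_comparison)
    show "eventually (\<lambda>x. norm (g j (?u' x) - A j (?u' x)) \<le> C * norm (?u' x) ^ Suc k) F"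
      using small by eventually_elim (rule C)
    have "((\<lambda>x. C * norm (?u' x) ^ Suc k) \<longlongrightarrow> C * norm (0 :: complex ^ 'm) ^ Suc k) F"
      by (intro tendsto_intros u')
    then show "((\<lambda>x. C * norm (?u' x) ^ Suc k) \<longlongrightarrow> 0) F" by simp
  qed
  have g0: "((\<lambda>x. g j (?u' x)) \<longlongrightarrow> 0) F" for j
    using tendsto_add[OF gA[of j] A_tendsto[OF u', of j]] by (simp add: A_0)
  define f where "f j x = 1 + g j (?u' x)" for j x
  have f1: "((\<lambda>x. f j x) \<longlongrightarrow> 1) F" for j
    using tendsto_add[OF tendsto_const[of 1] g0[of j]] by (simp add: f_def)
  define X where "X x = (\<chi> j. lam $ j * w' x $ j * f j x)" for x
  have X0: "((\<lambda>x. X x $ j) \<longlongrightarrow> 0) F" for j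
    using tendsto_mult[OF tendsto_mult[OF tendsto_const[of "lam $ j"] tendsto_vec_nth[OF w', of j]] f1[of j]]
    by (simp add: X_def)
  have e': "((\<lambda>x. of_real (T x) * e x $ j) \<longlongrightarrow> 0) F" for j
  proof (rule Lim_null_comparison)
    show "((\<lambda>x. norm (of_real (T x powr (1 + 1 / k)) * e x $ j)) \<longlongrightarrow> 0) F"
      using e by (simp add: tendsto_norm_zero)
    show "eventually (\<lambda>x. norm (of_real (T x) * e x $ j) \<le> norm (of_real (T x powr (1 + 1 / k)) * e x $ j)) F"
      using T1
    proof eventually_elim
      case (elim x)
      have "T x powr 1 \<le> T x powr (1 + 1 / k)" using elim by (intro powr_mono) auto
      then show ?case using elim by (simp add: norm_mult mult_right_mono)
    qed
  qed
  have e0: "((\<lambda>x. e x $ j) \<longlongrightarrow> 0) F" for j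
    by (rule tendsto_inverse_scale[OF T tendsto_Bfun[OF e']])
  have wX: "eventually (\<lambda>x. \<forall>j. w x $ j = X x $ j + e x $ j) F"
    using step by eventually_elim (simp add: X_def f_def)
  define \<Phi> where "\<Phi> t x = (\<Prod>j\<in>UNIV. f j x ^ P t $ j)" for t x
  have mpowX: "mpow (X x) (P t) = ?u' x $ t * \<Phi> t x" for x t
    using mpow_lam[of t]
    by (simp add: X_def mpow_def gen_monomials_def \<Phi>_def power_mult_distrib prod.distrib)
  have \<Phi>1: "((\<lambda>x. \<Phi> t x) \<longlongrightarrow> 1) F" for t
  proof -
    have "((\<lambda>x. \<Phi> t x) \<longlongrightarrow> (\<Prod>j\<in>UNIV. 1 ^ P t $ j)) F"
      unfolding \<Phi>_def by (intro tendsto_intros f1)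
    then show ?thesis by simp
  qed
  define E where "E t x = gen_monomials P (w x) $ t - ?u' x $ t * \<Phi> t x" for t x
  have E: "((\<lambda>x. of_real (T x powr (1 + 1 / k)) * E t x) \<longlongrightarrow> 0) F" for t
  proof (rule Lim_null_comparison)
    have "((\<lambda>x. \<Sum>j\<in>UNIV. of_nat (P t $ j) * norm (of_real (T x powr (1 + 1 / k)) * e x $ j))
        \<longlongrightarrow> (\<Sum>j\<in>UNIV. of_nat (P t $ j) * 0)) F"
      using e by (intro tendsto_intros) (simp add: tendsto_norm_zero)
    then show "((\<lambda>x. \<Sum>j\<in>UNIV. of_nat (P t $ j) * norm (of_real (T x powr (1 + 1 / k)) * e x $ j))
        \<longlongrightarrow> 0) F" by simp
    have "eventually (\<lambda>x. \<forall>j\<in>UNIV. norm (X x $ j) < 1) F"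
      by (rule eventually_ball_finite) (use tendstoD[OF X0, of 1] in auto)
    moreover have "eventually (\<lambda>x. \<forall>j\<in>UNIV. norm (X x $ j + e x $ j) < 1) F"
      by (rule eventually_ball_finite) (use tendstoD[OF tendsto_add[OF X0 e0], of 1] in auto)
    ultimately show "eventually (\<lambda>x. norm (of_real (T x powr (1 + 1 / k)) * E t x)
        \<le> (\<Sum>j\<in>UNIV. of_nat (P t $ j) * norm (of_real (T x powr (1 + 1 / k)) * e x $ j))) F"
      using wX
    proof eventually_elim
      case (elim x)
      have "norm (E t x) = norm (mpow (w x) (P t) - mpow (X x) (P t))"
        by (simp add: E_def mpowX) (simp add: gen_monomials_def)
      also have "\<dots> \<le> (\<Sum>j\<in>UNIV. of_nat (P t $ j) * norm (w x $ j - X x $ j))"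
        using elim by (intro norm_mpow_diff_le) (auto intro: less_imp_le)
      also have "\<dots> = (\<Sum>j\<in>UNIV. of_nat (P t $ j) * norm (e x $ j))" using elim by simp
      finally have "T x powr (1 + 1 / k) * norm (E t x)
          \<le> T x powr (1 + 1 / k) * (\<Sum>j\<in>UNIV. of_nat (P t $ j) * norm (e x $ j))"
        by (intro mult_left_mono) auto
      then show ?case by (simp add: norm_mult sum_distrib_left algebra_simps)
    qed
  qed
  define G where "G t x = of_real (T x powr (1 / k)) * E t x" for t x
  have TG: "((\<lambda>x. of_real (T x) * G t x) \<longlongrightarrow> 0) F" for t
    by (rule Lim_transform_eventually[OF E[of t]])
       (use T1 in eventually_elim, simp add: G_def powr_add)
  have G0: "((\<lambda>x. G t x) \<longlongrightarrow> 0) F" for t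
    by (rule tendsto_inverse_scale[OF T tendsto_Bfun[OF TG]])
  have YY': "Y x $ t = Y' x $ t * \<Phi> t x + G t x" for x t
    by (simp add: Y Y' G_def E_def algebra_simps)
  have Y'b: "Bfun Y' F"
  proof -
    obtain K where K: "K > 0" "eventually (\<lambda>x. norm (Y x) \<le> K) F" using Y(2) by (rule BfunE)
    have "eventually (\<lambda>x. \<forall>t\<in>UNIV. norm (\<Phi> t x - 1) < 1 / 2) F"
      by (rule eventually_ball_finite) (use tendstoD[OF \<Phi>1, of "1/2"] in \<open>auto simp: dist_norm\<close>)
    moreover have "eventually (\<lambda>x. \<forall>t\<in>UNIV. norm (G t x) < 1) F"
      by (rule eventually_ball_finite) (use tendstoD[OF G0, of 1] in auto)
    ultimately have "eventually (\<lambda>x. norm (Y' x) \<le> (\<Sum>t\<in>(UNIV :: 'm set). 2 * (K + 1))) F"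
      using K(2)
    proof eventually_elim
      case (elim x)
      have "norm (Y' x $ t) \<le> 2 * (K + 1)" for t
      proof -
        have "norm (\<Phi> t x) \<ge> 1 / 2"
          using elim(1) norm_triangle_ineq2[of 1 "1 - \<Phi> t x"]
          by (auto simp: norm_minus_commute dest!: spec[of _ t])
        then have "norm (Y' x $ t) * (1 / 2) \<le> norm (Y' x $ t) * norm (\<Phi> t x)"
          by (intro mult_left_mono) auto
        also have "\<dots> = norm (Y x $ t - G t x)" using YY'[of x t] by (simp add: norm_mult[symmetric])
        also have "\<dots> \<le> norm (Y x $ t) + norm (G t x)" by (rule norm_triangle_ineq4)
        also have "\<dots> \<le> K + 1"
          using elim Finite_Cartesian_Product.norm_nth_le[of "Y x" t] by (intro add_mono) (auto intro: less_imp_le)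
        finally show ?thesis by simp
      qed
      then show ?case by (intro order_trans[OF norm_le_sum_nth sum_mono])
    qed
    then show ?thesis by (rule BfunI)
  qed
  have u'Y': "eventually (\<lambda>x. A j (Y' x) = of_real (T x) * A j (?u' x)) F" for j
    using T1
  proof eventually_elim
    case (elim x)
    then have "(T x powr (1 / k)) ^ k = T x" using k by (simp add: powr_realpow[symmetric] powr_powr)
    then have "complex_of_real (T x powr (1 / k)) ^ k = of_real (T x)" by (metis of_real_power)
    then show ?case by (simp add: Y' A_hom)
  qed
  have TgA': "((\<lambda>x. of_real (T x) * g j (?u' x) - A j (Y' x)) \<longlongrightarrow> 0) F" for j
  proof (rule Lim_null_comparison)
    show "eventually (\<lambda>x. norm (of_real (T x) * g j (?u' x) - A j (Y' x))
        \<le> (C * norm (?u' x)) * norm (Y' x) ^ k) F"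
      using u'Y'[of j] small T1
    proof eventually_elim
      case (elim x)
      have "norm (of_real (T x) * g j (?u' x) - A j (Y' x)) = T x * norm (g j (?u' x) - A j (?u' x))"
        using elim by (simp add: norm_mult right_diff_distrib[symmetric])
      also have "\<dots> \<le> T x * (C * norm (?u' x) ^ Suc k)"
        using elim by (intro mult_left_mono C) auto
      also have "\<dots> = (C * norm (?u' x)) * (T x * norm (?u' x) ^ k)" by simp
      also have "T x * norm (?u' x) ^ k = norm (Y' x) ^ k"
      proof -
        have "(T x powr (1 / k)) ^ k = T x" using k elim by (simp add: powr_realpow[symmetric] powr_powr)
        then show ?thesis by (simp add: Y' norm_vector_scale power_mult_distrib)
      qed
      finally show ?case .
    qed
    have "Bfun (\<lambda>x. norm (Y' x) ^ k) F"
      by (rule bounded_continuous_image[OF Y'b]) (intro continuous_intros)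
    moreover have "((\<lambda>x. C * norm (?u' x)) \<longlongrightarrow> 0) F"
      using tendsto_mult[OF tendsto_const[of C] tendsto_norm[OF u']] by simp
    ultimately show "((\<lambda>x. (C * norm (?u' x)) * norm (Y' x) ^ k) \<longlongrightarrow> 0) F"
      by (intro tendsto_0_mult_Bfun(1)[of "\<lambda>x. C * norm (?u' x)"])
  qed
  have "first_order T F (f j) (\<lambda>x. A j (Y' x))" for j
    unfolding first_order_def using TgA'[of j] bounded_continuous_image[OF Y'b A_cont]
    by (simp add: f_def)
  then have \<Phi>fo: "first_order T F (\<Phi> t) (\<lambda>x. monomial_multiplier t (Y' x))" for t
    unfolding \<Phi>_def monomial_multiplier_def by (intro first_order_prod first_order_power T) auto
  have "((\<lambda>x. (of_real (T x) *s (Y x - Y' x) - H (Y' x)) $ t) \<longlongrightarrow> 0) F" for t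
  proof -
    have "((\<lambda>x. Y' x $ t * (of_real (T x) * (\<Phi> t x - 1) - monomial_multiplier t (Y' x)) + of_real (T x) * G t x)
        \<longlongrightarrow> 0 + 0) F"
    proof (intro tendsto_add TG tendsto_0_mult_Bfun(2))
      show "Bfun (\<lambda>x. Y' x $ t) F"
        by (rule bounded_continuous_image[OF Y'b]) (intro continuous_intros)
    qed (use \<Phi>fo in \<open>simp add: first_order_def\<close>)
    then show ?thesis by (simp add: H_def YY' algebra_simps)
  qed
  then have TYH: "((\<lambda>x. of_real (T x) *s (Y x - Y' x) - H (Y' x)) \<longlongrightarrow> 0) F"
    by (intro vec_tendstoI) simp
  have HY'b: "Bfun (\<lambda>x. H (Y' x)) F" by (rule bounded_continuous_image[OF Y'b H_cont])
  have YYb: "Bfun (\<lambda>x. of_real (T x) *s (Y x - Y' x)) F"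
    using Bfun_add[OF tendsto_Bfun[OF TYH] HY'b] by simp
  have diff: "((\<lambda>x. Y x - Y' x) \<longlongrightarrow> 0) F"
  proof (rule vec_tendstoI)
    fix t
    have "Bfun (\<lambda>x. (of_real (T x) *s (Y x - Y' x)) $ t) F"
      by (rule bounded_continuous_image[OF YYb]) (intro continuous_intros)
    then show "((\<lambda>x. (Y x - Y' x) $ t) \<longlongrightarrow> 0 $ t) F"
      using tendsto_inverse_scale[OF T, of "\<lambda>x. (Y x - Y' x) $ t"] by (simp add: right_diff_distrib)
  qed
  obtain K' where K': "eventually (\<lambda>x. norm (Y' x) \<le> K') F" using Y'b by (rule BfunE)
  have HH: "((\<lambda>x. H (Y x) - H (Y' x)) \<longlongrightarrow> 0) F"
    by (rule tendsto_uniform_diff[OF diff K' H_cont])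
  show "((\<lambda>x. of_real (T x) *s (Y' x - Y x) + H (Y x)) \<longlongrightarrow> 0) F"
    using tendsto_diff[OF HH TYH] by (simp add: vec.scale_right_diff_distrib algebra_simps)
  show "((\<lambda>x. of_real (T x) * g j (?u' x) - A j (Y x)) \<longlongrightarrow> 0) F" for j
    using tendsto_diff[OF TgA'[of j] tendsto_uniform_diff[OF diff K' A_cont[of j]]] by simp
qed

text \<open>
  The target of the inverse iteration at time \<open>T\<close>. In the second condition \<open>u\<close> is compared with
  \<open>T\<^bsup>-1/k\<^esup> v\<close>, the approximate orbit of the inverse; the first one keeps the order \<open>l + 1\<close> error negligible.
\<close>

definition region :: "(complex ^ 'm \<Rightarrow> real) \<Rightarrow> complex ^ 'm \<Rightarrow> real \<Rightarrow> real \<Rightarrow> real \<Rightarrow> complex ^ 'n \<Rightarrow> bool"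
  where "region N v \<eta> b T w \<longleftrightarrow> (\<forall>j. norm (w $ j) < T powr (- b)) \<and>
    N (of_real (T powr (1 / k)) *s gen_monomials P w - v) < \<eta>"

text \<open>
  For the coordinates: one step divides \<open>|w\<^sub>j|\<close> by at least \<open>1 + 2b/T\<close>, whereas the bound \<open>T\<^bsup>-b\<^esup>\<close> shrinks only by
  a factor of about \<open>1 - b/T\<close>. For the monomials: \<open>Y - v\<close> performs an Euler step of length \<open>1/T\<close> for the field
  \<open>-(dH(v) - 1/k)\<close>, which brings it closer to \<open>0\<close> by a factor \<open>1 - c/T\<close>. The other terms together are smaller than
  \<open>c \<eta> / T\<close>.
\<close>

lemma region_step:
  fixes T :: "'x \<Rightarrow> real" and w w' e :: "'x \<Rightarrow> complex ^ 'n"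
  assumes g: "r > 0" "\<And>j u. norm u < r \<Longrightarrow> norm (g j u - A j u) \<le> C * norm u ^ Suc k"
    and N: "norm_on UNIV N"
    and contr: "c > 0" "s0 > 0" "\<And>s y. 0 \<le> s \<Longrightarrow> s \<le> s0 \<Longrightarrow>
      N (y - of_real s *s (M *v y - (1 / of_nat k) *s y)) \<le> (1 - c * s) * N y"
    and v: "H v = (1 / of_nat k) *s v"
    and \<eta>: "\<eta> > 0" "\<And>y. N y < \<eta> \<Longrightarrow> N (H (v + y) - H v - M *v y) \<le> c / 4 * \<eta>"
    and b: "b > 0" "\<And>j Y. N (Y - v) < \<eta> \<Longrightarrow> Re (A j Y) \<ge> 3 * b"
    and T: "filterlim T at_top F" and w': "(w' \<longlongrightarrow> 0) F"
    and step: "eventually (\<lambda>x. \<forall>j. w x $ j = lam $ j * w' x $ j * (1 + g j (gen_monomials P (w' x))) + e x $ j) F"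
    and e: "\<And>j. ((\<lambda>x. of_real (T x powr (1 + 1 / k)) * e x $ j) \<longlongrightarrow> 0) F"
      "\<And>j. ((\<lambda>x. of_real (T x powr (1 + b)) * e x $ j) \<longlongrightarrow> 0) F"
    and region: "eventually (\<lambda>x. region N v \<eta> b (T x) (w x)) F"
  shows "eventually (\<lambda>x. region N v \<eta> b (T x + 1) (w' x)) F"
proof -
  let ?u' = "\<lambda>x. gen_monomials P (w' x)"
  define Y where "Y = (\<lambda>x. of_real (T x powr (1 / k)) *s gen_monomials P (w x))"
  define Y' where "Y' = (\<lambda>x. of_real (T x powr (1 / k)) *s ?u' x)"
  obtain l1 l2 where l: "l1 > 0" "l2 > 0" "\<And>x. l1 * norm x \<le> N x" "\<And>x. N x \<le> l2 * norm x"
    by (rule norm_on_UNIV_equivalent[OF N]) blast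
  have tri: "N (x + y) \<le> N x + N y" and scale: "N (a *s x) = norm a * N x" for x y a
    using N by (auto simp: norm_on_def)
  have T1: "eventually (\<lambda>x. T x \<ge> 1) F" using T by (auto simp: filterlim_at_top)
  have NY: "eventually (\<lambda>x. N (Y x - v) < \<eta>) F"
    using region by eventually_elim (simp add: region_def Y_def)
  have Yb: "Bfun Y F"
  proof (rule BfunI)
    show "eventually (\<lambda>x. norm (Y x) \<le> norm v + \<eta> / l1) F"
      using NY
    proof eventually_elim
      case (elim x)
      have "l1 * norm (Y x - v) \<le> \<eta>" using l(3)[of "Y x - v"] elim by linarith
      then have "norm (Y x - v) \<le> \<eta> / l1" using l(1) by (simp add: field_simps)
      with norm_triangle_sub[of "Y x" v] show ?case by linarith
    qed
  qed
  note asy = one_step_asymptotics[OF g T w' step e(1) Y_def Yb Y'_def]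
  have w_part: "eventually (\<lambda>x. norm (w' x $ j) < (T x + 1) powr (- b)) F" for j
  proof -
    let ?f = "\<lambda>x. (1 + 1 / T x) powr b * (1 + T x powr b * norm (e x $ j))"
    have "first_order T F (\<lambda>x. 1 + T x powr b * norm (e x $ j)) (\<lambda>_. 0)"
      unfolding first_order_def
    proof
      have "((\<lambda>x. norm (of_real (T x powr (1 + b)) * e x $ j)) \<longlongrightarrow> 0) F"
        using e(2) by (rule tendsto_norm_zero)
      moreover have "eventually (\<lambda>x. norm (of_real (T x powr (1 + b)) * e x $ j)
          = of_real (T x) * (1 + T x powr b * norm (e x $ j) - 1) - 0) F"
        using T1 by eventually_elim (simp add: norm_mult powr_add)
      ultimately show "((\<lambda>x. of_real (T x) * (1 + T x powr b * norm (e x $ j) - 1) - 0) \<longlongrightarrow> 0) F"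
        by (rule Lim_transform_eventually)
    qed simp
    from first_order_mult[OF T first_order_powr[OF T, of b] this]
    have "((\<lambda>x. T x * (?f x - 1) - b) \<longlongrightarrow> 0) F" by (simp add: first_order_def)
    from tendstoD[OF this b(1)] have "eventually (\<lambda>x. T x * (?f x - 1) < 2 * b) F"
      by eventually_elim (auto simp: dist_real_def)
    moreover have "eventually (\<lambda>x. norm (of_real (T x) * g j (?u' x) - A j (Y x)) < b / 2) F"
      using tendstoD[OF asy(2)[of j], of "b / 2"] b(1) by simp
    ultimately show ?thesis
      using T1 NY region step
    proof eventually_elim
      case (elim x)
      define q where "q = 1 + 2 * b / T x"
      have T0: "T x > 0" using elim by simp
      have q: "q > 0" using b T0 by (simp add: q_def add_pos_pos)
      have fq: "?f x < q" using elim(1) T0 by (simp add: q_def field_simps)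
      have "3 * b \<le> Re (A j (Y x))" using b(2) elim by blast
      moreover have "\<bar>T x * Re (g j (?u' x)) - Re (A j (Y x))\<bar> < b / 2"
        using elim(2) abs_Re_le_cmod[of "of_real (T x) * g j (?u' x) - A j (Y x)"] by simp
      ultimately have "2 * b < T x * Re (g j (?u' x))" using b(1) by linarith
      then have "q \<le> Re (1 + g j (?u' x))" using T0 by (simp add: q_def field_simps)
      also have "\<dots> \<le> norm (1 + g j (?u' x))" by (rule complex_Re_le_cmod)
      finally have "norm (w' x $ j) * q \<le> norm (w' x $ j) * norm (1 + g j (?u' x))"
        by (intro mult_left_mono) auto
      also have "\<dots> = norm (w x $ j - e x $ j)"
      proof -
        have "w x $ j - e x $ j = lam $ j * w' x $ j * (1 + g j (?u' x))" using elim by simp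
        then show ?thesis by (simp add: norm_mult norm_lam)
      qed
      also have "\<dots> \<le> norm (w x $ j) + norm (e x $ j)" by (rule norm_triangle_ineq4)
      also have "\<dots> \<le> T x powr (- b) + norm (e x $ j)"
        using elim by (simp add: region_def less_imp_le)
      also have "\<dots> = T x powr (- b) * (1 + T x powr b * norm (e x $ j))"
        using T0 by (simp add: powr_minus field_simps)
      also have "\<dots> = (T x + 1) powr (- b) * ?f x"
      proof -
        have "T x + 1 = T x * (1 + 1 / T x)" using T0 by (simp add: field_simps)
        then have "(T x + 1) powr (- b) = T x powr (- b) * (1 + 1 / T x) powr (- b)"
          using T0 by (simp add: powr_mult)
        moreover have "1 + 1 / T x \<noteq> 0" using T0 by (simp add: add_nonneg_eq_0_iff)
        then have "(1 + 1 / T x) powr (- b) * (1 + 1 / T x) powr b = 1"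
          by (simp add: powr_add[symmetric])
        ultimately show ?thesis by (simp add: mult.assoc[symmetric])
      qed
      also have "\<dots> < (T x + 1) powr (- b) * q" using fq T0 by (intro mult_strict_left_mono) auto
      finally show ?case using q by simp
    qed
  qed
  define Y2 where "Y2 = (\<lambda>x. of_real ((T x + 1) powr (1 / k)) *s ?u' x)"
  \<comment> \<open>The rescaling at the next time is by \<open>(T + 1)\<^bsup>1/k\<^esup>\<close>; this is where the term \<open>Y/k\<close> comes from.\<close>
  define \<rho> where "\<rho> = (\<lambda>x. of_real (T x) *s (Y2 x - Y x) - ((1 / of_nat k) *s Y x - H (Y x)))"
  have \<rho>0: "(\<rho> \<longlongrightarrow> 0) F"
  proof -
    let ?p = "\<lambda>x. (1 + 1 / T x) powr (1 / real k)"
    have fo: "((\<lambda>x. of_real (T x * (?p x - 1) - 1 / k) :: complex) \<longlongrightarrow> of_real 0) F"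
      using first_order_powr[OF T, of "1 / k"] by (intro tendsto_of_real) (simp add: first_order_def)
    have YH: "Bfun (\<lambda>x. H (Y x)) F" by (rule bounded_continuous_image[OF Yb H_cont])
    have TY: "Bfun (\<lambda>x. of_real (T x) *s (Y' x - Y x)) F"
      using Bfun_add[OF tendsto_Bfun[OF asy(1)] bounded_continuous_image[OF YH continuous_on_minus[OF continuous_on_id]]]
      by simp
    have diff: "((\<lambda>x. (Y' x - Y x) $ t) \<longlongrightarrow> 0) F" for t
    proof -
      have "Bfun (\<lambda>x. (of_real (T x) *s (Y' x - Y x)) $ t) F"
        by (rule bounded_continuous_image[OF TY]) (intro continuous_intros)
      then show ?thesis
        using tendsto_inverse_scale[OF T, of "\<lambda>x. (Y' x - Y x) $ t"] by (simp add: right_diff_distrib)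
    qed
    have Y't: "Bfun (\<lambda>x. Y' x $ t) F" for t
    proof -
      have "Bfun (\<lambda>x. Y x $ t) F"
        by (rule bounded_continuous_image[OF Yb]) (intro continuous_intros)
      from Bfun_add[OF tendsto_Bfun[OF diff[of t]] this] show ?thesis by simp
    qed
    have "((\<lambda>x. (of_real (T x * (?p x - 1) - 1 / k) *s Y' x + (1 / of_nat k) *s (Y' x - Y x)
       + (of_real (T x) *s (Y' x - Y x) + H (Y x))) $ t) \<longlongrightarrow> 0) F" for t
    proof -
      have "((\<lambda>x. of_real (T x * (?p x - 1) - 1 / k) * Y' x $ t + (1 / of_nat k) * (Y' x - Y x) $ t
       + (of_real (T x) *s (Y' x - Y x) + H (Y x)) $ t) \<longlongrightarrow> 0 + (1 / of_nat k) * 0 + 0 $ t) F"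
        using fo Y't diff asy(1)
        by (intro tendsto_add tendsto_mult tendsto_const tendsto_vec_nth tendsto_0_mult_Bfun) simp_all
      then show ?thesis
        by (simp only: vector_add_component vector_smult_component zero_index mult_zero_right add_0_left)
    qed
    then have lim: "((\<lambda>x. of_real (T x * (?p x - 1) - 1 / k) *s Y' x + (1 / of_nat k) *s (Y' x - Y x)
       + (of_real (T x) *s (Y' x - Y x) + H (Y x))) \<longlongrightarrow> 0) F"
      by (intro vec_tendstoI) simp
    have "eventually (\<lambda>x. of_real (T x * (?p x - 1) - 1 / k) *s Y' x + (1 / of_nat k) *s (Y' x - Y x)
       + (of_real (T x) *s (Y' x - Y x) + H (Y x)) = \<rho> x) F"
      using T1
    proof eventually_elim
      case (elim x)
      have "T x + 1 = T x * (1 + 1 / T x)" using elim by (simp add: field_simps)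
      then have "(T x + 1) powr (1 / k) = ?p x * T x powr (1 / k)"
        using elim by (simp add: powr_mult)
      then have Y2: "Y2 x = of_real (?p x) *s Y' x" by (simp add: Y2_def Y'_def)
      show ?case unfolding \<rho>_def Y2 by (simp add: vec_eq_iff algebra_simps)
    qed
    with lim show ?thesis by (rule Lim_transform_eventually)
  qed
  have N\<rho>: "eventually (\<lambda>x. N (\<rho> x) < c / 2 * \<eta>) F"
  proof -
    have "eventually (\<lambda>x. norm (\<rho> x) < c / 2 * \<eta> / l2) F"
      using tendstoD[OF \<rho>0, of "c / 2 * \<eta> / l2"] contr(1) \<eta>(1) l(2) by simp
    then show ?thesis
    proof eventually_elim
      case (elim x)
      then have "l2 * norm (\<rho> x) < c / 2 * \<eta>" using l(2) by (simp add: field_simps)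
      with l(4)[of "\<rho> x"] show ?case by linarith
    qed
  qed
  have "eventually (\<lambda>x. T x \<ge> max (1 / s0) (max 1 c)) F"
    using T unfolding filterlim_at_top by blast
  with N\<rho> NY have Y_part: "eventually (\<lambda>x. N (Y2 x - v) < \<eta>) F"
  proof eventually_elim
    case (elim x)
    define s where "s = 1 / T x"
    have T0: "T x > 0" using elim by simp
    have s: "0 < s" "s \<le> s0" "c * s \<le> 1" using elim T0 contr(2) by (auto simp: s_def field_simps)
    define y where "y = Y x - v"
    define Q where "Q = H (v + y) - H v - M *v y"
    have "of_real s *s \<rho> x = (Y2 x - Y x) - of_real s *s ((1 / of_nat k) *s Y x - H (Y x))"
      using T0 by (simp add: \<rho>_def s_def vec_eq_iff field_simps)
    moreover have "(1 / of_nat k) *s Y x - H (Y x) = - (M *v y - (1 / of_nat k) *s y) - Q"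
      by (simp add: Q_def v y_def vec_eq_iff algebra_simps)
    ultimately have eq: "Y2 x - v = (y - of_real s *s (M *v y - (1 / of_nat k) *s y))
        + of_real s *s (\<rho> x + (- 1) *s Q)"
      by (simp add: y_def vec_eq_iff algebra_simps)
    have Ny: "N y < \<eta>" using elim by (simp add: y_def)
    have "N (Y2 x - v) \<le> N (y - of_real s *s (M *v y - (1 / of_nat k) *s y))
        + norm (complex_of_real s) * N (\<rho> x + (- 1) *s Q)"
      unfolding eq using tri scale by metis
    also have "N (\<rho> x + (- 1) *s Q) \<le> N (\<rho> x) + N ((-1) *s Q)" by (rule tri)
    also have "N ((-1) *s Q) = N Q" by (simp only: scale) simp
    also have "N (y - of_real s *s (M *v y - (1 / of_nat k) *s y)) \<le> (1 - c * s) * N y"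
      using s by (intro contr) auto
    also have "N Q \<le> c / 4 * \<eta>" unfolding Q_def by (rule \<eta>(2)[OF Ny])
    also have "(1 - c * s) * N y \<le> (1 - c * s) * \<eta>" using s Ny by (intro mult_left_mono) auto
    also have "N (\<rho> x) \<le> c / 2 * \<eta>" using elim by simp
    finally have "N (Y2 x - v) \<le> (1 - c * s) * \<eta> + s * (c / 2 * \<eta> + c / 4 * \<eta>)"
      using s by simp
    also have "\<dots> < \<eta>" using s contr(1) \<eta>(1) by (simp add: algebra_simps)
    finally show ?case .
  qed
  have "eventually (\<lambda>x. \<forall>j\<in>UNIV. norm (w' x $ j) < (T x + 1) powr (- b)) F"
    using w_part by (intro eventually_ball_finite) auto
  with Y_part show ?thesis
    by eventually_elim (simp add: region_def Y2_def)
qed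

lemma H_gradient: "\<exists>d. complex_gradient_at (\<lambda>u. H u $ t) u d"
  and monomial_multiplier_gradient: "\<exists>d. complex_gradient_at (monomial_multiplier t) u d"
proof -
  have "\<forall>j. \<exists>d. complex_gradient_at (\<lambda>u. of_nat (P t $ j) * A j u) u d"
    using A_gradient complex_gradient_mult[OF complex_gradient_const] by blast
  then obtain d where "\<And>j. complex_gradient_at (\<lambda>u. of_nat (P t $ j) * A j u) u (d j)" by metis
  then have "complex_gradient_at (monomial_multiplier t) u (\<Sum>j\<in>UNIV. d j)"
    unfolding monomial_multiplier_def[abs_def] by (intro complex_gradient_sum)
  then show "\<exists>d. complex_gradient_at (monomial_multiplier t) u d" by blast
  then obtain e where "complex_gradient_at (monomial_multiplier t) u e" by blast
  from complex_gradient_mult[OF complex_gradient_nth[where t = t] this]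
  show "\<exists>d. complex_gradient_at (\<lambda>u. H u $ t) u d" by (auto simp: H_def)
qed

lemma H_hom: "H (c *s u) = c ^ Suc k *s H u"
  by (simp add: H_def monomial_multiplier_def vec_eq_iff A_hom sum_distrib_left algebra_simps)

text \<open>
  Every eigenvalue of \<open>dH(v)\<close> has real part above \<open>1/k\<close>, so \<open>dH(v) - 1/k\<close> admits an adapted norm. The number
  \<open>\<eta>\<close> is chosen so small that the nonlinear part of \<open>H\<close> at \<open>v\<close> takes at most a quarter of the
  contraction. The last fact is the eigenvalue bound for the coordinates in which \<open>v\<close> vanishes and the
  equation \<open>H v = v/k\<close> for the others.
\<close>

lemma adapted_neighbourhood:
  assumes v: "v \<noteq> 0" "H v = (1 / of_nat k) *s v" and attr: "fully_attractive k H v"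
    and re: "\<And>j. Re (A j v) > 0"
  obtains N M c s0 \<eta> b where "norm_on UNIV N" "c > 0" "s0 > 0"
    "\<And>s y. 0 \<le> s \<Longrightarrow> s \<le> s0 \<Longrightarrow>
      N (y - of_real s *s (M *v y - (1 / of_nat k) *s y)) \<le> (1 - c * s) * N y"
    "\<eta> > 0" "\<And>y. N y < \<eta> \<Longrightarrow> N (H (v + y) - H v - M *v y) \<le> c / 4 * \<eta>"
    "b > 0" "\<And>j Y. N (Y - v) < \<eta> \<Longrightarrow> Re (A j Y) \<ge> 3 * b"
    "\<And>t. (if v $ t = 0 then Re (monomial_multiplier t v) > 1 / real k else monomial_multiplier t v = 1 / of_nat k)"
proof -
  obtain M where M: "(H has_derivative (\<lambda>w. M *v w)) (at v)"
    by (rule has_derivative_matrix_of_gradients[of H, OF H_gradient]) blast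
  have spec: "Re \<mu> > 1 / real k" if "w \<noteq> 0" "M *v w = \<mu> *s w" for \<mu> w
  proof -
    have "Re (\<mu> / (1 / of_nat k)) > 1"
      using k by (intro eigenvalues_of_fully_attractive_direction[OF k H_hom M v(1,2) _ attr that]) auto
    then show ?thesis using k by (simp add: field_simps)
  qed
  have mult: "(if v $ t = 0 then Re (monomial_multiplier t v) > 1 / real k else monomial_multiplier t v = 1 / of_nat k)" for t
  proof (cases "v $ t = 0")
    case True
    obtain d where d: "complex_gradient_at (monomial_multiplier t) v d" using monomial_multiplier_gradient by blast
    have Ht: "H u $ t = u $ t * monomial_multiplier t u" for u by (simp add: H_def)
    obtain w where "w \<noteq> 0" "M *v w = monomial_multiplier t v *s w"
      by (rule zero_coordinate_multiplier[OF M Ht d True])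
    from spec[OF this] True show ?thesis by simp
  next
    case False
    have "H v $ t = v $ t * (1 / of_nat k)" using v by simp
    then have "v $ t * monomial_multiplier t v = v $ t * (1 / of_nat k)" by (simp only: H_def vec_lambda_beta)
    then have "monomial_multiplier t v = 1 / of_nat k" using False by (metis mult_cancel_left)
    then show ?thesis using False by simp
  qed
  define B where "B = M - mat (1 / of_nat k)"
  have B: "B *v y = M *v y - (1 / of_nat k) *s y" for y
  proof -
    have "(mat (1 / of_nat k) :: complex ^ 'm ^ 'm) *v y = (1 / of_nat k) *s y"
      by (simp add: vec_eq_iff matrix_vector_mult_def mat_def if_distrib[of "\<lambda>x. x * _"] cong: if_cong)
    then show ?thesis by (simp add: B_def matrix_vector_mult_diff_rdistrib)
  qed
  have specB: "Re \<mu> > 0" if "w \<noteq> 0" "B *v w = \<mu> *s w" for \<mu> w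
  proof -
    have "M *v w = (\<mu> + 1 / of_nat k) *s w"
      using that(2) by (simp add: B vec.scale_left_distrib algebra_simps)
    from spec[OF that(1) this] show ?thesis using k by simp
  qed
  obtain N where N: "norm_on UNIV N" "contracting_on B UNIV N"
    using adapted_norm_exists[of B] specB by blast
  obtain l1 l2 where l: "l1 > 0" "l2 > 0" "\<And>x. l1 * norm x \<le> N x" "\<And>x. N x \<le> l2 * norm x"
    by (rule norm_on_UNIV_equivalent[OF N(1)]) blast
  from N(2) obtain c s0 where c: "c > 0" "s0 > 0" "\<And>s y. 0 \<le> s \<Longrightarrow> s \<le> s0 \<Longrightarrow>
      N (y - of_real s *s (B *v y)) \<le> (1 - c * s) * N y"
    unfolding contracting_on_def by blast
  define b where "b = Min (range (\<lambda>j. Re (A j v))) / 4"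
  have "Min (range (\<lambda>j. Re (A j v))) > 0" using re by (subst Min_gr_iff) auto
  then have b: "b > 0" by (simp add: b_def)
  have bA: "4 * b \<le> Re (A j v)" for j by (simp add: b_def)
  have "eventually (\<lambda>Y. \<forall>j\<in>UNIV. Re (A j Y) > 3 * b) (nhds v)"
  proof (rule eventually_ball_finite)
    show "\<forall>j\<in>UNIV. eventually (\<lambda>Y. Re (A j Y) > 3 * b) (nhds v)"
    proof
      fix j
      have "((\<lambda>Y. Re (A j Y)) \<longlongrightarrow> Re (A j v)) (nhds v)"
        by (intro tendsto_intros A_tendsto filterlim_ident)
      moreover have "3 * b < Re (A j v)" using bA[of j] b by linarith
      ultimately show "eventually (\<lambda>Y. Re (A j Y) > 3 * b) (nhds v)" by (rule order_tendstoD)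
    qed
  qed simp
  then obtain d1 where d1: "d1 > 0" "\<And>Y j. dist Y v < d1 \<Longrightarrow> Re (A j Y) > 3 * b"
    unfolding eventually_nhds_metric by auto
  \<comment> \<open>The factor \<open>l1 / l2\<close> translates an estimate for the Euclidean norm into one for \<open>N\<close>.\<close>
  define \<epsilon> where "\<epsilon> = c * l1 / (4 * l2)"
  have \<epsilon>: "\<epsilon> > 0" using c l by (simp add: \<epsilon>_def)
  obtain d2 where d2: "d2 > 0" "\<And>Y. norm (Y - v) < d2 \<Longrightarrow> norm (H Y - H v - M *v (Y - v)) \<le> \<epsilon> * norm (Y - v)"
    using M[unfolded has_derivative_at_alt] \<epsilon> by blast
  define \<eta> where "\<eta> = l1 * min d1 d2"
  have \<eta>: "\<eta> > 0" using l d1 d2 by (simp add: \<eta>_def)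
  have small: "norm y < min d1 d2" if "N y < \<eta>" for y
  proof -
    have "l1 * norm y < l1 * min d1 d2" using l(3)[of y] that by (simp add: \<eta>_def)
    then show ?thesis using l(1) by (simp only: mult_less_cancel_left_pos)
  qed
  show thesis
  proof (rule that[of N c s0 M \<eta> b])
    show "N (y - of_real s *s (M *v y - (1 / of_nat k) *s y)) \<le> (1 - c * s) * N y"
      if "0 \<le> s" "s \<le> s0" for s y using c(3)[OF that, of y] by (simp only: B)
    show "N (H (v + y) - H v - M *v y) \<le> c / 4 * \<eta>" if "N y < \<eta>" for y
    proof -
      have "N (H (v + y) - H v - M *v y) \<le> l2 * norm (H (v + y) - H v - M *v y)" by (rule l)
      also have "\<dots> \<le> l2 * (\<epsilon> * norm y)"
        using d2(2)[of "v + y"] small[OF that] l by (intro mult_left_mono) auto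
      also have "\<dots> = c / 4 * (l1 * norm y)" using l by (simp add: \<epsilon>_def)
      also have "\<dots> \<le> c / 4 * \<eta>" using l(3)[of y] that c(1) by (intro mult_left_mono) auto
      finally show ?thesis .
    qed
    show "Re (A j Y) \<ge> 3 * b" if "N (Y - v) < \<eta>" for j Y
      using d1(2)[of Y j] small[OF that] by (simp add: dist_norm less_imp_le)
  qed (use N c \<eta> b mult in auto)
qed

text \<open>
  Along \<open>w\<^sub>j = c\<^sub>j T\<^bsup>-Re A\<^sub>j(v)\<^esup>\<close> the monomial \<open>w\<^bsup>P t\<^esup>\<close> decays with the exponent \<open>Re (monomial_multiplier t v)\<close>. This
  is exactly \<open>1/k\<close> if \<open>v\<^sub>t \<noteq> 0\<close>, and then \<open>c\<close> provides the right constant; it is more than \<open>1/k\<close> if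
  \<open>v\<^sub>t = 0\<close>, and then the rescaled monomial tends to \<open>0\<close>.
\<close>

lemma region_nonempty:
  assumes N: "norm_on UNIV N" and \<eta>: "\<eta> > 0" and b: "\<And>j. b < Re (A j v)"
    and mult: "\<And>t. (if v $ t = 0 then Re (monomial_multiplier t v) > 1 / real k else monomial_multiplier t v = 1 / of_nat k)"
    and c: "\<And>j. c $ j \<noteq> 0" "\<And>t. v $ t \<noteq> 0 \<Longrightarrow> mpow c (P t) = v $ t"
  shows "eventually (\<lambda>T. region N v \<eta> b T (\<chi> j. c $ j * of_real (T powr (- Re (A j v))))) at_top"
proof -
  define w where "w = (\<lambda>T. \<chi> j. c $ j * complex_of_real (T powr (- Re (A j v))))"
  have mono: "mpow (w T) (P t) = mpow c (P t) * of_real (T powr (- Re (monomial_multiplier t v)))" if "T > 0" for T t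
  proof -
    have "mpow (w T) (P t) = mpow c (P t) * of_real (\<Prod>j\<in>UNIV. (T powr (- Re (A j v))) ^ P t $ j)"
      by (simp add: w_def mpow_def power_mult_distrib prod.distrib)
    also have "(\<Prod>j\<in>UNIV. (T powr (- Re (A j v))) ^ P t $ j) = (\<Prod>j\<in>UNIV. T powr (- Re (A j v) * P t $ j))"
      using that by (simp add: powr_realpow[symmetric] powr_powr)
    also have "\<dots> = T powr (\<Sum>j\<in>UNIV. - Re (A j v) * P t $ j)"
      using that by (simp add: powr_sum)
    also have "(\<Sum>j\<in>UNIV. - Re (A j v) * P t $ j) = - Re (monomial_multiplier t v)"
      by (simp add: monomial_multiplier_def sum_negf algebra_simps)
    finally show ?thesis .
  qed
  have lim: "((\<lambda>T. of_real (T powr (1 / k)) * gen_monomials P (w T) $ t - v $ t) \<longlongrightarrow> 0) at_top" for t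
  proof -
    have pos: "eventually (\<lambda>T :: real. T > 0) at_top" by (rule eventually_gt_at_top)
    have eq: "eventually (\<lambda>T. mpow c (P t) * of_real (T powr (1 / k - Re (monomial_multiplier t v))) - v $ t
        = of_real (T powr (1 / k)) * gen_monomials P (w T) $ t - v $ t) at_top"
      using pos
    proof eventually_elim
      case (elim T)
      have "T powr (1 / k - Re (monomial_multiplier t v)) = T powr (1 / k) * T powr (- Re (monomial_multiplier t v))"
        using powr_add[of T "1 / k" "- Re (monomial_multiplier t v)"] by simp
      then show ?case using elim by (simp add: gen_monomials_def mono)
    qed
    show ?thesis
    proof (cases "v $ t \<noteq> 0")
      case True
      then have "monomial_multiplier t v = 1 / of_nat k" using mult[of t] by simp
      then have Rem: "Re (monomial_multiplier t v) = 1 / k" by (simp add: Re_divide_of_nat)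
      have "eventually (\<lambda>T. 0 = mpow c (P t) * of_real (T powr (1 / k - Re (monomial_multiplier t v))) - v $ t) at_top"
        using pos by eventually_elim (use c(2)[of t] True Rem in simp)
      then have "((\<lambda>T. mpow c (P t) * of_real (T powr (1 / k - Re (monomial_multiplier t v))) - v $ t) \<longlongrightarrow> 0) at_top"
        by (rule Lim_transform_eventually[OF tendsto_const])
      from Lim_transform_eventually[OF this eq] show ?thesis .
    next
      case False
      then have vt: "v $ t = 0" and gt: "Re (monomial_multiplier t v) > 1 / real k" using mult[of t] by simp_all
      have "((\<lambda>T. T powr (1 / k - Re (monomial_multiplier t v))) \<longlongrightarrow> 0) at_top"
        using gt by (intro tendsto_neg_powr filterlim_ident) auto
      then have "((\<lambda>T. mpow c (P t) * of_real (T powr (1 / k - Re (monomial_multiplier t v))) - v $ t)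
          \<longlongrightarrow> mpow c (P t) * of_real 0 - v $ t) at_top"
        by (intro tendsto_intros)
      then have "((\<lambda>T. mpow c (P t) * of_real (T powr (1 / k - Re (monomial_multiplier t v))) - v $ t) \<longlongrightarrow> 0) at_top"
        using vt by simp
      from Lim_transform_eventually[OF this eq] show ?thesis .
    qed
  qed
  obtain l1 l2 where l: "l1 > 0" "l2 > 0" "\<And>x. l1 * norm x \<le> N x" "\<And>x. N x \<le> l2 * norm x"
    by (rule norm_on_UNIV_equivalent[OF N]) blast
  have "((\<lambda>T. of_real (T powr (1 / k)) *s gen_monomials P (w T) - v) \<longlongrightarrow> 0) at_top"
    using lim by (intro vec_tendstoI) simp
  from tendstoD[OF this, of "\<eta> / l2"]
  have "eventually (\<lambda>T. norm (of_real (T powr (1 / k)) *s gen_monomials P (w T) - v) < \<eta> / l2) at_top"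
    using \<eta> l by simp
  then have 1: "eventually (\<lambda>T. N (of_real (T powr (1 / k)) *s gen_monomials P (w T) - v) < \<eta>) at_top"
  proof eventually_elim
    case (elim T)
    then have "l2 * norm (of_real (T powr (1 / k)) *s gen_monomials P (w T) - v) < \<eta>"
      using l(2) by (simp add: field_simps)
    then show ?case using l(4) le_less_trans by blast
  qed
  have "eventually (\<lambda>T. \<forall>j\<in>UNIV. norm (w T $ j) < T powr (- b)) at_top"
  proof (rule eventually_ball_finite)
    show "\<forall>j\<in>UNIV. eventually (\<lambda>T. norm (w T $ j) < T powr (- b)) at_top"
    proof
      fix j
      have "((\<lambda>T. norm (c $ j) * T powr (b - Re (A j v))) \<longlongrightarrow> norm (c $ j) * 0) at_top"
        using b[of j] by (intro tendsto_intros tendsto_neg_powr filterlim_ident) auto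
      then have "eventually (\<lambda>T. norm (c $ j) * T powr (b - Re (A j v)) < 1) at_top"
        by (intro order_tendstoD) auto
      with eventually_gt_at_top[of "0 :: real"]
      show "eventually (\<lambda>T. norm (w T $ j) < T powr (- b)) at_top"
      proof eventually_elim
        case (elim T)
        have "norm (w T $ j) = (norm (c $ j) * T powr (b - Re (A j v))) * T powr (- b)"
          using elim by (simp add: w_def norm_mult powr_add[symmetric])
        also have "\<dots> < 1 * T powr (- b)" using elim by (intro mult_strict_right_mono) auto
        finally show ?case by simp
      qed
    qed
  qed simp
  with 1 show ?thesis by eventually_elim (simp add: region_def w_def)
qed

lemma region_norm_le: "region N v \<eta> b T w \<Longrightarrow> norm w \<le> real CARD('n) * T powr (- b)"
proof -
  assume "region N v \<eta> b T w"
  then have "norm (w $ j) \<le> T powr (- b)" for j by (auto simp: region_def less_imp_le)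
  then have "norm w \<le> (\<Sum>j\<in>(UNIV :: 'n set). T powr (- b))"
    by (intro order_trans[OF norm_le_sum_nth sum_mono])
  then show ?thesis by simp
qed

lemma open_region:
  assumes N: "norm_on UNIV N"
  shows "open {w. region N v \<eta> b T w}"
proof -
  have gm: "continuous_on UNIV (\<lambda>w. of_real (T powr (1 / k)) *s gen_monomials P w - v)"
  proof -
    have "(\<lambda>w. of_real (T powr (1 / k)) *s gen_monomials P w - v)
        = (\<lambda>w. \<chi> t. of_real (T powr (1 / k)) * mpow w (P t) - v $ t)"
      by (simp add: fun_eq_iff vec_eq_iff gen_monomials_def)
    then show ?thesis by (simp only:) (intro continuous_on_vec_lambda continuous_intros)
  qed
  have "continuous_on UNIV (\<lambda>w. N (of_real (T powr (1 / k)) *s gen_monomials P w - v))"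
    using continuous_on_compose[OF gm continuous_on_subset[OF norm_on_continuous[OF N]]] by (simp add: o_def)
  then have "open {w. N (of_real (T powr (1 / k)) *s gen_monomials P w - v) < \<eta>}"
    by (intro open_Collect_less continuous_on_const)
  moreover have "open {w :: complex ^ 'n. \<forall>j. norm (w $ j) < T powr (- b)}"
  proof -
    have "open (\<Inter>j\<in>(UNIV :: 'n set). {w :: complex ^ 'n. norm (w $ j) < T powr (- b)})"
      by (intro open_INT ballI open_Collect_less continuous_intros) simp
    moreover have "(\<Inter>j\<in>(UNIV :: 'n set). {w :: complex ^ 'n. norm (w $ j) < T powr (- b)})
        = {w. \<forall>j. norm (w $ j) < T powr (- b)}" by auto
    ultimately show ?thesis by simp
  qed
  ultimately show ?thesis by (auto simp: region_def Collect_conj_eq intro: open_Int)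
qed

text \<open>
  A sequence of counterexamples with times tending to infinity would contradict \<open>region_step\<close>. The
  error term is \<open>O(T\<^bsup>-b(l+1)\<^esup>)\<close>, because \<open>|w|\<close>, hence \<open>|z|\<close>, is \<open>O(T\<^bsup>-b\<^esup>)\<close> in the region.
\<close>

lemma region_invariant:
  fixes \<phi> F G :: "complex ^ 'n \<Rightarrow> complex ^ 'n" and b :: real
  assumes g: "r0 > 0" "\<And>j u. norm u < r0 \<Longrightarrow> norm (g j u - A j u) \<le> C * norm u ^ Suc k"
    and N: "norm_on UNIV N"
    and contr: "c > 0" "s0 > 0" "\<And>s y. 0 \<le> s \<Longrightarrow> s \<le> s0 \<Longrightarrow>
      N (y - of_real s *s (M *v y - (1 / of_nat k) *s y)) \<le> (1 - c * s) * N y"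
    and v: "H v = (1 / of_nat k) *s v"
    and \<eta>: "\<eta> > 0" "\<And>y. N y < \<eta> \<Longrightarrow> N (H (v + y) - H v - M *v y) \<le> c / 4 * \<eta>"
    and b: "b > 0" "\<And>j Y. N (Y - v) < \<eta> \<Longrightarrow> Re (A j Y) \<ge> 3 * b"
    and l: "b * Suc l > 1 + 1 / k" "b * Suc l > 1 + b"
    and r: "r > 0" "\<And>z. norm z < r \<Longrightarrow> norm (\<phi> z - z) \<le> norm z / 2"
      "\<And>z. norm z < r \<Longrightarrow> norm (G z) \<le> 2 * norm z" "\<And>z. norm z < r \<Longrightarrow> F (G z) = z"
    and nf: "\<And>z j. norm z < r \<Longrightarrow>
      norm (\<phi> (F z) $ j - lam $ j * \<phi> z $ j * (1 + g j (gen_monomials P (\<phi> z)))) \<le> C' * norm z ^ Suc l"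
  shows "\<exists>T0. \<forall>T\<ge>T0. \<forall>z. norm z < r / 2 \<longrightarrow> region N v \<eta> b T (\<phi> z) \<longrightarrow> region N v \<eta> b (T + 1) (\<phi> (G z))"
proof (rule ccontr)
  assume "\<not> ?thesis"
  then have "\<forall>i :: nat. \<exists>T z. T \<ge> real i \<and> norm z < r / 2 \<and> region N v \<eta> b T (\<phi> z)
      \<and> \<not> region N v \<eta> b (T + 1) (\<phi> (G z))"
    by (meson not_le_imp_less not_less)
  then obtain T z where Ti: "\<And>i. T i \<ge> real i" and z: "\<And>i. norm (z i) < r / 2"
    and reg: "\<And>i. region N v \<eta> b (T i) (\<phi> (z i))"
    and bad: "\<And>i. \<not> region N v \<eta> b (T i + 1) (\<phi> (G (z i)))"
    by metis
  define w where "w i = \<phi> (z i)" for i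
  define w' where "w' i = \<phi> (G (z i))" for i
  define e where "e i = (\<chi> j. w i $ j - lam $ j * w' i $ j * (1 + g j (gen_monomials P (w' i))))" for i
  define n where "n = real CARD('n)"
  have n: "n \<ge> 0" by (simp add: n_def)
  have T: "filterlim T at_top sequentially"
    by (rule filterlim_at_top_mono[OF filterlim_real_sequentially]) (simp add: Ti)
  have T1: "eventually (\<lambda>i. T i \<ge> 1) sequentially" using T by (auto simp: filterlim_at_top)
  have powr0: "((\<lambda>i. T i powr (- p)) \<longlongrightarrow> 0) sequentially" if "p > 0" for p :: real
    using that by (intro tendsto_neg_powr T) auto
  have zr: "norm (z i) < r" for i using z[of i] r(1) by linarith
  have z_le: "norm (z i) \<le> 2 * n * T i powr (- b)" for i
  proof -
    have "norm (z i) \<le> norm (w i) + norm (\<phi> (z i) - z i)"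
      using norm_triangle_ineq4[of "\<phi> (z i)" "\<phi> (z i) - z i"] by (simp add: w_def)
    with r(2)[OF zr, of i] region_norm_le[OF reg, of i] show ?thesis by (simp add: w_def n_def)
  qed
  have Gz: "norm (G (z i)) \<le> 2 * norm (z i)" for i by (rule r(3)[OF zr])
  have Gzr: "norm (G (z i)) < r" for i using z[of i] by (intro le_less_trans[OF Gz]) simp
  have w'_le: "norm (w' i) \<le> 6 * n * T i powr (- b)" for i
  proof -
    have "norm (w' i) \<le> norm (G (z i)) + norm (w' i - G (z i))" by (rule norm_triangle_sub)
    with r(2)[OF Gzr, of i] Gz[of i] z_le[of i] show ?thesis by (simp add: w'_def)
  qed
  have w': "(w' \<longlongrightarrow> 0) sequentially"
  proof (rule Lim_null_comparison)
    show "eventually (\<lambda>i. norm (w' i) \<le> 6 * n * T i powr (- b)) sequentially" using w'_le by simp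
    show "((\<lambda>i. 6 * n * T i powr (- b)) \<longlongrightarrow> 0) sequentially"
      using tendsto_mult[OF tendsto_const[of "6 * n"] powr0[OF b(1)]] by simp
  qed
  have e_le: "norm (e i $ j) \<le> \<bar>C'\<bar> * (4 * n) ^ Suc l * T i powr (- (b * Suc l))" if "T i \<ge> 1" for i j
  proof -
    have "norm (e i $ j) \<le> C' * norm (G (z i)) ^ Suc l"
      using nf[OF Gzr, of i j] r(4)[OF zr, of i] by (simp add: e_def w_def w'_def)
    also have "\<dots> \<le> \<bar>C'\<bar> * norm (G (z i)) ^ Suc l" by (intro mult_right_mono) auto
    also have "norm (G (z i)) \<le> 4 * n * T i powr (- b)" using Gz[of i] z_le[of i] by linarith
    then have "\<bar>C'\<bar> * norm (G (z i)) ^ Suc l \<le> \<bar>C'\<bar> * (4 * n * T i powr (- b)) ^ Suc l"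
      by (intro mult_left_mono power_mono) auto
    also have "(4 * n * T i powr (- b)) ^ Suc l = (4 * n) ^ Suc l * T i powr (- (b * Suc l))"
    proof -
      have "(T i powr (- b)) ^ Suc l = T i powr (- b * Suc l)"
        unfolding powr_powr[symmetric] using that by (intro powr_realpow[symmetric]) simp
      then show ?thesis by (simp only: power_mult_distrib) simp
    qed
    finally show ?thesis by (simp only: mult.assoc)
  qed
  have e_lim: "((\<lambda>i. of_real (T i powr p) * e i $ j) \<longlongrightarrow> 0) sequentially" if "b * Suc l > p" for p j
  proof (rule Lim_null_comparison)
    define K where "K = \<bar>C'\<bar> * (4 * n) ^ Suc l"
    show "eventually (\<lambda>i. norm (of_real (T i powr p) * e i $ j) \<le> K * T i powr (- (b * Suc l - p))) sequentially"
      using T1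
    proof eventually_elim
      case (elim i)
      have "norm (of_real (T i powr p) * e i $ j) = T i powr p * norm (e i $ j)" by (simp add: norm_mult)
      also have "\<dots> \<le> T i powr p * (K * T i powr (- (b * Suc l)))"
        unfolding K_def by (intro mult_left_mono e_le elim) auto
      also have "\<dots> = K * (T i powr p * T i powr (- (b * Suc l)))" by (simp only: ac_simps)
      also have "T i powr p * T i powr (- (b * Suc l)) = T i powr (- (b * Suc l - p))"
        by (simp only: powr_add[symmetric]) simp
      finally show ?case .
    qed
    show "((\<lambda>i. K * T i powr (- (b * Suc l - p))) \<longlongrightarrow> 0) sequentially"
      using tendsto_mult[OF tendsto_const[of K] powr0[of "b * Suc l - p"]] that by simp
  qed
  have "eventually (\<lambda>i. region N v \<eta> b (T i + 1) (w' i)) sequentially"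
  proof (rule region_step[OF g N contr v \<eta> b T w'])
    show "eventually (\<lambda>i. \<forall>j. w i $ j = lam $ j * w' i $ j * (1 + g j (gen_monomials P (w' i))) + e i $ j) sequentially"
      by (simp add: e_def)
    show "eventually (\<lambda>i. region N v \<eta> b (T i) (w i)) sequentially" using reg by (simp add: w_def)
  qed (use l in \<open>auto intro!: e_lim\<close>)
  then obtain i where "region N v \<eta> b (T i + 1) (w' i)" by (auto simp: eventually_sequentially)
  with bad[of i] show False by (simp add: w'_def)
qed

text \<open>
  The starting points are those whose image under \<open>\<phi>\<close> lies in the region of a fixed late time \<open>T\<close>. At step \<open>l\<close>
  the orbit is in the region of time \<open>T + l\<close>, which gives the bound \<open>\<rho> l\<close>. As \<open>\<phi>\<close> is close to the
  identity near \<open>0\<close>, Brouwer's theorem provides a preimage of the chosen point of the region.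
\<close>

lemma uniformly_attracted_open_set:
  fixes \<phi> G :: "complex ^ 'n \<Rightarrow> complex ^ 'n" and b :: real
  assumes N: "norm_on UNIV N" and b: "b > 0"
    and r: "r > 0" "\<And>z. norm z < r \<Longrightarrow> norm (\<phi> z - z) \<le> norm z / 2"
      "\<And>z. norm z < r \<Longrightarrow> norm (G z) \<le> 2 * norm z"
    and \<phi>: "continuous_on UNIV \<phi>"
    and inv: "\<And>T z. T \<ge> T0 \<Longrightarrow> norm z < r / 2 \<Longrightarrow> region N v \<eta> b T (\<phi> z) \<Longrightarrow> region N v \<eta> b (T + 1) (\<phi> (G z))"
    and w: "eventually (\<lambda>T. region N v \<eta> b T (w T) \<and> w T \<noteq> 0) at_top"
  obtains W \<rho> where "open W" "W \<noteq> {}" "0 \<notin> W" "\<rho> \<longlonglongrightarrow> 0"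
    "\<And>l z. z \<in> W \<Longrightarrow> norm ((G ^^ l) z) \<le> \<rho> l" "\<And>l z. z \<in> W \<Longrightarrow> norm ((G ^^ l) z) < r / 2"
proof -
  define n where "n = real CARD('n)"
  have n: "n \<ge> 0" by (simp add: n_def)
  have "((\<lambda>T. n * T powr (- b)) \<longlongrightarrow> n * 0) at_top"
    using b by (intro tendsto_intros tendsto_neg_powr filterlim_ident) auto
  then have "eventually (\<lambda>T. n * T powr (- b) < r / 8) at_top"
    using r(1) by (intro order_tendstoD) auto
  with w have "eventually (\<lambda>T. region N v \<eta> b T (w T) \<and> w T \<noteq> 0 \<and> n * T powr (- b) < r / 8
      \<and> T \<ge> T0 \<and> T \<ge> 1) at_top"
    using eventually_ge_at_top[of T0] eventually_ge_at_top[of 1] by eventually_elim auto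
  then obtain T where T: "region N v \<eta> b T (w T)" "w T \<noteq> 0" "n * T powr (- b) < r / 8" "T \<ge> T0" "T \<ge> 1"
    by (auto dest: eventually_happens)
  define W where "W = {z. norm z < r / 2 \<and> z \<noteq> 0 \<and> region N v \<eta> b T (\<phi> z)}"
  have "W = ball 0 (r / 2) \<inter> (- {0}) \<inter> \<phi> -` {w. region N v \<eta> b T w}"
    by (auto simp: W_def)
  moreover have "open (\<phi> -` {w. region N v \<eta> b T w})"
    by (rule open_vimage[OF open_region[OF N] \<phi>])
  ultimately have "open W" by (auto intro!: open_Int open_Compl)
  moreover have "W \<noteq> {}"
  proof -
    have wT: "norm (w T) \<le> r / 8" using region_norm_le[OF T(1)] T(3) by (simp add: n_def)
    have "\<exists>z\<in>cball 0 (r / 4). \<phi> z = w T"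
    proof (rule brouwer_surjective_cball[where S = "{w T}"])
      show "continuous_on (cball 0 (r / 4)) \<phi>" using \<phi> by (rule continuous_on_subset) simp
      show "r / 4 > 0" using r(1) by simp
      show "x + (y - \<phi> y) \<in> cball 0 (r / 4)" if "x \<in> {w T}" "y \<in> cball 0 (r / 4)" for x y
      proof -
        have y: "norm y \<le> r / 4" using that by simp
        then have "norm y < r" using r(1) by linarith
        then have "norm (\<phi> y - y) \<le> norm y / 2" by (rule r(2))
        moreover have "norm (x + (y - \<phi> y)) \<le> norm x + norm (y - \<phi> y)" by (rule norm_triangle_ineq)
        ultimately have "norm (x + (y - \<phi> y)) \<le> r / 4"
          using that wT y by (simp add: norm_minus_commute)
        then show ?thesis by simp
      qed
    qed simp
    then obtain z where z: "norm z \<le> r / 4" "\<phi> z = w T" by auto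
    have "z \<noteq> 0"
    proof
      assume "z = 0"
      with r(2)[of 0] r(1) z T(2) show False by simp
    qed
    with z T(1) r(1) have "z \<in> W" by (simp add: W_def)
    then show ?thesis by blast
  qed
  moreover have "0 \<notin> W" by (simp add: W_def)
  moreover have lim: "(\<lambda>l. 2 * n * (T + real l) powr (- b)) \<longlonglongrightarrow> 0"
  proof -
    have "filterlim (\<lambda>l. T + real l) at_top sequentially"
      by (rule filterlim_tendsto_add_at_top[OF tendsto_const filterlim_real_sequentially])
    then have "(\<lambda>l. (T + real l) powr (- b)) \<longlonglongrightarrow> 0" using b by (intro tendsto_neg_powr) auto
    from tendsto_mult[OF tendsto_const[of "2 * n"] this] show ?thesis by simp
  qed
  moreover have orbit: "norm ((G ^^ l) z) < r / 2 \<and> region N v \<eta> b (T + real l) (\<phi> ((G ^^ l) z))" if z: "z \<in> W" for l z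
  proof (induction l)
    case 0
    then show ?case using z by (simp add: W_def)
  next
    case (Suc l)
    let ?z = "(G ^^ l) z"
    have reg: "region N v \<eta> b (T + real l + 1) (\<phi> (G ?z))"
      using Suc T(4) by (intro inv) auto
    have "norm (G ?z) < r"
      using r(3)[of ?z] Suc r(1) by linarith
    then have "norm (\<phi> (G ?z) - G ?z) \<le> norm (G ?z) / 2" by (rule r(2))
    moreover have "norm (G ?z) \<le> norm (\<phi> (G ?z)) + norm (\<phi> (G ?z) - G ?z)"
      using norm_triangle_ineq4[of "\<phi> (G ?z)" "\<phi> (G ?z) - G ?z"] by simp
    moreover have "norm (\<phi> (G ?z)) \<le> n * (T + real l + 1) powr (- b)"
      using region_norm_le[OF reg] by (simp add: n_def)
    moreover have "n * (T + real l + 1) powr (- b) \<le> n * T powr (- b)"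
      using T(5) b n by (intro mult_left_mono powr_mono2') auto
    ultimately have "norm (G ?z) < r / 2" using T(3) r(1) by linarith
    then show ?case using reg by (simp add: algebra_simps)
  qed
  moreover have "norm ((G ^^ l) z) \<le> 2 * n * (T + real l) powr (- b)" if z: "z \<in> W" for l z
  proof -
    let ?z = "(G ^^ l) z"
    have "norm ?z < r" using orbit[OF z, of l] r(1) by linarith
    then have "norm (\<phi> ?z - ?z) \<le> norm ?z / 2" by (rule r(2))
    moreover have "norm ?z \<le> norm (\<phi> ?z) + norm (\<phi> ?z - ?z)"
      using norm_triangle_ineq4[of "\<phi> ?z" "\<phi> ?z - ?z"] by simp
    moreover have "norm (\<phi> ?z) \<le> n * (T + real l) powr (- b)"
      using region_norm_le orbit[OF z, of l] by (auto simp: n_def)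
    ultimately show ?thesis by linarith
  qed
  ultimately show thesis by (intro that) auto
qed

end

section \<open>Resonant monomials and truncated normal forms\<close>

lemma mpow_gen_comb: "mpow w (gen_comb P K) = mpow (gen_monomials P w) K"
proof -
  have "mpow w (\<Sum>t\<in>I. K $ t *s P t) = (\<Prod>t\<in>I. mpow w (P t) ^ K $ t)" if "finite I" for I
    using that
  proof (induction I rule: finite_induct)
    case (insert t I)
    have "mpow w (K $ t *s P t) = mpow w (P t) ^ K $ t"
      by (simp add: mpow_def prod_power_distrib power_mult[symmetric] mult.commute)
    with insert show ?case by (simp add: mpow_add)
  qed simp
  from this[of UNIV] show ?thesis
    unfolding gen_comb_def mpow_def[of "gen_monomials P w"] by (simp add: gen_monomials_def)
qed

lemma mdeg_le_mdeg_gen_comb: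
  assumes "\<And>t. P t \<noteq> 0"
  shows "mdeg K \<le> mdeg (gen_comb P K)"
proof -
  have deg: "mdeg (\<Sum>t\<in>I. K $ t *s P t) = (\<Sum>t\<in>I. K $ t * mdeg (P t))" for I
  proof (induction I rule: infinite_finite_induct)
    case (insert t I)
    then show ?case by (simp add: mdeg_add) (simp add: mdeg_def sum_distrib_left)
  qed simp_all
  have "K $ t * 1 \<le> K $ t * mdeg (P t)" for t
    using assms[of t] by (intro mult_left_mono) (simp_all add: mdeg_eq_0_iff[symmetric] Suc_leI)
  then show ?thesis unfolding gen_comb_def deg mdeg_def[of K] by (intro sum_mono) simp
qed

lemma gen_comb_axis: "gen_comb P (axis t 1) = P t"
proof -
  have "gen_comb P (axis t 1) = (\<Sum>s\<in>UNIV. if s = t then P s else 0)"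
    unfolding gen_comb_def by (intro sum.cong) (auto simp: axis_def vec_eq_iff)
  then show ?thesis by simp
qed

text \<open>
  Factoring out \<open>w\<^sub>s\<close> shows that the truncated normal form depends on \<open>w\<close> only through \<open>w\<^sub>s\<close> and the resonant
  monomials.
\<close>

lemma jet_poly_pd_series:
  assumes P: "\<And>t. P t \<noteq> 0" and l: "l \<ge> 1"
  shows "finite {K. K \<noteq> 0 \<and> mdeg (gen_comb P K + axis s 1) \<le> l}"
    and "jet_poly l (pd_series lam P a s) w = lam $ s * w $ s
      + w $ s * (\<Sum>K | K \<noteq> 0 \<and> mdeg (gen_comb P K + axis s 1) \<le> l. a K s * mpow (gen_monomials P w) K)"
proof -
  let ?\<phi> = "\<lambda>K. gen_comb P K + axis s 1"
  let ?K = "{K. K \<noteq> 0 \<and> mdeg (?\<phi> K) \<le> l}"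
  let ?S = "{Q. mdeg Q \<le> l}"
  show fin: "finite ?K"
  proof (rule finite_subset)
    show "?K \<subseteq> {K. mdeg K \<le> l}"
    proof clarify
      fix K assume "mdeg (gen_comb P K + axis s 1) \<le> l"
      then show "mdeg K \<le> l" using mdeg_le_mdeg_gen_comb[of P K, OF P] by (simp add: mdeg_add)
    qed
  qed simp
  have "jet_poly l (pd_series lam P a s) w =
      (\<Sum>Q\<in>?S. (if Q = axis s 1 then lam $ s else 0) * mpow w Q)
      + (\<Sum>Q\<in>?S. \<Sum>K | K \<noteq> 0 \<and> ?\<phi> K = Q. a K s * mpow w (?\<phi> K))"
    by (simp add: jet_poly_def pd_series_def Abs_mfps_inverse distrib_right sum.distrib sum_distrib_right)
  also have "(\<Sum>Q\<in>?S. (if Q = axis s 1 then lam $ s else 0) * mpow w Q)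
      = (\<Sum>Q\<in>{axis s 1}. (if Q = axis s 1 then lam $ s else 0) * mpow w Q)"
    using l by (intro sum.mono_neutral_right) auto
  also have "\<dots> = lam $ s * w $ s" by simp
  also have "(\<Sum>Q\<in>?S. \<Sum>K | K \<noteq> 0 \<and> ?\<phi> K = Q. a K s * mpow w (?\<phi> K))
      = (\<Sum>Q\<in>?S. \<Sum>K | K \<in> ?K \<and> ?\<phi> K = Q. a K s * mpow w (?\<phi> K))"
    by (intro sum.cong) auto
  also have "\<dots> = (\<Sum>K\<in>?K. a K s * mpow w (?\<phi> K))"
    using fin by (intro sum.group) auto
  also have "\<dots> = w $ s * (\<Sum>K\<in>?K. a K s * mpow (gen_monomials P w) K)"
    by (simp add: mpow_add mpow_gen_comb sum_distrib_left algebra_simps)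
  finally show "jet_poly l (pd_series lam P a s) w = lam $ s * w $ s
      + w $ s * (\<Sum>K\<in>?K. a K s * mpow (gen_monomials P w) K)" .
qed

text \<open>
  The truncated normal form contains all monomials of the leading degree \<open>k\<close>, none of lower degree, and
  otherwise finitely many of degree at least \<open>k + 1\<close>.
\<close>

lemma truncated_coefficients_estimate:
  fixes a :: "nat ^ 'm::finite \<Rightarrow> 'n::finite \<Rightarrow> complex"
  assumes a: "\<And>K j. 1 \<le> mdeg K \<Longrightarrow> mdeg K < k \<Longrightarrow> a K j = 0" and k: "k \<ge> 1"
    and fin: "\<And>j. finite (\<K> j)" and K: "\<And>j. {K. mdeg K = k} \<subseteq> \<K> j" "\<And>j. 0 \<notin> \<K> j"
  obtains C where "\<And>j u. norm u < 1 \<Longrightarrow>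
     norm ((\<Sum>K\<in>\<K> j. a K j / lam $ j * mpow u K) - (\<Sum>K | mdeg K = k. a K j / lam $ j * mpow u K))
       \<le> C * norm u ^ Suc k"
proof -
  define C where "C = (\<Sum>j\<in>UNIV. \<Sum>K\<in>\<K> j. norm (a K j / lam $ j))"
  show thesis
  proof (rule that[of C])
    fix j and u :: "complex ^ 'm" assume u: "norm u < 1"
    have "(\<Sum>K\<in>\<K> j. a K j / lam $ j * mpow u K) - (\<Sum>K | mdeg K = k. a K j / lam $ j * mpow u K)
        = (\<Sum>K\<in>\<K> j - {K. mdeg K = k}. a K j / lam $ j * mpow u K)"
      using fin K by (simp add: sum_diff)
    also have "norm \<dots> \<le> (\<Sum>K\<in>\<K> j - {K. mdeg K = k}. norm (a K j / lam $ j) * norm u ^ Suc k)"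
    proof (intro order_trans[OF norm_sum sum_mono])
      fix K assume K': "K \<in> \<K> j - {K. mdeg K = k}"
      then have "K \<noteq> 0" using K(2)[of j] by auto
      then have K1: "mdeg K \<ge> 1" by (simp add: mdeg_eq_0_iff[symmetric] Suc_leI)
      show "norm (a K j / lam $ j * mpow u K) \<le> norm (a K j / lam $ j) * norm u ^ Suc k"
      proof (cases "mdeg K < k")
        case True
        then show ?thesis using a[OF K1] by simp
      next
        case False
        then have "norm u ^ mdeg K \<le> norm u ^ Suc k" using K' u by (intro power_decreasing) auto
        with norm_mpow_le[of u K] have "norm (mpow u K) \<le> norm u ^ Suc k" by linarith
        then show ?thesis by (simp only: norm_mult mult_left_mono norm_ge_zero)
      qed
    qed
    also have "\<dots> \<le> (\<Sum>K\<in>\<K> j. norm (a K j / lam $ j)) * norm u ^ Suc k"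
      unfolding sum_distrib_right using fin by (intro sum_mono2) auto
    also have "\<dots> \<le> C * norm u ^ Suc k"
      unfolding C_def
      by (intro mult_right_mono member_le_sum[of j UNIV "\<lambda>j. \<Sum>K\<in>\<K> j. norm (a K j / lam $ j)"])
         (auto intro: sum_nonneg)
    finally show "norm ((\<Sum>K\<in>\<K> j. a K j / lam $ j * mpow u K) - (\<Sum>K | mdeg K = k. a K j / lam $ j * mpow u K))
       \<le> C * norm u ^ Suc k" .
  qed
qed

text \<open>
  The exponents have a dual basis over the rationals, and \<open>c\<^sub>j\<close> is the exponential of the combination of
  logarithms of \<open>\<theta>\<close> that this basis prescribes.
\<close>

lemma prescribed_monomials:
  fixes P :: "'m::finite \<Rightarrow> nat ^ 'n" and \<theta> :: "'m \<Rightarrow> complex"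
  assumes P: "inj P" and ind: "vec.independent (range (\<lambda>t. (\<chi> h. of_nat (P t $ h)) :: rat ^ 'n))"
    and \<theta>: "\<And>t. \<theta> t \<noteq> 0"
  obtains c where "\<And>j. c $ j \<noteq> 0" "\<And>t. mpow c (P t) = \<theta> t"
proof -
  define p :: "'m \<Rightarrow> rat ^ 'n" where "p t = (\<chi> h. of_nat (P t $ h))" for t
  have injp: "inj p"
    using P by (auto simp: inj_on_def p_def vec_eq_iff)
  have indp: "vec.independent (range p)" using ind by (simp add: p_def[abs_def])
  obtain f :: "rat ^ 'n \<Rightarrow> rat ^ 'm" where lin: "Vector_Spaces.linear (*s) (*s) f"
    and f: "\<And>x. x \<in> range p \<Longrightarrow> f x = axis (inv p x) 1"
    using vec.linear_independent_extend[OF indp, of "\<lambda>x. axis (inv p x) 1"] by blast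
  have fp: "f (p t) = axis t 1" for t using f[of "p t"] injp by simp
  interpret f: Vector_Spaces.linear "(*s)" "(*s)" f by (rule lin)
  have expand: "f x = (\<Sum>j\<in>UNIV. x $ j *s f (axis j 1))" for x
  proof -
    have "f x = f (\<Sum>j\<in>UNIV. x $ j *s axis j 1)" by (simp add: basis_expansion)
    also have "\<dots> = (\<Sum>j\<in>UNIV. x $ j *s f (axis j 1))" by (simp add: f.sum f.scale)
    finally show ?thesis .
  qed
  have delta: "(\<Sum>j\<in>UNIV. of_nat (P t $ j) * f (axis j 1) $ s) = (if s = t then 1 else 0)" for t s
  proof -
    have "(\<Sum>j\<in>UNIV. of_nat (P t $ j) * f (axis j 1) $ s) = (\<Sum>j\<in>UNIV. p t $ j *s f (axis j 1)) $ s"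
      by (simp add: p_def)
    also have "\<dots> = axis t 1 $ s" by (simp only: expand[symmetric] fp)
    finally show ?thesis by (simp add: axis_def)
  qed
  define y where "y j = (\<Sum>s\<in>UNIV. of_rat (f (axis j 1) $ s) * Ln (\<theta> s))" for j
  define c where "c = (\<chi> j. exp (y j))"
  have "mpow c (P t) = \<theta> t" for t
  proof -
    have "mpow c (P t) = exp (\<Sum>j\<in>UNIV. of_nat (P t $ j) * y j)"
      by (simp add: mpow_def c_def exp_sum exp_of_nat_mult)
    also have "(\<Sum>j\<in>UNIV. of_nat (P t $ j) * y j)
        = (\<Sum>s\<in>UNIV. of_rat (\<Sum>j\<in>UNIV. of_nat (P t $ j) * f (axis j 1) $ s) * Ln (\<theta> s))"
      unfolding y_def sum_distrib_left
      by (subst sum.swap) (simp add: of_rat_sum of_rat_mult sum_distrib_right mult.assoc)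
    also have "\<dots> = (\<Sum>s\<in>UNIV. if s = t then Ln (\<theta> s) else 0)"
      by (intro sum.cong) (auto simp: delta)
    also have "\<dots> = Ln (\<theta> t)" by simp
    finally show ?thesis using \<theta> by simp
  qed
  then show thesis by (intro that[of c]) (auto simp: c_def)
qed

text \<open>
  A generator vanishing would contradict independence, and the resonance \<open>e\<^sub>j + P t\<close> says
  \<open>\<lambda>\<^sub>j = \<lambda>\<^sub>j \<lambda>\<^bsup>P t\<^esup>\<close>.
\<close>

lemma resonance_generators:
  fixes P :: "'m::finite \<Rightarrow> nat ^ 'n"
  assumes res: "resonant_with_generators lam P" and nz: "\<And>j. lam $ j \<noteq> 0"
  shows "P t \<noteq> 0" "mpow lam (P t) = 1"
proof -
  have ind: "vec.independent (range (\<lambda>t. (\<chi> h. of_nat (P t $ h)) :: rat ^ 'n))"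
    using res by (simp add: resonant_with_generators_def)
  show "P t \<noteq> 0"
  proof
    assume "P t = 0"
    then have "(0 :: rat ^ 'n) = (\<chi> h. of_nat (P t $ h))" by (simp add: vec_eq_iff)
    then have "(0 :: rat ^ 'n) \<in> range (\<lambda>t. \<chi> h. of_nat (P t $ h))" by (rule range_eqI)
    from vec.dependent_zero[OF this] ind show False by contradiction
  qed
  obtain j :: 'n where True by simp
  have "(j, axis j 1 + gen_comb P (axis t 1)) \<in> {(j, axis j 1 + gen_comb P K) | j K. 1 \<le> mdeg K}"
  proof -
    have "1 \<le> mdeg (axis t 1 :: nat ^ 'm)" by simp
    then show ?thesis by (intro CollectI exI[of _ j] exI[of _ "axis t 1"] conjI refl)
  qed
  then have "(j, axis j 1 + gen_comb P (axis t 1)) \<in> {(j, L). is_resonance lam j L}"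
    using res by (simp add: resonant_with_generators_def)
  then have "is_resonance lam j (axis j 1 + P t)"
    by (simp only: gen_comb_axis mem_Collect_eq case_prod_conv)
  then have "lam $ j = lam $ j * mpow lam (P t)"
    by (simp add: is_resonance_def mpow_add)
  then show "mpow lam (P t) = 1" using nz[of j] by simp
qed

lemma nf_order_eq_enatD:
  fixes a :: "nat ^ 'm::finite \<Rightarrow> 'n \<Rightarrow> complex"
  assumes "nf_order a = enat k"
  shows "k \<ge> 1" "\<And>K j. 1 \<le> mdeg K \<Longrightarrow> mdeg K < k \<Longrightarrow> a K j = 0"
proof -
  have "enat 1 \<le> nf_order a"
    unfolding nf_order_def by (intro INF_greatest) simp
  then show "k \<ge> 1" using assms by simp
  fix K :: "nat ^ 'm" and j assume K: "1 \<le> mdeg K" "mdeg K < k"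
  show "a K j = 0"
  proof (rule ccontr)
    assume "a K j \<noteq> 0"
    with K have "nf_order a \<le> enat (mdeg K)" unfolding nf_order_def by (intro INF_lower) auto
    with assms K show False by simp
  qed
qed

definition coordinate_multiplier :: "complex ^ 'n \<Rightarrow> (nat ^ 'm::finite \<Rightarrow> 'n \<Rightarrow> complex) \<Rightarrow> nat \<Rightarrow> 'n \<Rightarrow> complex ^ 'm \<Rightarrow> complex"
  where "coordinate_multiplier lam a k j u = (\<Sum>K | mdeg K = k. a K j / lam $ j * mpow u K)"

lemma coordinate_multiplier_scale: "coordinate_multiplier lam a k j (c *s u) = c ^ k * coordinate_multiplier lam a k j u"
  by (simp add: coordinate_multiplier_def mpow_scale sum_distrib_left algebra_simps)

lemma coordinate_multiplier_gradient: "\<exists>d. complex_gradient_at (coordinate_multiplier lam a k j) u d"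
proof -
  have "\<forall>K. \<exists>d. complex_gradient_at (\<lambda>u. a K j / lam $ j * mpow u K) u d"
    using complex_gradient_mult[OF complex_gradient_const] complex_gradient_mpow by blast
  then obtain d where "\<And>K. complex_gradient_at (\<lambda>u. a K j / lam $ j * mpow u K) u (d K)" by metis
  then have "complex_gradient_at (\<lambda>u. \<Sum>K | mdeg K = k. a K j / lam $ j * mpow u K) u (\<Sum>K | mdeg K = k. d K)"
    by (intro complex_gradient_sum)
  then show ?thesis by (auto simp: coordinate_multiplier_def[abs_def])
qed

lemma shadow_term_eq:
  "shadow_term lam P a k u
    = (\<chi> t. u $ t * (\<Sum>j\<in>UNIV. of_nat (P t $ j) * coordinate_multiplier lam a k j u))"
proof -
  have "(\<Sum>K | mdeg K = k. (\<Sum>j\<in>UNIV. of_nat (P t $ j) * a K j / lam $ j) * mpow u K)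
      = (\<Sum>j\<in>UNIV. of_nat (P t $ j) * coordinate_multiplier lam a k j u)" for t
    unfolding coordinate_multiplier_def sum_distrib_left sum_distrib_right
    by (subst sum.swap) (simp add: algebra_simps)
  then show ?thesis by (simp add: shadow_term_def)
qed

section \<open>Disjoint basins from one uniformly attracted open set\<close>

text \<open>
  By injectivity the points whose orbit meets a given finite set, or is met by the orbit of one of its
  points, form a countable set, while open sets are uncountable.
\<close>

lemma points_with_disjoint_orbits:
  fixes W :: "'a::euclidean_space set"
  assumes W: "open W" "W \<noteq> {}" and inj: "\<And>l. inj_on (G ^^ l) W"
  shows "\<exists>X. finite X \<and> card X = m \<and> X \<subseteq> W \<and> (\<forall>x\<in>X. \<forall>y\<in>X. x \<noteq> y \<longrightarrow> (\<forall>l. (G ^^ l) x \<noteq> y))"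
proof (induction m)
  case 0
  show ?case by (intro exI[of _ "{}"]) simp
next
  case (Suc m)
  then obtain X where X: "finite X" "card X = m" "X \<subseteq> W"
    "\<And>x y l. x \<in> X \<Longrightarrow> y \<in> X \<Longrightarrow> x \<noteq> y \<Longrightarrow> (G ^^ l) x \<noteq> y" by blast
  define Z where "Z = (\<Union>x\<in>X. \<Union>l. {(G ^^ l) x} \<union> {y \<in> W. (G ^^ l) y = x})"
  have "countable Z"
    unfolding Z_def
  proof (intro countable_UN countable_Un)
    fix x l
    have "(G ^^ l) ` {y \<in> W. (G ^^ l) y = x} \<subseteq> {x}" by auto
    moreover have "inj_on (G ^^ l) {y \<in> W. (G ^^ l) y = x}" using inj by (rule inj_on_subset) auto
    ultimately have "finite {y \<in> W. (G ^^ l) y = x}" by (meson finite.intros finite_imageD finite_subset)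
    then show "countable {y \<in> W. (G ^^ l) y = x}" by (rule countable_finite)
  qed (use X in \<open>auto intro: countable_finite\<close>)
  moreover have "uncountable W"
  proof -
    obtain a e where "e > 0" "ball a e \<subseteq> W" using W by (metis ex_in_conv open_contains_ball)
    then show ?thesis using uncountable_ball countable_subset by blast
  qed
  ultimately obtain z where z: "z \<in> W" "z \<notin> Z" by (metis countable_subset subsetI)
  have zX: "z \<notin> X"
  proof
    assume "z \<in> X"
    then have "z \<in> Z" unfolding Z_def by (intro UN_I[of z] UN_I[of 0]) auto
    with z show False by simp
  qed
  have "(G ^^ l) x \<noteq> z" "(G ^^ l) z \<noteq> x" if "x \<in> X" for x l
    using z that by (auto simp: Z_def)
  with X z zX show ?case
    by (intro exI[of _ "insert z X"]) auto
qed

text \<open>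
  The orbits of points of \<open>W\<close> enter every neighbourhood of \<open>0\<close> after a number of steps that does not
  depend on the point. So the saturated balls around two points can only meet at one of finitely many
  iterates, and continuity of these iterates separates them if the balls are small.
\<close>

lemma disjoint_basins_from_uniform_attraction:
  fixes G :: "complex ^ 'n \<Rightarrow> complex ^ 'n"
  assumes V: "0 \<in> V" "G 0 = 0" and inj: "inj_on G V" and cont: "continuous_on V G"
    and op: "\<And>S. open S \<Longrightarrow> S \<subseteq> V \<Longrightarrow> open (G ` S)"
    and W: "open W" "W \<noteq> {}" "0 \<notin> W" and orbit: "\<And>l z. z \<in> W \<Longrightarrow> (G ^^ l) z \<in> V"
    and \<rho>: "\<rho> \<longlonglongrightarrow> 0" "\<And>l z. z \<in> W \<Longrightarrow> norm ((G ^^ l) z) \<le> \<rho> l"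
  shows "\<exists>\<B>. finite \<B> \<and> card \<B> = m \<and> disjoint \<B> \<and>
    (\<forall>B\<in>\<B>. basin_of_attraction G V B \<and> 0 \<in> frontier B)"
proof -
  have injl: "inj_on (G ^^ l) W" for l
  proof (induction l)
    case (Suc l)
    have "inj_on G ((G ^^ l) ` W)" using inj orbit by (auto intro: inj_on_subset)
    then show ?case using comp_inj_on[OF Suc] by (simp add: comp_def)
  qed simp
  have contl: "continuous_on W (G ^^ l)" for l
  proof (induction l)
    case (Suc l)
    have "continuous_on ((G ^^ l) ` W) G" using cont orbit by (auto intro: continuous_on_subset)
    then show ?case using continuous_on_compose[OF Suc] by (simp add: comp_def)
  qed simp
  have openl: "open ((G ^^ l) ` S)" if "open S" "S \<subseteq> W" for l S
  proof (induction l)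
    case (Suc l)
    have "open (G ` (G ^^ l) ` S)" using orbit that by (intro op Suc) auto
    then show ?case by (simp add: image_comp comp_def)
  qed (use that in simp)
  have G0: "(G ^^ l) 0 = 0" for l by (induction l) (simp_all add: V)
  have nz: "(G ^^ l) z \<noteq> 0" if "z \<in> W" for l z
  proof (induction l)
    case 0
    then show ?case using that W by auto
  next
    case (Suc l)
    show ?case
    proof
      assume "(G ^^ Suc l) z = 0"
      then have "G ((G ^^ l) z) = G 0" using V by simp
      then have "(G ^^ l) z = 0" by (rule inj_onD[OF inj _ orbit[OF that] V(1)])
      with Suc show False by simp
    qed
  qed
  obtain X where X: "finite X" "card X = m" "X \<subseteq> W"
    and sep: "\<And>x y l. x \<in> X \<Longrightarrow> y \<in> X \<Longrightarrow> x \<noteq> y \<Longrightarrow> (G ^^ l) x \<noteq> y"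
    using points_with_disjoint_orbits[OF W(1,2) injl, of m] by blast
  have pair: "eventually (\<lambda>\<epsilon>. \<forall>l. \<forall>p\<in>ball x \<epsilon> \<inter> W. (G ^^ l) p \<notin> ball y \<epsilon>) (at_right 0)"
    if xy: "x \<in> X" "y \<in> X" "x \<noteq> y" for x y
  proof -
    have y0: "norm y > 0" using xy X W by auto
    then have "eventually (\<lambda>l. norm (\<rho> l) < norm y / 2) sequentially"
      using tendstoD[OF \<rho>(1), of "norm y / 2"] by simp
    then obtain L where L: "\<And>l. l \<ge> L \<Longrightarrow> norm (\<rho> l) < norm y / 2" by (auto simp: eventually_sequentially)
    have one: "eventually (\<lambda>\<epsilon>. \<forall>p\<in>ball x \<epsilon> \<inter> W. (G ^^ l) p \<notin> ball y \<epsilon>) (at_right 0)" for l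
    proof -
      define d where "d = dist ((G ^^ l) x) y / 2"
      have d: "d > 0" using sep[OF xy] by (simp add: d_def)
      have "x \<in> W" using xy X by auto
      then obtain e where e: "e > 0" "\<And>p. p \<in> W \<Longrightarrow> dist p x < e \<Longrightarrow> dist ((G ^^ l) p) ((G ^^ l) x) < d"
        using contl[of l] d unfolding continuous_on_iff by blast
      have "eventually (\<lambda>\<epsilon>. \<epsilon> < min d e) (at_right 0)"
        using d e(1) by (intro eventually_at_right_less[THEN eventually_mono] order_tendstoD(2)[OF tendsto_ident_at]) auto
      then show ?thesis
      proof eventually_elim
        case (elim \<epsilon>)
        show ?case
        proof
          fix p assume p: "p \<in> ball x \<epsilon> \<inter> W"
          then have "dist ((G ^^ l) p) ((G ^^ l) x) < d" using elim by (intro e) (auto simp: dist_commute)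
          then have "dist ((G ^^ l) p) y > d"
            using dist_triangle[of "(G ^^ l) x" y "(G ^^ l) p"] by (simp add: d_def dist_commute)
          then show "(G ^^ l) p \<notin> ball y \<epsilon>" using elim by (simp add: dist_commute)
        qed
      qed
    qed
    have "eventually (\<lambda>\<epsilon>. \<forall>l\<in>{..<L}. \<forall>p\<in>ball x \<epsilon> \<inter> W. (G ^^ l) p \<notin> ball y \<epsilon>) (at_right 0)"
      by (rule eventually_ball_finite) (use one in auto)
    moreover have "eventually (\<lambda>\<epsilon>. \<epsilon> < norm y / 2) (at_right (0 :: real))"
      using y0 by (intro order_tendstoD(2)[OF tendsto_ident_at]) auto
    ultimately show ?thesis
    proof eventually_elim
      case (elim \<epsilon>)
      show ?case
      proof (intro allI ballI)
        fix l p assume p: "p \<in> ball x \<epsilon> \<inter> W"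
        show "(G ^^ l) p \<notin> ball y \<epsilon>"
        proof (cases "l < L")
          case True
          with elim p show ?thesis by blast
        next
          case False
          then have "norm ((G ^^ l) p) < norm y / 2"
            using L[of l] \<rho>(2)[of p l] p by (auto intro: le_less_trans)
          moreover have "norm y \<le> norm ((G ^^ l) p) + dist y ((G ^^ l) p)"
            using norm_triangle_sub[of y "(G ^^ l) p"] by (simp add: dist_norm)
          ultimately show ?thesis using elim by simp
        qed
      qed
    qed
  qed
  have "eventually (\<lambda>\<epsilon>. \<forall>x\<in>X. ball x \<epsilon> \<subseteq> W) (at_right 0)"
  proof (rule eventually_ball_finite[OF X(1)], rule ballI)
    fix x assume "x \<in> X"
    then have "x \<in> W" using X(3) by blast
    then obtain e where e: "e > 0" "ball x e \<subseteq> W" using W(1) unfolding open_contains_ball by blast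
    have "eventually (\<lambda>\<epsilon>. \<epsilon> < e) (at_right 0)"
      using e(1) by (intro order_tendstoD(2)[OF tendsto_ident_at])
    then show "eventually (\<lambda>\<epsilon>. ball x \<epsilon> \<subseteq> W) (at_right 0)"
      by eventually_elim (use e(2) in auto)
  qed
  moreover have "eventually (\<lambda>\<epsilon>. \<forall>x\<in>X. \<forall>y\<in>X - {x}. \<forall>l. \<forall>p\<in>ball x \<epsilon> \<inter> W. (G ^^ l) p \<notin> ball y \<epsilon>) (at_right 0)"
    using X(1) pair by (intro eventually_ball_finite ballI) auto
  moreover have "eventually (\<lambda>\<epsilon> :: real. \<epsilon> > 0) (at_right 0)" by (rule eventually_at_right_less)
  ultimately have "eventually (\<lambda>\<epsilon>. \<epsilon> > 0 \<and> (\<forall>x\<in>X. ball x \<epsilon> \<subseteq> W) \<and>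
      (\<forall>x\<in>X. \<forall>y\<in>X - {x}. \<forall>l. \<forall>p\<in>ball x \<epsilon> \<inter> W. (G ^^ l) p \<notin> ball y \<epsilon>)) (at_right 0)"
    by eventually_elim blast
  from eventually_happens'[OF trivial_limit_at_right_real this]
  obtain \<epsilon> where \<epsilon>: "\<epsilon> > 0" "\<forall>x\<in>X. ball x \<epsilon> \<subseteq> W"
    and dis': "\<forall>x\<in>X. \<forall>y\<in>X - {x}. \<forall>l. \<forall>p\<in>ball x \<epsilon> \<inter> W. (G ^^ l) p \<notin> ball y \<epsilon>"
    by (elim exE conjE)
  have sub_W: "ball x \<epsilon> \<subseteq> W" if "x \<in> X" for x using \<epsilon>(2) that by (rule bspec)
  have dis: "(G ^^ l) p \<notin> ball y \<epsilon>" if "x \<in> X" "y \<in> X" "x \<noteq> y" "p \<in> ball x \<epsilon>" for x y l p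
  proof -
    have "p \<in> ball x \<epsilon> \<inter> W" "y \<in> X - {x}" using that sub_W[OF that(1)] by auto
    with dis' \<open>x \<in> X\<close> show ?thesis by (elim ballE allE) auto
  qed
  define B where "B x = (\<Union>l. (G ^^ l) ` ball x \<epsilon>)" for x
  have B_in: "x \<in> B x" for x
    unfolding B_def using \<epsilon>(1) by (intro UN_I[of 0]) auto
  have basin: "basin_of_attraction G V (B x) \<and> 0 \<in> frontier (B x)" if x: "x \<in> X" for x
  proof -
    have open_B: "open (B x)"
      unfolding B_def using sub_W[OF x] by (intro open_UN ballI openl) auto
    have lim: "(\<lambda>l. (G ^^ l) z) \<longlonglongrightarrow> 0" if "z \<in> B x" for z
    proof -
      obtain i p where z: "z = (G ^^ i) p" "p \<in> ball x \<epsilon>" using \<open>z \<in> B x\<close> unfolding B_def by blast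
      have "p \<in> W" using z sub_W[OF x] by auto
      have *: "\<forall>l. norm ((G ^^ l) z) \<le> \<rho> (l + i)"
      proof
        fix l
        have "(G ^^ l) z = (G ^^ (l + i)) p" by (simp add: z funpow_add)
        with \<rho>(2)[OF \<open>p \<in> W\<close>, of "l + i"] show "norm ((G ^^ l) z) \<le> \<rho> (l + i)" by simp
      qed
      show ?thesis
        by (rule Lim_null_comparison[OF always_eventually[OF *] LIMSEQ_ignore_initial_segment[OF \<rho>(1)]])
    qed
    have inv: "G ` B x \<subseteq> B x"
    proof
      fix z assume "z \<in> G ` B x"
      then obtain i p where z: "z = G ((G ^^ i) p)" "p \<in> ball x \<epsilon>" unfolding B_def by blast
      then have "z = (G ^^ Suc i) p" by simp
      with z(2) show "z \<in> B x" unfolding B_def by blast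
    qed
    have orb: "(G ^^ l) x \<in> B x" for l unfolding B_def using \<epsilon>(1) by (intro UN_I[of l]) auto
    have clos: "0 \<in> closure (B x)"
      unfolding closure_sequential using orb lim[OF B_in]
      by (intro exI[of _ "\<lambda>l. (G ^^ l) x"] conjI allI)
    have sub: "B x \<subseteq> V" using orbit sub_W[OF x] by (auto simp: B_def)
    have "0 \<notin> B x"
    proof
      assume "0 \<in> B x"
      then obtain i p where "0 = (G ^^ i) p" "p \<in> ball x \<epsilon>" unfolding B_def by blast
      with nz[of p i] sub_W[OF x] show False by auto
    qed
    then have "0 \<in> frontier (B x)" using clos open_B by (simp add: frontier_def interior_open)
    then show ?thesis
      using open_B lim inv clos sub B_in by (auto simp: basin_of_attraction_def)
  qed
  have disj: "B x \<inter> B y = {}" if xy: "x \<in> X" "y \<in> X" "x \<noteq> y" for x y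
  proof -
    have no: "False" if "x \<in> X" "y \<in> X" "x \<noteq> y" "p \<in> ball x \<epsilon>" "q \<in> ball y \<epsilon>"
      "(G ^^ (i + l)) p = (G ^^ i) q" for x y p q i l
    proof -
      have "(G ^^ i) ((G ^^ l) p) = (G ^^ i) q" using that by (simp add: funpow_add)
      moreover have p: "p \<in> W" "q \<in> W" using that sub_W[OF that(1)] sub_W[OF that(2)] by blast+
      ultimately have "(G ^^ l) p = q"
      proof (induction i)
        case (Suc i)
        have "(G ^^ i) ((G ^^ l) p) \<in> V" "(G ^^ i) q \<in> V"
          using orbit[OF p(1), of "i + l"] orbit[OF p(2)] by (auto simp: funpow_add)
        with Suc.prems have "(G ^^ i) ((G ^^ l) p) = (G ^^ i) q" using inj by (auto dest: inj_onD)
        then show ?case using Suc.IH p by blast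
      qed simp
      with dis[of x y p l] that show False by simp
    qed
    show ?thesis
    proof (rule ccontr)
      assume "B x \<inter> B y \<noteq> {}"
      then obtain i j p q where pq: "p \<in> ball x \<epsilon>" "q \<in> ball y \<epsilon>" "(G ^^ i) p = (G ^^ j) q"
        unfolding B_def by blast
      show False
      proof (cases "j \<le> i")
        case True
        then show ?thesis using no[OF xy pq(1,2), of j "i - j"] pq(3) by simp
      next
        case False
        then show ?thesis using no[OF xy(2,1) xy(3)[symmetric] pq(2,1), of i "j - i"] pq(3) by simp
      qed
    qed
  qed
  have "inj_on B X" using disj B_in by (fastforce simp: inj_on_def)
  then have "card (B ` X) = m" using X by (simp add: card_image)
  moreover have "disjoint (B ` X)"
    unfolding disjoint_def using disj by blast
  ultimately show ?thesis using X(1) basin by (intro exI[of _ "B ` X"]) auto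
qed

section \<open>Repelling basins of parabolically attracting germs\<close>

lemma holomorphic_map_on_continuous_on: "holomorphic_map_on F U \<Longrightarrow> continuous_on U F"
  unfolding holomorphic_map_on_def
  by (metis continuous_at_imp_continuous_on has_derivative_continuous)

text \<open>
  The differential is an isometry, so \<open>F\<close> cannot shrink short vectors by more than a factor of two.
\<close>

lemma inverse_norm_le:
  fixes F :: "complex ^ 'n \<Rightarrow> complex ^ 'n"
  assumes der: "(F has_derivative (\<lambda>z. \<chi> j. lam $ j * z $ j)) (at 0)" "F 0 = 0"
    and lam: "\<And>j. norm (lam $ j) = 1"
  obtains d where "d > 0" "\<And>y. norm y < d \<Longrightarrow> norm y \<le> 2 * norm (F y)"
proof -
  obtain d where d: "d > 0" "\<And>y. norm (y - 0) < d \<Longrightarrow>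
      norm (F y - F 0 - (\<chi> j. lam $ j * (y - 0) $ j)) \<le> 1 / 2 * norm (y - 0)"
    using der(1)[unfolded has_derivative_at_alt, THEN conjunct2, rule_format, of "1 / 2"] by auto
  have "norm y \<le> 2 * norm (F y)" if "norm y < d" for y
  proof -
    have "norm (\<chi> j. lam $ j * y $ j) = norm y" by (simp add: norm_vec_def norm_mult lam)
    moreover have "norm (F y - (\<chi> j. lam $ j * y $ j)) \<le> norm y / 2" using d(2)[of y] that der(2) by simp
    moreover have "norm (\<chi> j. lam $ j * y $ j) \<le> norm (F y) + norm (F y - (\<chi> j. lam $ j * y $ j))"
      using norm_triangle_ineq4[of "F y" "F y - (\<chi> j. lam $ j * y $ j)"] by simp
    ultimately show ?thesis by simp
  qed
  with d(1) show thesis by (rule that)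
qed

theorem corollary5p2:
  fixes F :: "complex ^ 'n \<Rightarrow> complex ^ 'n"
    and U :: "(complex ^ 'n) set"
    and lam :: "complex ^ 'n"
    and P :: "'m::finite \<Rightarrow> nat ^ 'n"
    and k0 :: nat
  assumes "0 \<in> U" and "biholomorphic_on F U" and "F 0 = 0"
    and "(F has_derivative (\<lambda>z. \<chi> j. lam $ j * z $ j)) (at 0)"
    and "resonant_with_generators lam P"
    and "has_weighted_order F lam P (enat k0)"
    and "\<forall>j. norm (lam $ j) = 1"
    and "parabolically_attracting F lam P"
  shows "\<exists>\<B>. finite \<B> \<and> card \<B> = k0 \<and> disjoint \<B> \<and>
    (\<forall>B\<in>\<B>. repelling_basin F U B \<and> 0 \<in> frontier B)"
proof -
  have lam1: "norm (lam $ j) = 1" for j using assms(7) by blast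
  then have lam0: "lam $ j \<noteq> 0" for j by (metis norm_zero zero_neq_one)
  note gens = resonance_generators[OF assms(5) lam0]
  obtain a k v where nf: "is_pd_normal_form F lam P a" and ord: "nf_order a = enat k"
    and v: "nondeg_char_direction (shadow_term lam P a k) v" "fully_attractive k (shadow_term lam P a k) v"
      "shadow_term lam P a k v = (- 1 / of_nat k) *s v"
    and re: "\<And>j. Re (\<Sum>K | mdeg K = k. a K j / lam $ j * mpow v K) < 0"
    using assms(8) unfolding parabolically_attracting_def by blast
  obtain c Phi where taylor: "taylor_at_0 F c" and tangent: "tangent_to_id Phi"
    and conj: "fcompose (pd_series lam P a) Phi = fcompose Phi c"
    using nf unfolding is_pd_normal_form_def by blast
  define A where "A = coordinate_multiplier lam a k"
  have k: "k \<ge> 1" using ord by (rule nf_order_eq_enatD)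
  interpret shadow_data lam P k A
    by unfold_locales
       (use k in \<open>simp_all add: lam1 gens A_def coordinate_multiplier_scale coordinate_multiplier_gradient\<close>)
  have H_eq: "H = shadow_term lam P a k"
    by (simp add: fun_eq_iff shadow_term_eq H_def monomial_multiplier_def) (simp add: A_def)
  \<comment> \<open>A root of \<open>\<zeta>\<^sup>k = -1\<close> turns the attracting direction of \<open>F\<close> into one of the inverse.\<close>
  define \<zeta> where "\<zeta> = cis (pi / real k)"
  have \<zeta>k: "\<zeta> ^ k = - 1" 
  proof -
    have "\<zeta> ^ k = cis (real k * (pi / real k))" unfolding \<zeta>_def by (rule Complex.DeMoivre)
    also have "real k * (pi / real k) = pi" using k by simp
    finally show ?thesis by simp
  qed
  have \<zeta>0: "\<zeta> \<noteq> 0" by (simp add: \<zeta>_def)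
  define v' where "v' = \<zeta> *s v"
  have v'0: "v' \<noteq> 0"
    using v(1) \<zeta>0 by (simp add: v'_def nondeg_char_direction_def)
  have Hv': "H v' = (1 / of_nat k) *s v'"
    using v(3) \<zeta>k by (simp add: v'_def H_hom H_eq[symmetric] vec.scale_minus_left)
  have attr: "fully_attractive k H v'"
    unfolding v'_def fully_attractive_scale[OF \<zeta>0] H_eq by (rule v)
  have re': "Re (A j v') > 0" for j
    using re[of j] by (simp add: v'_def A_hom \<zeta>k) (simp add: A_def coordinate_multiplier_def)
  obtain N M cc s0 \<eta> b where N: "norm_on UNIV N"
    and contr: "cc > 0" "s0 > 0" "\<And>s y. 0 \<le> s \<Longrightarrow> s \<le> s0 \<Longrightarrow>
      N (y - of_real s *s (M *v y - (1 / of_nat k) *s y)) \<le> (1 - cc * s) * N y"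
    and \<eta>: "\<eta> > 0" "\<And>y. N y < \<eta> \<Longrightarrow> N (H (v' + y) - H v' - M *v y) \<le> cc / 4 * \<eta>"
    and b: "b > 0" "\<And>j Y. N (Y - v') < \<eta> \<Longrightarrow> Re (A j Y) \<ge> 3 * b"
    and mult: "\<And>t. if v' $ t = 0 then Re (monomial_multiplier t v') > 1 / real k else monomial_multiplier t v' = 1 / of_nat k"
    by (rule adapted_neighbourhood[OF v'0 Hv' attr re']) blast
  \<comment> \<open>The truncation order has to beat the slow decay \<open>T\<^bsup>-b\<^esup>\<close> in both error conditions of \<open>region_invariant\<close>
    and to retain every monomial of leading degree.\<close>
  obtain l where l: "l \<ge> 1" "b * Suc l > 1 + 1 / k" "b * Suc l > 1 + b"
    "\<And>K :: nat ^ 'm. mdeg K = k \<Longrightarrow> mdeg (gen_comb P K) + 1 \<le> l"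
  proof -
    obtain l1 :: nat where l1: "(1 + 1 / k + 1 + b) / b < l1" using reals_Archimedean2 by blast
    define l where "l = l1 + 1 + Max ((\<lambda>K. mdeg (gen_comb P K) + 1) ` {K :: nat ^ 'm. mdeg K = k})"
    have "1 + 1 / k + 1 + b < b * l1" using l1 b(1) by (simp add: field_simps)
    also have "\<dots> \<le> b * Suc l" using b(1) by (intro mult_left_mono) (auto simp: l_def)
    finally have big: "1 + 1 / k + 1 + b < b * Suc l" .
    have "mdeg (gen_comb P K) + 1 \<le> l" if "mdeg K = k" for K :: "nat ^ 'm"
    proof -
      have "mdeg (gen_comb P K) + 1 \<le> Max ((\<lambda>K. mdeg (gen_comb P K) + 1) ` {K :: nat ^ 'm. mdeg K = k})"
        using that by (intro Max_ge) auto
      then show ?thesis by (simp add: l_def)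
    qed
    moreover have "0 \<le> 1 / real k" by simp
    then have "b * Suc l > 1 + 1 / k" "b * Suc l > 1 + b" using big b(1) by linarith+
    moreover have "l \<ge> 1" by (simp add: l_def)
    ultimately show thesis by (intro that[of l])
  qed
  define \<K> where "\<K> j = {K :: nat ^ 'm. K \<noteq> 0 \<and> mdeg (gen_comb P K + axis j 1) \<le> l}" for j
  define g where "g j u = (\<Sum>K\<in>\<K> j. a K j / lam $ j * mpow u K)" for j and u :: "complex ^ 'm"
  obtain C where g: "\<And>j u. norm u < 1 \<Longrightarrow> norm (g j u - A j u) \<le> C * norm u ^ Suc k"
  proof -
    have fin: "finite (\<K> j)" for j
      unfolding \<K>_def by (rule jet_poly_pd_series(1)[OF gens(1) l(1)])
    have sub: "{K. mdeg K = k} \<subseteq> \<K> j" for j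
      using l(4) k by (force simp: \<K>_def mdeg_add)
    have zero: "0 \<notin> \<K> j" for j by (simp add: \<K>_def)
    show thesis
    proof (rule truncated_coefficients_estimate[of k a \<K> lam, OF nf_order_eq_enatD(2)[OF ord] k fin sub zero])
      fix C
      assume "norm u < 1 \<Longrightarrow>
         norm ((\<Sum>K\<in>\<K> j. a K j / lam $ j * mpow u K) - (\<Sum>K | mdeg K = k. a K j / lam $ j * mpow u K))
           \<le> C * norm u ^ Suc k" for j u
      then have "norm u < 1 \<Longrightarrow> norm (g j u - A j u) \<le> C * norm u ^ Suc k" for j u
        by (simp only: g_def A_def coordinate_multiplier_def)
      then show thesis by (rule that)
    qed
  qed
  define \<phi> where "\<phi> z = (\<chi> j. jet_poly l (Phi j) z)" for z
  have pd: "jet_poly l (pd_series lam P a j) w = lam $ j * w $ j * (1 + g j (gen_monomials P w))" for j w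
    using lam0[of j]
    by (simp add: jet_poly_pd_series(2)[OF gens(1) l(1)] g_def \<K>_def sum_distrib_left sum_distrib_right
        distrib_left algebra_simps)
  obtain C' r1 where nf': "C' > 0" "r1 > 0" "\<And>j z. norm z < r1 \<Longrightarrow>
      norm (jet_poly l (Phi j) (F z) - jet_poly l (pd_series lam P a j) (\<chi> h. jet_poly l (Phi h) z)) \<le> C' * norm z ^ Suc l"
    by (rule bigo_nhds_0E[of "\<lambda>j z. jet_poly l (Phi j) (F z)
        - jet_poly l (pd_series lam P a j) (\<chi> h. jet_poly l (Phi h) z)" "Suc l",
        OF normal_form_up_to_order[OF taylor assms(3) tangent conj]]) blast
  obtain C2 r2 where tan: "C2 > 0" "r2 > 0" "\<And>j z. norm z < r2 \<Longrightarrow>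
      norm (jet_poly l (Phi j) z - z $ j) \<le> C2 * norm z ^ 2"
    by (rule bigo_nhds_0E[of "\<lambda>j z. jet_poly l (Phi j) z - z $ j" 2, OF tangent_to_id_jet[OF tangent l(1)]]) blast
  define V where "V = F ` U"
  define G where "G = inv_into U F"
  have bih: "open U" "inj_on F U" "continuous_on U F" "open V" "continuous_on V G"
    using assms(2) by (auto simp: biholomorphic_on_def V_def G_def holomorphic_map_on_continuous_on)
  have GF: "G (F z) = z" if "z \<in> U" for z using that bih(2) by (simp add: G_def)
  have FG: "F (G z) = z" "G z \<in> U" if "z \<in> V" for z
    using that by (auto simp: V_def G_def f_inv_into_f inv_into_into)
  have V0: "0 \<in> V" unfolding V_def using assms(1,3) by (metis image_eqI)
  have G0: "G 0 = 0" using GF[OF assms(1)] assms(3) by simp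
  obtain d where d: "d > 0" "\<And>y. norm y < d \<Longrightarrow> norm y \<le> 2 * norm (F y)"
    by (rule inverse_norm_le[OF assms(4,3) lam1]) blast
  obtain r3 where r3: "r3 > 0" "ball 0 r3 \<subseteq> V" using bih(4) V0 by (auto simp: open_contains_ball)
  obtain r4 where r4: "r4 > 0" "\<And>z. z \<in> V \<Longrightarrow> norm z < r4 \<Longrightarrow> norm (G z) < d"
    using bih(5)[unfolded continuous_on_iff, rule_format, OF V0 d(1)] by (auto simp: G0)
  define n where "n = real CARD('n)"
  have n: "n > 0" by (simp add: n_def)
  define r where "r = min (min r1 (min r2 (1 / (2 * n * C2)))) (min r3 r4)"
  have r: "r > 0" using nf'(2) tan(1,2) r3(1) r4(1) n by (simp add: r_def)
  have zV: "z \<in> V" if "norm z < r" for z using that r3(2) by (auto simp: r_def)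
  have near: "norm (\<phi> z - z) \<le> norm z / 2" if "norm z < r" for z
  proof -
    have "norm (\<phi> z - z) \<le> (\<Sum>j\<in>(UNIV :: 'n set). C2 * norm z ^ 2)"
      using tan(3)[of z] that by (intro order_trans[OF norm_le_sum_nth sum_mono]) (simp add: \<phi>_def r_def)
    also have "\<dots> = (n * C2 * norm z) * norm z" by (simp add: n_def power2_eq_square)
    also have "\<dots> \<le> 1 / 2 * norm z"
    proof (rule mult_right_mono)
      have "norm z < 1 / (2 * n * C2)" using that by (simp add: r_def)
      then show "n * C2 * norm z \<le> 1 / 2" using n tan(1) by (simp add: field_simps)
    qed simp
    finally show ?thesis by simp
  qed
  have Gle: "norm (G z) \<le> 2 * norm z" if "norm z < r" for z
    using d(2)[OF r4(2)[OF zV[OF that]]] FG(1)[OF zV[OF that]] that by (simp add: r_def)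
  have FGr: "F (G z) = z" if "norm z < r" for z by (rule FG(1)[OF zV[OF that]])
  have nfr: "norm (\<phi> (F z) $ j - lam $ j * \<phi> z $ j * (1 + g j (gen_monomials P (\<phi> z)))) \<le> C' * norm z ^ Suc l"
    if "norm z < r" for z j
  proof -
    have "norm z < r1" using that by (simp add: r_def)
    from nf'(3)[OF this, of j] show ?thesis by (simp only: pd \<phi>_def vec_lambda_beta)
  qed
  obtain T0 where T0: "\<forall>T\<ge>T0. \<forall>z. norm z < r / 2 \<longrightarrow> region N v' \<eta> b T (\<phi> z) \<longrightarrow> region N v' \<eta> b (T + 1) (\<phi> (G z))"
    using region_invariant[OF zero_less_one g N contr Hv' \<eta> b l(2,3) r near Gle FGr nfr] by blast
  \<comment> \<open>Where \<open>v'\<close> vanishes any nonzero value of the monomial will do.\<close>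
  obtain cs where cs: "\<And>j. cs $ j \<noteq> 0" "\<And>t. mpow cs (P t) = (if v' $ t = 0 then 1 else v' $ t)"
    using prescribed_monomials[of P "\<lambda>t. if v' $ t = 0 then 1 else v' $ t"] assms(5)
    unfolding resonant_with_generators_def by (metis zero_neq_one)
  define w where "w T = (\<chi> j. cs $ j * complex_of_real (T powr (- Re (A j v'))))" for T
  have "eventually (\<lambda>T. region N v' \<eta> b T (w T) \<and> w T \<noteq> 0) at_top"
  proof (rule eventually_conj)
    have "b < Re (A j v')" for j
    proof -
      have "N 0 = 0" using N by (metis norm_on_def UNIV_I norm_zero mult_zero_left vec.scale_zero_left)
      then have "3 * b \<le> Re (A j v')" using b(2)[of v' j] \<eta>(1) by simp
      with b(1) show ?thesis by linarith
    qed
    then show "eventually (\<lambda>T. region N v' \<eta> b T (w T)) at_top"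
      unfolding w_def by (intro region_nonempty N \<eta>(1) mult cs(1)) (auto simp: cs(2))
    obtain j :: 'n where True by simp
    show "eventually (\<lambda>T. w T \<noteq> 0) at_top"
      using eventually_gt_at_top[of 0]
    proof eventually_elim
      case (elim T)
      then have "w T $ j \<noteq> 0" using cs(1)[of j] by (simp add: w_def)
      then show ?case by auto
    qed
  qed
  moreover have "continuous_on UNIV \<phi>"
    unfolding \<phi>_def jet_poly_def by (intro continuous_on_vec_lambda continuous_intros)
  ultimately obtain W \<rho> where W: "open W" "W \<noteq> {}" "0 \<notin> W" and \<rho>: "\<rho> \<longlonglongrightarrow> 0"
    "\<And>l z. z \<in> W \<Longrightarrow> norm ((G ^^ l) z) \<le> \<rho> l" and small: "\<And>l z. z \<in> W \<Longrightarrow> norm ((G ^^ l) z) < r / 2"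
    using uniformly_attracted_open_set[OF N b(1) r near Gle, of T0 v' \<eta> w] T0 by blast
  have "\<exists>\<B>. finite \<B> \<and> card \<B> = k0 \<and> disjoint \<B> \<and>
    (\<forall>B\<in>\<B>. basin_of_attraction G V B \<and> 0 \<in> frontier B)"
  proof (rule disjoint_basins_from_uniform_attraction[OF V0 G0 _ bih(5) _ W _ \<rho>])
    show "inj_on G V" unfolding G_def V_def by (rule inj_on_inv_into) simp
    show "open (G ` S)" if S: "open S" "S \<subseteq> V" for S
    proof -
      have "G ` S = U \<inter> F -` S"
      proof
        show "G ` S \<subseteq> U \<inter> F -` S" using S FG by auto
        show "U \<inter> F -` S \<subseteq> G ` S" using GF by force
      qed
      then show ?thesis using continuous_open_preimage[OF bih(3,1) S(1)] by simp
    qed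
    show "(G ^^ l) z \<in> V" if "z \<in> W" for l z
      using small[OF that, of l] r by (intro zV) simp
  qed
  then show ?thesis by (simp add: repelling_basin_def G_def V_def)
qed

end
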